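(* Let $c\ge 1$, let $\mathcal N_c$ be the variety of nilpotent groups of class at most $c$, and let $\mathcal V$ be an arbitrary variety of groups. Let $A$ and $B$ be groups with free presentations $1\to R_1\to F_1\xrightarrow{\nu_1}A\to1$ and $1\to R_2\to F_2\xrightarrow{\nu_2}B\to1$, let $F=F_1*F_2$, and let $S_V$ and $\prod[R_2,F_1,F_2]_c$ be the subgroups of $F$ defined in the context. Then the $\mathcal V$-verbal wreath product $A\,\mathrm{Wr}_V\,B$ of $A$ by $B$ satisfies $$\mathcal N_cM(A\,\mathrm{Wr}_V\,B)\cong\mathcal N_cM(B)\oplus\frac{S_V\cap\gamma_{c+1}(F)}{\prod[R_2,F_1,F_2]_c\,[S_V,\,_cF]}.$$
   Context: Conventions: commutators of several entries are left-normed; for subgroups, $[X,\,_cY]=[X,Y,\dots,Y]$ with $c$ copies of $Y$; $\gamma_{c+1}(X)$ is the $(c+1)$-st term of the lower central series; for a subset $X$ of a group $Y$, $X^Y$ is the normal closure of $X$ in $Y$; $V(X)$ is the verbal subgroup of $X$ for the set of laws $V$ defining $\mathcal V$. For a group $G\cong F/R$ with $F$ free, $\mathcal N_cM(G)=(R\cap\gamma_{c+1}(F))/[R,\,_cF]$ (the Baer invariant with respect to $\mathcal N_c$), which is independent of the choice of free presentation. $\mathcal V$-verbal wreath product: for $b\in B$ let $A_b$ be an isomorphic copy of $A$, with $a_b\in A_b$ corresponding to $a\in A$. Let $C=\prod^*_{b\in B}A_b$ be the free product, $[A_b]^*$ its cartesian subgroup (the kernel of the natural map from $C$ onto the restricted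 direct product of the $A_b$), $C_V=V(C)\cap[A_b]^*$, and $G_V=C/C_V$ (the $\mathcal V$-verbal product of the $A_b$). For fixed $b'\in B$ the map $a_b\mapsto a_{bb'}$ ($a\in A$, $b\in B$) induces an automorphism $\theta_Vb'$ of $G_V$; $A\,\mathrm{Wr}_V\,B$ is the semidirect product of the normal subgroup $G_V$ by $B$ under $\theta_V$. In $F=F_1*F_2$ let $H=F_1^{F_2}$ be the subgroup generated by all conjugates $F_1^{u}$, $u\in F_2$ (that is, the normal closure $F_1^F$). Put $$R_V=V(H)\cap\langle[x,y]: x\in(F_1^u)^H,\ y\in(F_1^v)^H,\ u,v\in F_2\rangle,$$ where $(F_1^u)^H$ is the normal closure of $F_1^u$ in $H$, and $$S_V=[R_2,F_1]^F\,R_1^F\,R_V .$$ Also $$\prod[R_2,F_1,F_2]_c=\langle[r_2,f_1,\dots,f_c]: r_2\in R_2,\ f_i\in F_1\cup F_2\ (1\le i\le c),\ f_k\in F_1\text{ for some }k\rangle^F .$$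
   Formalization: In R_V the elements u, v of F_2 are required to lie in different cosets of R_2; with all u, v allowed the statement fails, e.g. for c=1, B=F_2=1, A=Q_8 and V the abelian law (left side 0, right side Z/2). *)

theory Defs
  imports "HOL-Algebra.Product_Groups" "HOL-Algebra.Weak_Morphisms"
begin

section \<open>Commutators, normal closures, verbal subgroups\<close>

text \<open>The conventions are $[x,y] = x^{-1}y^{-1}xy$ and $x^u = u^{-1}xu$.\<close>

definition gcomm :: "('a, 'm) monoid_scheme \<Rightarrow> 'a \<Rightarrow> 'a \<Rightarrow> 'a" where
  "gcomm G x y = inv\<^bsub>G\<^esub> x \<otimes>\<^bsub>G\<^esub> inv\<^bsub>G\<^esub> y \<otimes>\<^bsub>G\<^esub> x \<otimes>\<^bsub>G\<^esub> y"

definition gconj :: "('a, 'm) monoid_scheme \<Rightarrow> 'a \<Rightarrow> 'a \<Rightarrow> 'a" where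
  "gconj G u x = inv\<^bsub>G\<^esub> u \<otimes>\<^bsub>G\<^esub> x \<otimes>\<^bsub>G\<^esub> u"

definition comm_subgroup :: "('a, 'm) monoid_scheme \<Rightarrow> 'a set \<Rightarrow> 'a set \<Rightarrow> 'a set" where
  "comm_subgroup G X Y = generate G {gcomm G x y | x y. x \<in> X \<and> y \<in> Y}"

primrec iter_comm :: "('a, 'm) monoid_scheme \<Rightarrow> 'a set \<Rightarrow> nat \<Rightarrow> 'a set \<Rightarrow> 'a set" where
  "iter_comm G X 0 Y = X"
| "iter_comm G X (Suc c) Y = comm_subgroup G (iter_comm G X c Y) Y"

text \<open>The lower central series is numbered from $\gamma_1(G) = G$; the value at \<open>0\<close> is junk.\<close>

definition lower_central :: "('a, 'm) monoid_scheme \<Rightarrow> nat \<Rightarrow> 'a set" where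
  "lower_central G n = iter_comm G (carrier G) (n - 1) (carrier G)"

definition normal_closure :: "('a, 'm) monoid_scheme \<Rightarrow> 'a set \<Rightarrow> 'a set" where
  "normal_closure G X = generate G {gconj G g x | g x. g \<in> carrier G \<and> x \<in> X}"

text \<open>A law is a word in the variables $x_0, x_1, \dots$; the letter \<open>(i, True)\<close> stands for
  $x_i$ and \<open>(i, False)\<close> for $x_i^{-1}$. A variety is given by a set of laws.\<close>

type_synonym law = "(nat \<times> bool) list"

definition law_value :: "('a, 'm) monoid_scheme \<Rightarrow> (nat \<Rightarrow> 'a) \<Rightarrow> law \<Rightarrow> 'a" where
  "law_value G x w =
     foldr (\<lambda>(i, b) g. (if b then x i else inv\<^bsub>G\<^esub> (x i)) \<otimes>\<^bsub>G\<^esub> g) w \<one>\<^bsub>G\<^esub>"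

definition verbal_subgroup :: "law set \<Rightarrow> ('a, 'm) monoid_scheme \<Rightarrow> 'a set" where
  "verbal_subgroup V G = generate G {law_value G x w | x w. w \<in> V \<and> range x \<subseteq> carrier G}"


section \<open>Free products and free groups\<close>

text \<open>The free product of the groups \<open>G i\<close>, \<open>i \<in> I\<close>, consists of the words in the disjoint
  union of the \<open>G i\<close>, modulo the congruence that multiplies adjacent letters from the same
  factor and deletes identity letters.\<close>

definition fp_words :: "'i set \<Rightarrow> ('i \<Rightarrow> ('a, 'm) monoid_scheme) \<Rightarrow> ('i \<times> 'a) list set" where
  "fp_words I G = lists (SIGMA i:I. carrier (G i))"

inductive fp_cong ::
  "'i set \<Rightarrow> ('i \<Rightarrow> ('a, 'm) monoid_scheme) \<Rightarrow> ('i \<times> 'a) list \<Rightarrow> ('i \<times> 'a) list \<Rightarrow> bool"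
  for I G where
  fp_one: "i \<in> I \<Longrightarrow> fp_cong I G [(i, \<one>\<^bsub>G i\<^esub>)] []"
| fp_mult: "i \<in> I \<Longrightarrow> a \<in> carrier (G i) \<Longrightarrow> b \<in> carrier (G i) \<Longrightarrow>
    fp_cong I G [(i, a), (i, b)] [(i, a \<otimes>\<^bsub>G i\<^esub> b)]"
| fp_append: "fp_cong I G v v' \<Longrightarrow> fp_cong I G w w' \<Longrightarrow> fp_cong I G (v @ w) (v' @ w')"
| fp_refl: "w \<in> fp_words I G \<Longrightarrow> fp_cong I G w w"
| fp_sym: "fp_cong I G v w \<Longrightarrow> fp_cong I G w v"
| fp_trans: "fp_cong I G u v \<Longrightarrow> fp_cong I G v w \<Longrightarrow> fp_cong I G u w"

definition fp_rel :: "'i set \<Rightarrow> ('i \<Rightarrow> ('a, 'm) monoid_scheme) \<Rightarrow> ('i \<times> 'a) list rel" where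
  "fp_rel I G = {(v, w). fp_cong I G v w}"

definition free_product ::
  "'i set \<Rightarrow> ('i \<Rightarrow> ('a, 'm) monoid_scheme) \<Rightarrow> ('i \<times> 'a) list set monoid" where
  "free_product I G =
     \<lparr>carrier = fp_words I G // fp_rel I G,
      monoid.mult = (\<lambda>X Y. \<Union>v\<in>X. \<Union>w\<in>Y. fp_rel I G `` {v @ w}),
      one = fp_rel I G `` {[]}\<rparr>"

definition fp_incl ::
  "'i set \<Rightarrow> ('i \<Rightarrow> ('a, 'm) monoid_scheme) \<Rightarrow> 'i \<Rightarrow> 'a \<Rightarrow> ('i \<times> 'a) list set" where
  "fp_incl I G i a = fp_rel I G `` {[(i, a)]}"

text \<open>The homomorphism from a free product to \<open>K\<close> induced by homomorphisms
  \<open>f i \<in> hom (G i) K\<close>: the product $\prod_k f_{i_k}(a_k)$ is the same for all words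
  $(i_1,a_1)\cdots(i_n,a_n)$ in a congruence class.\<close>

definition fp_lift ::
  "('b, 'n) monoid_scheme \<Rightarrow> ('i \<Rightarrow> 'a \<Rightarrow> 'b) \<Rightarrow> ('i \<times> 'a) list set \<Rightarrow> 'b" where
  "fp_lift K f X = the_elem ((\<lambda>w. foldr (\<lambda>(i, a) k. f i a \<otimes>\<^bsub>K\<^esub> k) w \<one>\<^bsub>K\<^esub>) ` X)"

text \<open>The free product of two groups, whose carriers may have different types; both are first
  copied into the sum type.\<close>

definition fp2_factor :: "'a monoid \<Rightarrow> 'b monoid \<Rightarrow> bool \<Rightarrow> ('a + 'b) monoid" where
  "fp2_factor G H b = (if b then image_group Inl G else image_group Inr H)"

definition free_product2 ::
  "'a monoid \<Rightarrow> 'b monoid \<Rightarrow> (bool \<times> ('a + 'b)) list set monoid" (infixr \<open>\<star>\<close> 75) where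
  "G \<star> H = free_product UNIV (fp2_factor G H)"

definition fp2_inl :: "'a monoid \<Rightarrow> 'b monoid \<Rightarrow> 'a \<Rightarrow> (bool \<times> ('a + 'b)) list set" where
  "fp2_inl G H a = fp_incl UNIV (fp2_factor G H) True (Inl a)"

definition fp2_inr :: "'a monoid \<Rightarrow> 'b monoid \<Rightarrow> 'b \<Rightarrow> (bool \<times> ('a + 'b)) list set" where
  "fp2_inr G H b = fp_incl UNIV (fp2_factor G H) False (Inr b)"

text \<open>The free group on \<open>X\<close> is the free product of infinite cyclic groups indexed by \<open>X\<close>;
  the integer \<open>n\<close> in the factor of \<open>x\<close> is $x^n$.\<close>

definition free_group :: "'a set \<Rightarrow> ('a \<times> int) list set monoid" where
  "free_group X = free_product X (\<lambda>_. integer_group)"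

definition free_group_lift ::
  "('b, 'n) monoid_scheme \<Rightarrow> ('a \<Rightarrow> 'b) \<Rightarrow> ('a \<times> int) list set \<Rightarrow> 'b" where
  "free_group_lift K f = fp_lift K (\<lambda>x (n :: int). f x [^]\<^bsub>K\<^esub> n)"

definition is_free_on :: "('a, 'm) monoid_scheme \<Rightarrow> 'a set \<Rightarrow> bool" where
  "is_free_on F X \<longleftrightarrow> group F \<and> X \<subseteq> carrier F \<and> free_group_lift F (\<lambda>x. x) \<in> iso (free_group X) F"

definition free_presentation ::
  "('f, 'm) monoid_scheme \<Rightarrow> ('f \<Rightarrow> 'a) \<Rightarrow> ('a, 'n) monoid_scheme \<Rightarrow> bool" where
  "free_presentation F \<nu> G \<longleftrightarrow> (\<exists>X. is_free_on F X) \<and> \<nu> \<in> epi F G"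


section \<open>Baer invariants with respect to nilpotent groups of class at most \<open>c\<close>\<close>

definition baer_invariant_of :: "nat \<Rightarrow> ('f, 'm) monoid_scheme \<Rightarrow> 'f set \<Rightarrow> 'f set monoid" where
  "baer_invariant_of c F R =
     (F\<lparr>carrier := R \<inter> lower_central F (c + 1)\<rparr>) Mod iter_comm F R c (carrier F)"

text \<open>Up to isomorphism the Baer invariant does not depend on the free presentation. The definition uses
  the one in which the free group on the underlying set of \<open>G\<close> is mapped onto \<open>G\<close>.\<close>

definition baer_invariant :: "nat \<Rightarrow> 'a monoid \<Rightarrow> ('a \<times> int) list set set monoid" where
  "baer_invariant c G =
     baer_invariant_of c (free_group (carrier G))
       (kernel (free_group (carrier G)) G (free_group_lift G (\<lambda>g. g)))"


section \<open>Verbal wreath products\<close>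

text \<open>The kernel of the natural map from the free product onto the restricted direct product.\<close>

definition cartesian_subgroup ::
  "'i set \<Rightarrow> ('i \<Rightarrow> 'a monoid) \<Rightarrow> ('i \<times> 'a) list set set" where
  "cartesian_subgroup I G =
     kernel (free_product I G) (sum_group I G)
       (fp_lift (sum_group I G) (\<lambda>i a. \<lambda>j\<in>I. if j = i then a else \<one>\<^bsub>G j\<^esub>))"

definition verbal_product ::
  "law set \<Rightarrow> 'i set \<Rightarrow> ('i \<Rightarrow> 'a monoid) \<Rightarrow> ('i \<times> 'a) list set set monoid" where
  "verbal_product V I G =
     free_product I G Mod (verbal_subgroup V (free_product I G) \<inter> cartesian_subgroup I G)"

text \<open>The automorphism $a_b \mapsto a_{bb'}$ of the free product of copies of \<open>A\<close> maps the
  subgroup that is factored out onto itself, so the induced automorphism of the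
  verbal product maps a coset to its image.\<close>

definition wreath_shift ::
  "'a monoid \<Rightarrow> 'b monoid \<Rightarrow> 'b \<Rightarrow> ('b \<times> 'a) list set \<Rightarrow> ('b \<times> 'a) list set" where
  "wreath_shift A B b' =
     fp_lift (free_product (carrier B) (\<lambda>_. A))
       (\<lambda>b a. fp_incl (carrier B) (\<lambda>_. A) (b \<otimes>\<^bsub>B\<^esub> b') a)"

definition wreath_action ::
  "'a monoid \<Rightarrow> 'b monoid \<Rightarrow> 'b \<Rightarrow> ('b \<times> 'a) list set set \<Rightarrow> ('b \<times> 'a) list set set" where
  "wreath_action A B b' X = wreath_shift A B b' ` X"

text \<open>Since \<open>wreath_action\<close> is a right action of \<open>B\<close>, the semidirect product is
  written as pairs \<open>(b, g)\<close> standing for the product $bg$, with $b^{-1}gb = g\theta_V(b)$.\<close>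

definition verbal_wreath ::
  "law set \<Rightarrow> 'a monoid \<Rightarrow> 'b monoid \<Rightarrow> ('b \<times> ('b \<times> 'a) list set set) monoid" where
  "verbal_wreath V A B =
     (let P = verbal_product V (carrier B) (\<lambda>_. A) in
      \<lparr>carrier = carrier B \<times> carrier P,
       monoid.mult = (\<lambda>(b\<^sub>1, g\<^sub>1) (b\<^sub>2, g\<^sub>2).
         (b\<^sub>1 \<otimes>\<^bsub>B\<^esub> b\<^sub>2, wreath_action A B b\<^sub>2 g\<^sub>1 \<otimes>\<^bsub>P\<^esub> g\<^sub>2)),
       one = (\<one>\<^bsub>B\<^esub>, \<one>\<^bsub>P\<^esub>)\<rparr>)"


section \<open>Subgroups of the free product \<open>F\<close>\<close>

text \<open>In this section \<open>F\<^sub>1\<close>, \<open>F\<^sub>2\<close>, \<open>R\<^sub>1\<close>, \<open>R\<^sub>2\<close> are subgroups of \<open>F\<close>.\<close>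

definition conj_subgroup :: "('f, 'm) monoid_scheme \<Rightarrow> 'f set \<Rightarrow> 'f set \<Rightarrow> 'f set" where
  "conj_subgroup F F\<^sub>1 F\<^sub>2 = generate F (\<Union>u\<in>F\<^sub>2. gconj F u ` F\<^sub>1)"

text \<open>The subgroup $R_V$. The conjugates $F_1^u$ and $F_1^v$ must have different images in
  the wreath product, that is, \<open>u\<close> and \<open>v\<close> must lie in different cosets of \<open>R\<^sub>2\<close>. If
  $u = v$ were allowed, $R_V$ would contain $V(F_1) \cap [F_1,F_1]$, which need not be trivial in
  the wreath product; the same happens modulo $[R_2,F_1]^F$ for $u \neq v$ in one coset.\<close>

definition R_V :: "law set \<Rightarrow> ('f, 'm) monoid_scheme \<Rightarrow> 'f set \<Rightarrow> 'f set \<Rightarrow> 'f set \<Rightarrow> 'f set" where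
  "R_V V F F\<^sub>1 F\<^sub>2 R\<^sub>2 =
     (let H = F\<lparr>carrier := conj_subgroup F F\<^sub>1 F\<^sub>2\<rparr> in
      verbal_subgroup V H \<inter>
      generate F {gcomm F x y | x y u v.
        u \<in> F\<^sub>2 \<and> v \<in> F\<^sub>2 \<and> R\<^sub>2 #>\<^bsub>F\<^esub> u \<noteq> R\<^sub>2 #>\<^bsub>F\<^esub> v \<and>
        x \<in> normal_closure H (gconj F u ` F\<^sub>1) \<and> y \<in> normal_closure H (gconj F v ` F\<^sub>1)})"

definition S_V ::
  "law set \<Rightarrow> ('f, 'm) monoid_scheme \<Rightarrow> 'f set \<Rightarrow> 'f set \<Rightarrow> 'f set \<Rightarrow> 'f set \<Rightarrow> 'f set" where
  "S_V V F F\<^sub>1 F\<^sub>2 R\<^sub>1 R\<^sub>2 =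
     normal_closure F (comm_subgroup F R\<^sub>2 F\<^sub>1) <#>\<^bsub>F\<^esub> normal_closure F R\<^sub>1 <#>\<^bsub>F\<^esub> R_V V F F\<^sub>1 F\<^sub>2 R\<^sub>2"

text \<open>The subgroup $\prod[R_2,F_1,F_2]_c$; \<open>foldl (gcomm F) r [f\<^sub>1, \<dots>, f\<^sub>c]\<close> is the
  left-normed commutator $[r,f_1,\dots,f_c]$.\<close>

definition prod_comm ::
  "nat \<Rightarrow> ('f, 'm) monoid_scheme \<Rightarrow> 'f set \<Rightarrow> 'f set \<Rightarrow> 'f set \<Rightarrow> 'f set" where
  "prod_comm c F F\<^sub>1 F\<^sub>2 R\<^sub>2 =
     normal_closure F {foldl (gcomm F) r fs | r fs.
       r \<in> R\<^sub>2 \<and> length fs = c \<and> set fs \<subseteq> F\<^sub>1 \<union> F\<^sub>2 \<and> set fs \<inter> F\<^sub>1 \<noteq> {}}"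

end

theory Submission
  imports Defs "HOL-Algebra.Zassenhaus"
begin

text \<open>Write $F=F_1*F_2$, let $W$ be the verbal wreath product, $\pi:F\to W$ the map induced by the two
  presentations, $R$ its kernel and $p:F\to F_2$ the retraction that is trivial on $F_1$. The
  kernel of $p$ is $H=F_1^F$.

  The first half of the proof is the equation $S_V=R\cap H$ (\<open>S_V_eq\<close>). The conjugate $f^u$
  ($f\in F_1$, $u\in F_2$) is mapped to the copy of $\nu_1f$ in the factor with index $\nu_2u$, so $\pi$
  maps $H$ onto $C/C_V$ through a map $\rho:H\to C$ onto the free product of the copies of $A$. The kernel
  of $\rho$ is $K=[R_2,F_1]^FR_1^F$, because $f^u$ modulo $K$ depends only on $\nu_1f$ and
  $\nu_2u$, which gives an inverse $C\to H/K$ (\<open>kernel_rho_le_K\<close>). It remains to see that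
  $\rho$ maps $R_V$ onto $C_V=V(C)\cap[A_b]^*$. Both of the subgroups whose intersection is $R_V$ have the
  right images, but the image of an intersection can be smaller than the intersection of the images.
  An element of $C_V$ is therefore lifted explicitly (\<open>C_V_lift\<close>): first to the verbal subgroup of
  the free product of copies of $F_1$, where its components in the factors can be divided off. They are
  again in the verbal subgroup and lie in $R_1$, and what remains is a product of commutators
  between different factors.

  The second half computes the Baer invariant of $F/R$ from $R=R_2S$ and $S=R\cap H\lhd F$. By induction $[R,{}_nF]$ is the product of
  $[R_2,{}_nF_2]$, $\prod[R_2,F_1,F_2]_n$ and $[S,{}_nF]$ (\<open>iter_comm_R_le_Q\<close>). The last two are
  contained in $S$, and the first meets $H$ trivially. Hence $x\mapsto(p(x),\,p(x)^{-1}x)$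
  induces the isomorphism; it is a homomorphism because
  $[S,\gamma_{c+1}(F)]\le[S,{}_cF]$ (\<open>baer_invariant_of_split\<close>).

  Finally $F$ is projective, as a free product of free groups, and a Baer invariant can be computed from
  any projective presentation (\<open>baer_invariant_presentation\<close>): an endomorphism of $F$ that
  is the identity modulo $R$ is the identity on $\gamma_{c+1}(F)$ modulo $[R,{}_cF]$.\<close>

section \<open>Commutators modulo a normal subgroup\<close>

lemma (in group_hom) subgroup_vimage:
  assumes "subgroup K H" shows "subgroup {x \<in> carrier G. h x \<in> K} G"
proof -
  interpret K: subgroup K H by fact
  show ?thesis by (rule G.subgroupI) (auto intro!: exI[of _ "\<one>\<^bsub>G\<^esub>"])
qed

context group begin

text \<open>With associativity and the rule for the inverse of a product these equations reduce every group
  word, so that simplification decides identities of words.\<close>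

lemma inv_mult_cancel [simp]:
  assumes "x \<in> carrier G" "y \<in> carrier G"
  shows "inv x \<otimes> (x \<otimes> y) = y" "x \<otimes> (inv x \<otimes> y) = y"
  using assms by (simp_all flip: m_assoc)

lemma gcomm_closed [simp]:
  "x \<in> carrier G \<Longrightarrow> y \<in> carrier G \<Longrightarrow> gcomm G x y \<in> carrier G"
  by (simp add: gcomm_def)

lemma gconj_closed [simp]:
  "u \<in> carrier G \<Longrightarrow> x \<in> carrier G \<Longrightarrow> gconj G u x \<in> carrier G"
  by (simp add: gconj_def)

lemma gconj_mult:
  "\<lbrakk>u \<in> carrier G; x \<in> carrier G; y \<in> carrier G\<rbrakk> \<Longrightarrow>
    gconj G u (x \<otimes> y) = gconj G u x \<otimes> gconj G u y"
  by (simp add: gconj_def m_assoc)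

lemma gconj_gconj:
  "\<lbrakk>u \<in> carrier G; v \<in> carrier G; x \<in> carrier G\<rbrakk> \<Longrightarrow>
    gconj G u (gconj G v x) = gconj G (v \<otimes> u) x"
  by (simp add: gconj_def m_assoc inv_mult_group)

lemma gconj_gcomm:
  "\<lbrakk>u \<in> carrier G; x \<in> carrier G; y \<in> carrier G\<rbrakk> \<Longrightarrow>
    gconj G u (gcomm G x y) = gcomm G (gconj G u x) (gconj G u y)"
  by (simp add: gconj_def gcomm_def m_assoc inv_mult_group)

lemma gconj_one [simp]: "x \<in> carrier G \<Longrightarrow> gconj G \<one> x = x"
  by (simp add: gconj_def)

lemma gconj_hom: "u \<in> carrier G \<Longrightarrow> gconj G u \<in> hom G G"
  by (rule homI) (simp_all add: gconj_mult)

lemma gcomm_eq_one_iff: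
  assumes "x \<in> carrier G" "y \<in> carrier G"
  shows "gcomm G x y = \<one> \<longleftrightarrow> x \<otimes> y = y \<otimes> x"
proof -
  have "x \<otimes> y = y \<otimes> x \<otimes> gcomm G x y" using assms by (simp add: gcomm_def m_assoc)
  then show ?thesis using assms by (metis gcomm_closed l_cancel_one m_closed r_one)
qed

lemma gcomm_swap:
  "x \<in> carrier G \<Longrightarrow> y \<in> carrier G \<Longrightarrow> gcomm G y x = inv (gcomm G x y)"
  by (simp add: gcomm_def m_assoc inv_mult_group)

lemma normal_gconj_closed: "N \<lhd> G \<Longrightarrow> u \<in> carrier G \<Longrightarrow> x \<in> N \<Longrightarrow> gconj G u x \<in> N"
  by (simp add: gconj_def normal.inv_op_closed1)

lemma normalI_gconj:
  assumes "subgroup N G" "\<And>u x. u \<in> carrier G \<Longrightarrow> x \<in> N \<Longrightarrow> gconj G u x \<in> N"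
  shows "N \<lhd> G"
  unfolding normal_inv_iff
proof (intro conjI ballI)
  fix x h assume "x \<in> carrier G" "h \<in> N"
  then show "x \<otimes> h \<otimes> inv x \<in> N" using assms(2)[of "inv x" h] by (simp add: gconj_def)
qed (rule assms(1))

lemma normal_gcomm_left:
  assumes "N \<lhd> G" "x \<in> N" "y \<in> carrier G" shows "gcomm G x y \<in> N"
proof -
  interpret N: normal N G by fact
  have "gcomm G x y = inv x \<otimes> gconj G y x"
    using assms N.subset by (auto simp: gcomm_def gconj_def m_assoc)
  then show ?thesis using assms normal_gconj_closed by simp
qed

lemma normal_gcomm_right:
  assumes "N \<lhd> G" "x \<in> carrier G" "y \<in> N" shows "gcomm G x y \<in> N"
proof -
  interpret N: normal N G by fact
  have "gcomm G x y = inv (gcomm G y x)"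
    using assms N.subset by (intro gcomm_swap) auto
  then show ?thesis using assms normal_gcomm_left[OF assms(1) assms(3,2)] by simp
qed

lemma generate_gconj_closed:
  assumes "X \<subseteq> carrier G" "u \<in> carrier G" "\<And>x. x \<in> X \<Longrightarrow> gconj G u x \<in> generate G Y"
    "Y \<subseteq> carrier G" "x \<in> generate G X"
  shows "gconj G u x \<in> generate G Y"
proof -
  interpret h: group_hom G G "gconj G u"
    by (simp add: group_hom_def group_hom_axioms_def gconj_hom assms(2))
  have "gconj G u x \<in> generate G (gconj G u ` X)"
    using h.generate_img[OF assms(1)] assms(5) by blast
  also have "\<dots> \<subseteq> generate G Y"
    using assms(3) by (intro generate_subgroup_incl generate_is_subgroup assms(4)) auto
  finally show ?thesis .
qed

lemma normal_generate_gconj: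
  assumes "X \<subseteq> carrier G" "\<And>u x. u \<in> carrier G \<Longrightarrow> x \<in> X \<Longrightarrow> gconj G u x \<in> X"
  shows "generate G X \<lhd> G"
proof (rule normalI_gconj)
  show "subgroup (generate G X) G" using assms(1) by (rule generate_is_subgroup)
  fix u x assume u: "u \<in> carrier G" and x: "x \<in> generate G X"
  show "gconj G u x \<in> generate G X"
    by (rule generate_gconj_closed[OF assms(1) u generate.incl[OF assms(2)[OF u]] assms(1) x])
qed

lemma normal_subset: "N \<lhd> G \<Longrightarrow> N \<subseteq> carrier G"
  by (rule subgroup.subset[OF normal_imp_subgroup])

lemma normal_closure_normal:
  assumes "X \<subseteq> carrier G" shows "normal_closure G X \<lhd> G"
  unfolding normal_closure_def
proof (rule normal_generate_gconj)
  show "{gconj G g x |g x. g \<in> carrier G \<and> x \<in> X} \<subseteq> carrier G" using assms by auto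
next
  fix u y assume "u \<in> carrier G" "y \<in> {gconj G g x |g x. g \<in> carrier G \<and> x \<in> X}"
  then obtain g x where "y = gconj G g x" "g \<in> carrier G" "x \<in> X" by auto
  moreover then have "gconj G u y = gconj G (g \<otimes> u) x"
    using \<open>u \<in> carrier G\<close> assms gconj_gconj[of u g x] by auto
  ultimately show "gconj G u y \<in> {gconj G g x |g x. g \<in> carrier G \<and> x \<in> X}"
    using \<open>u \<in> carrier G\<close> by (intro CollectI exI[of _ "g \<otimes> u"] exI[of _ x]) simp
qed

lemma normal_closure_incl:
  assumes "X \<subseteq> carrier G" "x \<in> X" shows "x \<in> normal_closure G X"
proof -
  have "x = gconj G \<one> x" using assms by auto
  then show ?thesis unfolding normal_closure_def using assms(2) one_closed
    by (intro generate.incl CollectI exI conjI)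
qed

lemma normal_closure_minimal:
  assumes "N \<lhd> G" "X \<subseteq> N" shows "normal_closure G X \<subseteq> N"
  unfolding normal_closure_def
  using assms normal_gconj_closed
  by (intro generate_subgroup_incl) (auto simp: normal_imp_subgroup)

text \<open>Hiding the cosets behind an abstract quotient keeps the rewrite rules for the set
  product of cosets out of computations modulo a normal subgroup.\<close>

lemma quotient_hom:
  assumes "N \<lhd> G"
  obtains Q :: "'a set monoid" and q where "group_hom G Q q"
    "q ` carrier G = carrier Q" "\<forall>x\<in>carrier G. q x = \<one>\<^bsub>Q\<^esub> \<longleftrightarrow> x \<in> N"
proof -
  interpret N: normal N G by fact
  show thesis
  proof (rule that[of "G Mod N" "\<lambda>x. N #> x"])
    show "group_hom G (G Mod N) ((#>) N)"
      by (simp add: group_hom_def group_hom_axioms_def N.factorgroup_is_group N.r_coset_hom_Mod)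
    show "(#>) N ` carrier G = carrier (G Mod N)" by (simp add: carrier_FactGroup)
    show "\<forall>x\<in>carrier G. N #> x = \<one>\<^bsub>G Mod N\<^esub> \<longleftrightarrow> x \<in> N"
      using coset_join1[OF _ _ N.subgroup_axioms] coset_join2[OF _ N.subgroup_axioms] by auto
  qed
qed

lemma gcomm_hom:
  assumes "group_hom G K h" "x \<in> carrier G" "y \<in> carrier G"
  shows "h (gcomm G x y) = gcomm K (h x) (h y)"
proof -
  interpret h: group_hom G K h by fact
  show ?thesis using assms by (simp add: gcomm_def)
qed

lemma gconj_image_hom:
  assumes "group_hom G K h" "x \<in> carrier G" "y \<in> carrier G"
  shows "h (gconj G x y) = gconj K (h x) (h y)"
proof -
  interpret h: group_hom G K h by fact
  show ?thesis using assms by (simp add: gconj_def)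
qed

lemma inv_commute:
  assumes "a \<in> carrier G" "y \<in> carrier G" "a \<otimes> y = y \<otimes> a"
  shows "inv a \<otimes> y = y \<otimes> inv a"
proof -
  have "inv a \<otimes> (a \<otimes> y) \<otimes> inv a = inv a \<otimes> (y \<otimes> a) \<otimes> inv a" using assms(3) by simp
  then show ?thesis using assms(1,2) by (simp add: m_assoc)
qed

lemma subgroup_centralizer:
  assumes "Y \<subseteq> carrier G"
  shows "subgroup {x \<in> carrier G. \<forall>y\<in>Y. x \<otimes> y = y \<otimes> x} G"
proof (rule subgroupI)
  fix a assume a: "a \<in> {x \<in> carrier G. \<forall>y\<in>Y. x \<otimes> y = y \<otimes> x}"
  then have "inv a \<otimes> y = y \<otimes> inv a" if "y \<in> Y" for y
    using that assms by (auto intro: inv_commute)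
  then show "inv a \<in> {x \<in> carrier G. \<forall>y\<in>Y. x \<otimes> y = y \<otimes> x}" using a by auto
next
  fix a b assume a: "a \<in> {x \<in> carrier G. \<forall>y\<in>Y. x \<otimes> y = y \<otimes> x}"
    and b: "b \<in> {x \<in> carrier G. \<forall>y\<in>Y. x \<otimes> y = y \<otimes> x}"
  have "a \<otimes> b \<otimes> y = y \<otimes> (a \<otimes> b)" if "y \<in> Y" for y
  proof -
    have "y \<in> carrier G" using that assms by auto
    moreover have "a \<otimes> y = y \<otimes> a" "b \<otimes> y = y \<otimes> b" using a b that by auto
    moreover have "a \<in> carrier G" "b \<in> carrier G" using a b by auto
    ultimately show ?thesis by (simp add: m_assoc) (simp flip: m_assoc)
  qed
  then show "a \<otimes> b \<in> {x \<in> carrier G. \<forall>y\<in>Y. x \<otimes> y = y \<otimes> x}" using a b by auto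
qed (use assms in \<open>auto intro!: exI[of _ \<one>]\<close>)

text \<open>This is a centralizer in $G/N$, pulled back to $G$.\<close>

lemma subgroup_centralizer_mod:
  assumes "N \<lhd> G" "Y \<subseteq> carrier G"
  shows "subgroup {x \<in> carrier G. \<forall>y\<in>Y. gcomm G x y \<in> N} G"
    and "subgroup {x \<in> carrier G. \<forall>y\<in>Y. gcomm G y x \<in> N} G"
proof -
  obtain Q :: "'a set monoid" and q where q: "group_hom G Q q"
    "q ` carrier G = carrier Q" "\<forall>x\<in>carrier G. q x = \<one>\<^bsub>Q\<^esub> \<longleftrightarrow> x \<in> N"
    by (rule quotient_hom[OF assms(1)])
  interpret q: group_hom G Q q by fact
  have *: "gcomm G x y \<in> N \<longleftrightarrow> q x \<otimes>\<^bsub>Q\<^esub> q y = q y \<otimes>\<^bsub>Q\<^esub> q x"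
    if "x \<in> carrier G" "y \<in> carrier G" for x y
    using that bspec[OF q(3), of "gcomm G x y"] gcomm_hom[OF q(1) that] q.H.gcomm_eq_one_iff by auto
  have "q ` Y \<subseteq> carrier Q" using assms(2) by auto
  from q.H.subgroup_centralizer[OF this]
  have s: "subgroup {x \<in> carrier G. q x \<in> {x \<in> carrier Q. \<forall>y\<in>q ` Y. x \<otimes>\<^bsub>Q\<^esub> y = y \<otimes>\<^bsub>Q\<^esub> x}} G"
    (is "subgroup ?S G")
    by (rule q.subgroup_vimage)
  have "?S = {x \<in> carrier G. \<forall>y\<in>Y. gcomm G x y \<in> N}"
    using assms(2) * by (auto simp: subset_iff)
  then show "subgroup {x \<in> carrier G. \<forall>y\<in>Y. gcomm G x y \<in> N} G" using s by simp
  have "?S = {x \<in> carrier G. \<forall>y\<in>Y. gcomm G y x \<in> N}"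
    using assms(2) * by (auto simp: subset_iff)
  then show "subgroup {x \<in> carrier G. \<forall>y\<in>Y. gcomm G y x \<in> N} G" using s by simp
qed

lemma gcomm_generate_mod:
  assumes "N \<lhd> G" "X \<subseteq> carrier G" "Y \<subseteq> carrier G"
    and "\<And>x y. x \<in> X \<Longrightarrow> y \<in> Y \<Longrightarrow> gcomm G x y \<in> N"
    and "x \<in> generate G X" "y \<in> generate G Y"
  shows "gcomm G x y \<in> N"
proof -
  have gX: "generate G X \<subseteq> carrier G" by (rule generate_incl[OF assms(2)])
  have "X \<subseteq> {x \<in> carrier G. \<forall>y\<in>Y. gcomm G x y \<in> N}" using assms(2,4) by blast
  then have "generate G X \<subseteq> {x \<in> carrier G. \<forall>y\<in>Y. gcomm G x y \<in> N}"
    by (rule generate_subgroup_incl[OF _ subgroup_centralizer_mod(1)[OF assms(1,3)]])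
  then have "Y \<subseteq> {y \<in> carrier G. \<forall>x\<in>generate G X. gcomm G x y \<in> N}"
    using assms(3) by blast
  then have "generate G Y \<subseteq> {y \<in> carrier G. \<forall>x\<in>generate G X. gcomm G x y \<in> N}"
    by (rule generate_subgroup_incl[OF _ subgroup_centralizer_mod(2)[OF assms(1) gX]])
  then show ?thesis using assms(5,6) by blast
qed

section \<open>Iterated commutator subgroups\<close>

lemma comm_subgroup_incl: "x \<in> X \<Longrightarrow> y \<in> Y \<Longrightarrow> gcomm G x y \<in> comm_subgroup G X Y"
  unfolding comm_subgroup_def by (rule generate.incl) blast

lemma comm_subgroup_minimal:
  assumes "subgroup N G" "\<And>x y. x \<in> X \<Longrightarrow> y \<in> Y \<Longrightarrow> gcomm G x y \<in> N"
  shows "comm_subgroup G X Y \<subseteq> N"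
  unfolding comm_subgroup_def
proof (rule generate_subgroup_incl[OF _ assms(1)])
  show "{gcomm G x y |x y. x \<in> X \<and> y \<in> Y} \<subseteq> N" using assms(2) by blast
qed

lemma comm_subgroup_normal:
  assumes "N \<lhd> G" "M \<lhd> G" shows "comm_subgroup G N M \<lhd> G"
proof -
  interpret N: normal N G by fact
  interpret M: normal M G by fact
  show ?thesis unfolding comm_subgroup_def
  proof (rule normal_generate_gconj)
    show "{gcomm G x y |x y. x \<in> N \<and> y \<in> M} \<subseteq> carrier G" using N.subset M.subset by auto
    fix u z assume u: "u \<in> carrier G" and "z \<in> {gcomm G x y |x y. x \<in> N \<and> y \<in> M}"
    then obtain x y where z: "z = gcomm G x y" "x \<in> N" "y \<in> M" by blast
    then have "gconj G u z = gcomm G (gconj G u x) (gconj G u y)"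
      using u N.subset M.subset gconj_gcomm by blast
    moreover have "gconj G u x \<in> N" "gconj G u y \<in> M"
      using z u normal_gconj_closed assms by blast+
    ultimately show "gconj G u z \<in> {gcomm G x y |x y. x \<in> N \<and> y \<in> M}" by blast
  qed
qed

lemma iter_comm_normal: "N \<lhd> G \<Longrightarrow> iter_comm G N n (carrier G) \<lhd> G"
  by (induction n) (simp_all add: comm_subgroup_normal normal_self)

lemma iter_comm_subset: "N \<lhd> G \<Longrightarrow> iter_comm G N n (carrier G) \<subseteq> carrier G"
  using iter_comm_normal normal_imp_subgroup subgroup.subset by blast

lemma iter_comm_shift:
  "iter_comm G (comm_subgroup G X Y) n Y = iter_comm G X (Suc n) Y"
  by (induction n) auto

lemma iter_comm_Suc_subset:
  assumes "N \<lhd> G" shows "iter_comm G N (Suc n) (carrier G) \<subseteq> iter_comm G N n (carrier G)"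
  unfolding iter_comm.simps
proof (rule comm_subgroup_minimal)
  have n: "iter_comm G N n (carrier G) \<lhd> G" by (rule iter_comm_normal[OF assms])
  then show "subgroup (iter_comm G N n (carrier G)) G" by (rule normal_imp_subgroup)
  show "gcomm G x y \<in> iter_comm G N n (carrier G)"
    if "x \<in> iter_comm G N n (carrier G)" "y \<in> carrier G" for x y
    using n that by (rule normal_gcomm_left)
qed

lemma iter_comm_le:
  assumes "N \<lhd> G" shows "iter_comm G N n (carrier G) \<subseteq> N"
proof (induction n)
  case (Suc n) then show ?case using iter_comm_Suc_subset[OF assms, of n] by blast
qed simp

lemma comm_subgroup_mono:
  "X \<subseteq> X' \<Longrightarrow> Y \<subseteq> Y' \<Longrightarrow> comm_subgroup G X Y \<subseteq> comm_subgroup G X' Y'"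
  unfolding comm_subgroup_def by (rule mono_generate) blast

lemma iter_comm_mono:
  assumes "N \<subseteq> M"
  shows "iter_comm G N n (carrier G) \<subseteq> iter_comm G M n (carrier G)"
  by (induction n) (use assms in \<open>simp_all add: comm_subgroup_mono\<close>)

lemma lower_central_Suc: "lower_central G (Suc n) = iter_comm G (carrier G) n (carrier G)"
  by (simp add: lower_central_def)

lemma lower_central_normal: "lower_central G n \<lhd> G"
  by (simp add: lower_central_def iter_comm_normal normal_self)

lemma iter_comm_le_lower_central:
  "N \<lhd> G \<Longrightarrow> iter_comm G N n (carrier G) \<subseteq> lower_central G (Suc n)"
  unfolding lower_central_Suc
  by (simp add: iter_comm_mono normal_imp_subgroup subgroup.subset normal_self)

lemma hall_witt:
  assumes "x \<in> carrier G" "y \<in> carrier G" "z \<in> carrier G"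
  shows "gconj G y (gcomm G (gcomm G x (inv y)) z) \<otimes>
    gconj G z (gcomm G (gcomm G y (inv z)) x) \<otimes>
    gconj G x (gcomm G (gcomm G z (inv x)) y) = \<one>"
  using assms by (simp add: gconj_def gcomm_def m_assoc inv_mult_group)

text \<open>The induction step is the three subgroups lemma: $[\gamma_{n+2},N]=[\gamma_{n+1},G,N]$ is contained
  in the product of $[G,N,\gamma_{n+1}]$ and $[N,\gamma_{n+1},G]$, and the induction hypothesis applies to
  $[N,G]$ and to $N$.\<close>

lemma comm_lower_central:
  assumes "N \<lhd> G" "x \<in> N" "g \<in> lower_central G (Suc n)"
  shows "gcomm G x g \<in> iter_comm G N (Suc n) (carrier G)"
  using assms
proof (induction n arbitrary: N x g)
  case 0
  then show ?case by (simp add: lower_central_def comm_subgroup_incl)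
next
  case (Suc n)
  let ?N' = "comm_subgroup G N (carrier G)" and ?M = "iter_comm G N (Suc (Suc n)) (carrier G)"
  let ?\<gamma> = "lower_central G (Suc n)"
  interpret N: normal N G by fact
  have N': "?N' \<lhd> G" using Suc.prems(1) by (simp add: comm_subgroup_normal normal_self)
  have M: "?M \<lhd> G" using Suc.prems(1) by (rule iter_comm_normal)
  have \<gamma>: "?\<gamma> \<lhd> G" by (rule lower_central_normal)
  have \<gamma>c: "?\<gamma> \<subseteq> carrier G" using \<gamma> normal_imp_subgroup subgroup.subset by blast
  have *: "gcomm G z (gcomm G a b) \<in> ?M" if "z \<in> N" "a \<in> ?\<gamma>" "b \<in> carrier G" for z a b
  proof -
    have c: "a \<in> carrier G" "z \<in> carrier G" using that \<gamma>c N.subset by auto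
    \<comment> \<open>The Hall--Witt identity has inverted second entries; it is applied to \<open>a\<close>, \<open>inv b\<close> and \<open>z\<close>.\<close>
    let ?y = "inv b"
    have y: "?y \<in> carrier G" using that by simp
    have 1: "gcomm G (gcomm G ?y (inv z)) a \<in> ?M"
    proof -
      have "gcomm G (inv z) ?y \<in> ?N'" using that(1) y by (intro comm_subgroup_incl N.m_inv_closed)
      then have "inv (gcomm G (inv z) ?y) \<in> ?N'"
        by (rule subgroup.m_inv_closed[OF normal_imp_subgroup[OF N']])
      then have "gcomm G ?y (inv z) \<in> ?N'"
        using gcomm_swap[of "inv z" ?y] c y by simp
      from Suc.IH[OF N' this that(2)] show ?thesis by (simp only: iter_comm_shift)
    qed
    have 2: "gcomm G (gcomm G z (inv a)) ?y \<in> ?M"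
    proof -
      have "inv a \<in> ?\<gamma>" using that(2) by (rule subgroup.m_inv_closed[OF normal_imp_subgroup[OF \<gamma>]])
      from Suc.IH[OF Suc.prems(1) that(1) this] show ?thesis
        unfolding iter_comm.simps(2)[of G N "Suc n"] using y by (rule comm_subgroup_incl)
    qed
    have 3: "gconj G z (gcomm G (gcomm G ?y (inv z)) a) \<in> ?M"
      "gconj G a (gcomm G (gcomm G z (inv a)) ?y) \<in> ?M"
      by (rule normal_gconj_closed[OF M c(2) 1], rule normal_gconj_closed[OF M c(1) 2])
    have "gconj G ?y (gcomm G (gcomm G a (inv ?y)) z) \<otimes>
      gconj G z (gcomm G (gcomm G ?y (inv z)) a) \<otimes>
      gconj G a (gcomm G (gcomm G z (inv a)) ?y) = \<one>"
      using c y by (intro hall_witt) auto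
    then have "gconj G ?y (gcomm G (gcomm G a (inv ?y)) z) \<otimes>
      (gconj G z (gcomm G (gcomm G ?y (inv z)) a) \<otimes>
      gconj G a (gcomm G (gcomm G z (inv a)) ?y)) = \<one>"
      using c y by (simp add: m_assoc)
    then have "gconj G ?y (gcomm G (gcomm G a (inv ?y)) z) =
      inv (gconj G z (gcomm G (gcomm G ?y (inv z)) a) \<otimes>
      gconj G a (gcomm G (gcomm G z (inv a)) ?y))"
      using c y by (intro inv_equality[symmetric]) auto
    also have "\<dots> \<in> ?M" using 3 M by (intro subgroup.m_inv_closed subgroup.m_closed normal_imp_subgroup)
    finally have "gconj G b (gconj G ?y (gcomm G (gcomm G a (inv ?y)) z)) \<in> ?M"
      using normal_gconj_closed[OF M that(3)] by blast
    then have "gcomm G (gcomm G a b) z \<in> ?M"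
      using c y that by (simp add: gconj_gconj)
    then have "inv (gcomm G (gcomm G a b) z) \<in> ?M"
      using M by (intro subgroup.m_inv_closed normal_imp_subgroup)
    then show ?thesis using gcomm_swap[of "gcomm G a b" z] c that by simp
  qed
  have "lower_central G (Suc (Suc n)) \<subseteq> {g \<in> carrier G. \<forall>z\<in>N. gcomm G z g \<in> ?M}"
    unfolding lower_central_Suc iter_comm.simps(2)[of G "carrier G" n]
  proof (rule comm_subgroup_minimal)
    show "subgroup {g \<in> carrier G. \<forall>z\<in>N. gcomm G z g \<in> ?M} G"
      by (rule subgroup_centralizer_mod(2)[OF M N.subset])
    fix a b assume a: "a \<in> iter_comm G (carrier G) n (carrier G)" and b: "b \<in> carrier G"
    have "a \<in> carrier G" using a \<gamma>c unfolding lower_central_Suc by blast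
    then show "gcomm G a b \<in> {g \<in> carrier G. \<forall>z\<in>N. gcomm G z g \<in> ?M}"
      using *[OF _ a[folded lower_central_Suc] b] b by simp
  qed
  then show ?case using Suc.prems by blast
qed

end

lemma (in group_hom) generate_image_subset:
  assumes "X \<subseteq> carrier G" "h ` X \<subseteq> Y" "Y \<subseteq> carrier H" 
  shows "h ` generate G X \<subseteq> generate H Y"
  using generate_img[OF assms(1)] H.mono_generate[OF assms(2)] assms by auto

lemma (in group_hom) comm_subgroup_image_subset:
  assumes "X \<subseteq> carrier G" "Y \<subseteq> carrier G" "h ` X \<subseteq> X'" "h ` Y \<subseteq> Y'"
    "X' \<subseteq> carrier H" "Y' \<subseteq> carrier H"
  shows "h ` comm_subgroup G X Y \<subseteq> comm_subgroup H X' Y'"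
  unfolding comm_subgroup_def
proof (rule generate_image_subset)
  show "{gcomm G x y |x y. x \<in> X \<and> y \<in> Y} \<subseteq> carrier G"
    "{gcomm H x y |x y. x \<in> X' \<and> y \<in> Y'} \<subseteq> carrier H"
    using assms by (auto intro!: G.gcomm_closed H.gcomm_closed)
  show "h ` {gcomm G x y |x y. x \<in> X \<and> y \<in> Y} \<subseteq> {gcomm H x y |x y. x \<in> X' \<and> y \<in> Y'}"
  proof clarify
    fix x y assume "x \<in> X" "y \<in> Y"
    then have "h (gcomm G x y) = gcomm H (h x) (h y)"
      using assms by (intro G.gcomm_hom group_hom_axioms) auto
    then show "\<exists>x' y'. h (gcomm G x y) = gcomm H x' y' \<and> x' \<in> X' \<and> y' \<in> Y'"
      using \<open>x \<in> X\<close> \<open>y \<in> Y\<close> assms by blast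
  qed
qed

lemma (in group_hom) iter_comm_image_subset:
  assumes "N \<lhd> G" "M \<lhd> H" "h ` N \<subseteq> M"
  shows "h ` iter_comm G N n (carrier G) \<subseteq> iter_comm H M n (carrier H)"
proof (induction n)
  case (Suc n)
  then show ?case
    unfolding iter_comm.simps
    by (intro comm_subgroup_image_subset G.iter_comm_subset[OF assms(1)]
      H.iter_comm_subset[OF assms(2)]) auto
qed (use assms in auto)

lemma (in group_hom) lower_central_image_subset:
  "h ` lower_central G n \<subseteq> lower_central H n"
  unfolding lower_central_def by (intro iter_comm_image_subset G.normal_self H.normal_self) auto

section \<open>Independence of the Baer invariant of the free presentation\<close>

lemma set_mult_iff: "x \<in> H <#>\<^bsub>G\<^esub> K \<longleftrightarrow> (\<exists>h\<in>H. \<exists>k\<in>K. x = h \<otimes>\<^bsub>G\<^esub> k)"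
  by (auto simp: set_mult_def)

lemma group_homI: "group G \<Longrightarrow> group H \<Longrightarrow> h \<in> hom G H \<Longrightarrow> group_hom G H h"
  by (simp add: group_hom_def group_hom_axioms_def)

context group begin

lemma lower_central_subset: "lower_central G n \<subseteq> carrier G"
  by (rule normal_subset[OF lower_central_normal])

lemma lower_central_carrier: "x \<in> lower_central G n \<Longrightarrow> x \<in> carrier G"
  using lower_central_subset by blast

lemma normal_carrier: "N \<lhd> G \<Longrightarrow> x \<in> N \<Longrightarrow> x \<in> carrier G"
  using normal_subset by blast

lemma normal_mult_closed: "N \<lhd> G \<Longrightarrow> x \<in> N \<Longrightarrow> y \<in> N \<Longrightarrow> x \<otimes> y \<in> N"
  by (rule subgroup.m_closed[OF normal_imp_subgroup])

lemma normal_m_inv_closed: "N \<lhd> G \<Longrightarrow> x \<in> N \<Longrightarrow> inv x \<in> N"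
  by (rule subgroup.m_inv_closed[OF normal_imp_subgroup])

lemma normal_one_closed: "N \<lhd> G \<Longrightarrow> \<one> \<in> N"
  by (rule subgroup.one_closed[OF normal_imp_subgroup])

lemma gcomm_mult_commuting:
  assumes c: "a \<in> carrier G" "b \<in> carrier G" "r \<in> carrier G" "s \<in> carrier G"
    and "r \<otimes> b = b \<otimes> r" "r \<otimes> s = s \<otimes> r" "s \<otimes> a = a \<otimes> s"
    and "r \<otimes> gcomm G a b = gcomm G a b \<otimes> r" "s \<otimes> gcomm G a b = gcomm G a b \<otimes> s"
  shows "gcomm G (a \<otimes> r) (b \<otimes> s) = gcomm G a b"
proof -
  have 1: "a \<otimes> r \<otimes> (b \<otimes> s) = a \<otimes> b \<otimes> (r \<otimes> s)"
  proof -
    have "a \<otimes> r \<otimes> (b \<otimes> s) = a \<otimes> (r \<otimes> b) \<otimes> s" using c by (simp add: m_assoc)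
    also have "\<dots> = a \<otimes> (b \<otimes> r) \<otimes> s" using assms by simp
    finally show ?thesis using c by (simp add: m_assoc)
  qed
  have 2: "b \<otimes> s \<otimes> (a \<otimes> r) = b \<otimes> a \<otimes> (r \<otimes> s)"
  proof -
    have "b \<otimes> s \<otimes> (a \<otimes> r) = b \<otimes> (s \<otimes> a) \<otimes> r" using c by (simp add: m_assoc)
    also have "\<dots> = b \<otimes> (a \<otimes> s) \<otimes> r" using assms by simp
    also have "\<dots> = b \<otimes> a \<otimes> (s \<otimes> r)" using c by (simp add: m_assoc)
    finally show ?thesis using assms by simp
  qed
  have 3: "(r \<otimes> s) \<otimes> gcomm G a b = gcomm G a b \<otimes> (r \<otimes> s)"
  proof -
    have "(r \<otimes> s) \<otimes> gcomm G a b = r \<otimes> (gcomm G a b \<otimes> s)"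
      using c assms(9) by (simp add: m_assoc del: inv_mult_cancel)
    also have "\<dots> = (r \<otimes> gcomm G a b) \<otimes> s" using c by (simp add: m_assoc)
    finally show ?thesis using c assms(8) by (simp add: m_assoc)
  qed
  have g: "gcomm G x y = inv (y \<otimes> x) \<otimes> (x \<otimes> y)" if "x \<in> carrier G" "y \<in> carrier G" for x y
    using that by (simp add: gcomm_def m_assoc inv_mult_group)
  have "gcomm G (a \<otimes> r) (b \<otimes> s) = inv (b \<otimes> a \<otimes> (r \<otimes> s)) \<otimes> (a \<otimes> b \<otimes> (r \<otimes> s))"
    using c by (simp add: g 1 2)
  also have "\<dots> = inv (r \<otimes> s) \<otimes> (gcomm G a b \<otimes> (r \<otimes> s))"
    using c by (simp add: g m_assoc inv_mult_group)
  also have "\<dots> = inv (r \<otimes> s) \<otimes> ((r \<otimes> s) \<otimes> gcomm G a b)" using 3 by simp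
  also have "\<dots> = gcomm G a b" using c by simp
  finally show ?thesis .
qed

text \<open>In the commutator $[ar,bs]$ with $a\in\gamma_{n+1}$, $r\in[N,{}_nG]$ and $s\in N$ the factors $r$ and $s$
  have no effect modulo $[N,{}_{n+1}G]$: there $r$ is central, and $s$ commutes with
  $\gamma_{n+1}$, which contains $a$ and $[a,b]$.\<close>

lemma endomorphism_lower_central:
  assumes N: "N \<lhd> G" and \<alpha>: "\<alpha> \<in> hom G G"
    and mod: "\<And>x. x \<in> carrier G \<Longrightarrow> inv x \<otimes> \<alpha> x \<in> N"
    and x: "x \<in> lower_central G (Suc n)"
  shows "inv x \<otimes> \<alpha> x \<in> iter_comm G N n (carrier G)"
  using x
proof (induction n arbitrary: x)
  case 0
  then show ?case using mod by (simp add: lower_central_def)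
next
  case (Suc n)
  interpret \<alpha>: group_hom G G \<alpha> by (intro group_homI \<alpha> is_group)
  let ?M = "iter_comm G N (Suc n) (carrier G)"
  have M: "?M \<lhd> G" by (rule iter_comm_normal[OF N])
  obtain Q :: "'a set monoid" and q where q: "group_hom G Q q"
    and "q ` carrier G = carrier Q" and q1: "\<forall>x\<in>carrier G. q x = \<one>\<^bsub>Q\<^esub> \<longleftrightarrow> x \<in> ?M"
    by (rule quotient_hom[OF M])
  interpret q: group_hom G Q q by (rule q)
  have qeq: "q x = q y \<longleftrightarrow> inv x \<otimes> y \<in> ?M" if "x \<in> carrier G" "y \<in> carrier G" for x y
  proof -
    have "inv x \<otimes> y \<in> ?M \<longleftrightarrow> inv\<^bsub>Q\<^esub> q x \<otimes>\<^bsub>Q\<^esub> q y = \<one>\<^bsub>Q\<^esub>"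
      using bspec[OF q1, of "inv x \<otimes> y"] that by simp
    also have "\<dots> \<longleftrightarrow> q x = q y"
      using that by (metis q.H.inv_closed q.H.inv_equality q.H.inv_inv q.hom_closed q.H.l_inv)
    finally show ?thesis by simp
  qed
  have com: "q x \<otimes>\<^bsub>Q\<^esub> q y = q y \<otimes>\<^bsub>Q\<^esub> q x" if "x \<in> carrier G" "y \<in> carrier G" "gcomm G x y \<in> ?M" for x y
    using that bspec[OF q1, of "gcomm G x y"] gcomm_hom[OF q, of x y] q.H.gcomm_eq_one_iff by auto
  have "lower_central G (Suc (Suc n)) \<subseteq> {x \<in> carrier G. q (\<alpha> x) = q x}"
    unfolding lower_central_Suc iter_comm.simps(2)[of G "carrier G"]
  proof (rule comm_subgroup_minimal)
    show "subgroup {x \<in> carrier G. q (\<alpha> x) = q x} G"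
      by (rule subgroupI) (auto intro!: exI[of _ "\<one>"])
  next
    fix a b assume ab: "a \<in> iter_comm G (carrier G) n (carrier G)" "b \<in> carrier G"
    from ab(1) have a: "a \<in> lower_central G (Suc n)" unfolding lower_central_Suc .
    have ac: "a \<in> carrier G" by (rule lower_central_carrier[OF a])
    define r s where "r = inv a \<otimes> \<alpha> a" and "s = inv b \<otimes> \<alpha> b"
    have r: "r \<in> iter_comm G N n (carrier G)" unfolding r_def by (rule Suc.IH[OF a])
    have s: "s \<in> N" unfolding s_def by (rule mod[OF ab(2)])
    have rc: "r \<in> carrier G" "s \<in> carrier G" using ac ab(2) by (auto simp: r_def s_def)
    have ar: "\<alpha> a = a \<otimes> r" "\<alpha> b = b \<otimes> s" using ac ab(2) by (auto simp: r_def s_def)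
    have rM: "gcomm G r y \<in> ?M" if "y \<in> carrier G" for y
      using comm_subgroup_incl[OF r that] by simp
    have sM: "gcomm G s y \<in> ?M" if "y \<in> lower_central G (Suc n)" for y
      by (rule comm_lower_central[OF N s that])
    have cM: "gcomm G a b \<in> lower_central G (Suc n)"
      by (rule normal_gcomm_left[OF lower_central_normal a ab(2)])
    have "q (\<alpha> (gcomm G a b)) = q (gcomm G (a \<otimes> r) (b \<otimes> s))"
      using gcomm_hom[OF \<alpha>.group_hom_axioms ac ab(2)] ar by simp
    also have "\<dots> = gcomm Q (q a \<otimes>\<^bsub>Q\<^esub> q r) (q b \<otimes>\<^bsub>Q\<^esub> q s)"
      using gcomm_hom[OF q, of "a \<otimes> r" "b \<otimes> s"] ac ab(2) rc by simp
    also have "\<dots> = gcomm Q (q a) (q b)"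
    proof (rule q.H.gcomm_mult_commuting)
      show "q r \<otimes>\<^bsub>Q\<^esub> q b = q b \<otimes>\<^bsub>Q\<^esub> q r" by (rule com[OF rc(1) ab(2) rM[OF ab(2)]])
      show "q r \<otimes>\<^bsub>Q\<^esub> q s = q s \<otimes>\<^bsub>Q\<^esub> q r" by (rule com[OF rc(1,2) rM[OF rc(2)]])
      show "q s \<otimes>\<^bsub>Q\<^esub> q a = q a \<otimes>\<^bsub>Q\<^esub> q s" by (rule com[OF rc(2) ac sM[OF a]])
      have c: "gcomm G a b \<in> carrier G" using ac ab(2) by simp
      show "q r \<otimes>\<^bsub>Q\<^esub> gcomm Q (q a) (q b) = gcomm Q (q a) (q b) \<otimes>\<^bsub>Q\<^esub> q r"
        using com[OF rc(1) c rM[OF c]] gcomm_hom[OF q ac ab(2)] by simp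
      show "q s \<otimes>\<^bsub>Q\<^esub> gcomm Q (q a) (q b) = gcomm Q (q a) (q b) \<otimes>\<^bsub>Q\<^esub> q s"
        using com[OF rc(2) c sM[OF cM]] gcomm_hom[OF q ac ab(2)] by simp
    qed (use ac ab(2) rc in auto)
    also have "\<dots> = q (gcomm G a b)" using gcomm_hom[OF q ac ab(2)] by simp
    finally show "gcomm G a b \<in> {x \<in> carrier G. q (\<alpha> x) = q x}" using ac ab(2) by simp
  qed
  then have "q (\<alpha> x) = q x" "x \<in> carrier G" using Suc.prems by auto
  then show ?case using qeq[of x "\<alpha> x"] by simp
qed

lemma baer_subgroups:
  assumes "R \<lhd> G"
  shows "subgroup (R \<inter> lower_central G (c + 1)) G"
    and "iter_comm G R c (carrier G) \<lhd> G\<lparr>carrier := R \<inter> lower_central G (c + 1)\<rparr>"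
proof -
  show s: "subgroup (R \<inter> lower_central G (c + 1)) G"
    by (rule subgroups_Inter_pair[OF normal_imp_subgroup[OF assms] normal_imp_subgroup[OF lower_central_normal]])
  show "iter_comm G R c (carrier G) \<lhd> G\<lparr>carrier := R \<inter> lower_central G (c + 1)\<rparr>"
  proof (rule normal_restrict_supergroup[OF s iter_comm_normal[OF assms]])
    show "iter_comm G R c (carrier G) \<subseteq> R \<inter> lower_central G (c + 1)"
      using iter_comm_le[OF assms] iter_comm_le_lower_central[OF assms] by simp
  qed
qed

lemma r_coset_eq_iff:
  assumes "subgroup N G" "x \<in> carrier G" shows "N #> x = N \<longleftrightarrow> x \<in> N"
  using coset_join1[OF _ assms(2,1)] coset_join2[OF assms(2,1)] by auto

end

text \<open>The compositions of \<open>h\<close> and \<open>k\<close> are the identity modulo the kernels, and by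
  \<open>endomorphism_lower_central\<close> they act as the identity on the Baer invariants.\<close>

theorem baer_invariant_of_independent:
  assumes p: "group_hom F G p" and p': "group_hom F' G p'"
    and h: "h \<in> hom F F'" and k: "k \<in> hom F' F"
    and ph: "\<And>x. x \<in> carrier F \<Longrightarrow> p' (h x) = p x"
    and pk: "\<And>y. y \<in> carrier F' \<Longrightarrow> p (k y) = p' y"
  shows "baer_invariant_of c F (kernel F G p) \<cong> baer_invariant_of c F' (kernel F' G p')"
proof -
  interpret p: group_hom F G p by (rule p)
  interpret p': group_hom F' G p' by (rule p')
  interpret h: group_hom F F' h by (intro group_homI h p.G.group_axioms p'.G.group_axioms)
  interpret k: group_hom F' F k by (intro group_homI k p.G.group_axioms p'.G.group_axioms)
  let ?R = "kernel F G p" and ?R' = "kernel F' G p'"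
  have R: "?R \<lhd> F" and R': "?R' \<lhd> F'" by (rule p.normal_kernel, rule p'.normal_kernel)
  let ?X = "F\<lparr>carrier := ?R \<inter> lower_central F (c + 1)\<rparr>"
  let ?X' = "F'\<lparr>carrier := ?R' \<inter> lower_central F' (c + 1)\<rparr>"
  let ?N = "iter_comm F ?R c (carrier F)" and ?N' = "iter_comm F' ?R' c (carrier F')"
  have hR: "h ` ?R \<subseteq> ?R'" "k ` ?R' \<subseteq> ?R" using ph pk by (auto simp: kernel_def)
  have hN: "h ` ?N \<subseteq> ?N'" "k ` ?N' \<subseteq> ?N"
    by (rule h.iter_comm_image_subset[OF R R' hR(1)], rule k.iter_comm_image_subset[OF R' R hR(2)])
  have h\<gamma>: "h ` lower_central F n \<subseteq> lower_central F' n" "k ` lower_central F' n \<subseteq> lower_central F n" for n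
    by (rule h.lower_central_image_subset, rule k.lower_central_image_subset)
  have kh: "inv\<^bsub>F\<^esub> x \<otimes>\<^bsub>F\<^esub> k (h x) \<in> ?N" if "x \<in> lower_central F (Suc c)" for x
  proof (rule p.G.endomorphism_lower_central[OF R, of "\<lambda>x. k (h x)", OF _ _ that])
    show "(\<lambda>x. k (h x)) \<in> hom F F" by (rule homI) auto
    show "inv\<^bsub>F\<^esub> x \<otimes>\<^bsub>F\<^esub> k (h x) \<in> ?R" if "x \<in> carrier F" for x
      using that ph pk by (auto simp: kernel_def)
  qed
  have hk: "inv\<^bsub>F'\<^esub> x \<otimes>\<^bsub>F'\<^esub> h (k x) \<in> ?N'" if "x \<in> lower_central F' (Suc c)" for x
  proof (rule p'.G.endomorphism_lower_central[OF R', of "\<lambda>x. h (k x)", OF _ _ that])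
    show "(\<lambda>x. h (k x)) \<in> hom F' F'" by (rule homI) auto
    show "inv\<^bsub>F'\<^esub> x \<otimes>\<^bsub>F'\<^esub> h (k x) \<in> ?R'" if "x \<in> carrier F'" for x
      using that ph pk by (auto simp: kernel_def)
  qed
  note X = p.G.baer_subgroups[OF R, of c] and X' = p'.G.baer_subgroups[OF R', of c]
  have N: "?N \<lhd> F" and N': "?N' \<lhd> F'"
    by (rule p.G.iter_comm_normal[OF R], rule p'.G.iter_comm_normal[OF R'])
  have N's: "subgroup ?N' F'" by (rule normal_imp_subgroup[OF N'])
  define \<Psi> where "\<Psi> x = ?N' #>\<^bsub>F'\<^esub> h x" for x
  have hX: "h x \<in> carrier ?X'" if "x \<in> carrier ?X" for x
    using that hR h\<gamma>(1)[of "c + 1"] by auto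
  have \<Psi>: "\<Psi> \<in> hom ?X (?X' Mod ?N')"
  proof (rule homI)
    show "\<Psi> x \<in> carrier (?X' Mod ?N')" if "x \<in> carrier ?X" for x
      using hX[OF that] by (auto simp: \<Psi>_def carrier_FactGroup)
    show "\<Psi> (x \<otimes>\<^bsub>?X\<^esub> y) = \<Psi> x \<otimes>\<^bsub>?X' Mod ?N'\<^esub> \<Psi> y" if "x \<in> carrier ?X" "y \<in> carrier ?X" for x y
    proof -
      have "x \<in> carrier F" "y \<in> carrier F" using that p.G.lower_central_carrier by auto
      then show ?thesis by (simp add: \<Psi>_def normal.rcos_sum[OF N'])
    qed
  qed
  interpret \<Psi>: group_hom ?X "?X' Mod ?N'" \<Psi>
    by (intro group_homI \<Psi> p.G.subgroup_imp_group X(1) normal.factorgroup_is_group X'(2))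
  have surj: "\<Psi> ` carrier ?X = carrier (?X' Mod ?N')"
  proof
    show "carrier (?X' Mod ?N') \<subseteq> \<Psi> ` carrier ?X"
    proof
      fix Y assume "Y \<in> carrier (?X' Mod ?N')"
      then obtain y where y: "Y = ?N' #>\<^bsub>F'\<^esub> y" "y \<in> carrier ?X'"
        by (auto simp: carrier_FactGroup)
      then have yc: "y \<in> carrier F'" "y \<in> lower_central F' (Suc c)"
        using p'.G.lower_central_carrier by auto
      have "k y \<in> carrier ?X" using y hR h\<gamma>(2)[of "c + 1"] by auto
      moreover have "?N' #>\<^bsub>F'\<^esub> h (k y) = ?N' #>\<^bsub>F'\<^esub> y"
      proof (rule p'.G.repr_independence[symmetric])
        have "h (k y) = y \<otimes>\<^bsub>F'\<^esub> (inv\<^bsub>F'\<^esub> y \<otimes>\<^bsub>F'\<^esub> h (k y))"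
          using yc by simp
        also have "\<dots> \<in> y <#\<^bsub>F'\<^esub> ?N'" using hk[OF yc(2)] by (auto simp: l_coset_def)
        also have "\<dots> = ?N' #>\<^bsub>F'\<^esub> y" using normal.coset_eq[OF N'] yc by auto
        finally show "h (k y) \<in> ?N' #>\<^bsub>F'\<^esub> y" .
      qed (use yc N's in auto)
      ultimately show "Y \<in> \<Psi> ` carrier ?X" using y by (auto simp: \<Psi>_def image_iff)
    qed
    show "\<Psi> ` carrier ?X \<subseteq> carrier (?X' Mod ?N')" using \<Psi>.hom_closed by blast
  qed
  have "kernel ?X (?X' Mod ?N') \<Psi> = ?N"
  proof
    show "?N \<subseteq> kernel ?X (?X' Mod ?N') \<Psi>"
    proof
      fix x assume x: "x \<in> ?N"
      have "x \<in> carrier ?X" using x subgroup.subset[OF normal_imp_subgroup[OF X(2)]] by auto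
      moreover have "\<Psi> x = ?N'" unfolding \<Psi>_def
        using x hN(1) p.G.normal_carrier[OF N x] by (subst p'.G.r_coset_eq_iff[OF N's]) auto
      ultimately show "x \<in> kernel ?X (?X' Mod ?N') \<Psi>" by (simp add: kernel_def)
    qed
    show "kernel ?X (?X' Mod ?N') \<Psi> \<subseteq> ?N"
    proof
      fix x assume x: "x \<in> kernel ?X (?X' Mod ?N') \<Psi>"
      then have xl: "x \<in> lower_central F (Suc c)" and "\<Psi> x = ?N'" by (auto simp: kernel_def)
      then have xc: "x \<in> carrier F" using p.G.lower_central_carrier by blast
      have "h x \<in> ?N'" using \<open>\<Psi> x = ?N'\<close> xc unfolding \<Psi>_def
        by (subst (asm) p'.G.r_coset_eq_iff[OF N's]) auto
      then have "k (h x) \<in> ?N" using hN(2) by blast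
      then have "k (h x) \<otimes>\<^bsub>F\<^esub> inv\<^bsub>F\<^esub> (inv\<^bsub>F\<^esub> x \<otimes>\<^bsub>F\<^esub> k (h x)) \<in> ?N"
        by (intro p.G.normal_mult_closed[OF N] p.G.normal_m_inv_closed[OF N] kh[OF xl])
      then show "x \<in> ?N" using xc by (simp add: p.G.inv_mult_group p.G.m_assoc)
    qed
  qed
  then show ?thesis unfolding baer_invariant_of_def using \<Psi>.FactGroup_iso[OF surj] by simp
qed

section \<open>Presentations of split extensions\<close>

context group begin

lemma normal_set_mult_subgroup:
  assumes "subgroup H G" "N \<lhd> G" shows "subgroup (H <#> N) G"
  using mult_norm_subgroup[OF assms(2,1)] commut_normal[OF assms] by simp

lemma normal_set_mult_normal:
  assumes "M \<lhd> G" "N \<lhd> G" shows "M <#> N \<lhd> G"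
proof (rule normalI_gconj[OF normal_set_mult_subgroup[OF normal_imp_subgroup[OF assms(1)] assms(2)]])
  fix u x assume u: "u \<in> carrier G" and "x \<in> M <#> N"
  then obtain m n where x: "x = m \<otimes> n" "m \<in> M" "n \<in> N" by (auto simp: set_mult_iff)
  have "gconj G u x = gconj G u m \<otimes> gconj G u n"
    using x u normal_carrier[OF assms(1)] normal_carrier[OF assms(2)] by (simp add: gconj_mult)
  then show "gconj G u x \<in> M <#> N"
    using normal_gconj_closed[OF assms(1) u x(2)] normal_gconj_closed[OF assms(2) u x(3)]
    unfolding set_mult_iff by blast
qed

lemma set_mult_incl_left: "N \<lhd> G \<Longrightarrow> H \<subseteq> carrier G \<Longrightarrow> H \<subseteq> H <#> N"
  using normal_one_closed[of N] by (force simp: set_mult_iff)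

lemma set_mult_incl_right: "subgroup H G \<Longrightarrow> N \<subseteq> carrier G \<Longrightarrow> N \<subseteq> H <#> N"
  using subgroup.one_closed[of H G] by (force simp: set_mult_iff)

lemma set_mult_minimal: "subgroup K G \<Longrightarrow> M \<subseteq> K \<Longrightarrow> N \<subseteq> K \<Longrightarrow> M <#> N \<subseteq> K"
  by (auto simp: set_mult_iff subset_iff intro: subgroup.m_closed)

lemma normalI_generators:
  assumes N: "subgroup N G" and X: "X \<subseteq> carrier G" "carrier G = generate G X"
    "\<And>x. x \<in> X \<Longrightarrow> inv x \<in> X" and conj: "\<And>x n. x \<in> X \<Longrightarrow> n \<in> N \<Longrightarrow> gconj G x n \<in> N"
  shows "N \<lhd> G"
proof (rule normalI_gconj[OF N])
  have Nc: "n \<in> carrier G" if "n \<in> N" for n using subgroup.mem_carrier[OF N that] .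
  fix u n assume "u \<in> carrier G" "n \<in> N"
  then have "u \<in> generate G X" using X(2) by simp
  then show "gconj G u n \<in> N" using \<open>n \<in> N\<close>
  proof (induction arbitrary: n)
    case one
    then show ?case using Nc by simp
  next
    case (eng a b)
    have "a \<in> carrier G" "b \<in> carrier G" using eng.hyps X(2) by simp_all
    then have "gconj G (a \<otimes> b) n = gconj G b (gconj G a n)"
      using gconj_gconj[of b a n] Nc[OF eng.prems] by simp
    then show ?case using eng by simp
  qed (use X(3) conj in auto)
qed

text \<open>The set is closed under conjugation because $z^u=z[z,u]$ and $[z,u]\in N$.\<close>

lemma central_mod_normal:
  assumes N: "N \<lhd> G" shows "{z \<in> carrier G. \<forall>y\<in>carrier G. gcomm G z y \<in> N} \<lhd> G" (is "?Z \<lhd> G")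
proof (rule normalI_gconj)
  show s: "subgroup ?Z G" by (rule subgroup_centralizer_mod(1)[OF N order_refl])
  have NZ: "N \<subseteq> ?Z" using normal_gcomm_left[OF N] normal_carrier[OF N] by blast
  fix u z assume u: "u \<in> carrier G" and z: "z \<in> ?Z"
  have "gconj G u z = z \<otimes> gcomm G z u" using u z by (simp add: gconj_def gcomm_def m_assoc)
  moreover have "gcomm G z u \<in> ?Z" using NZ u z by blast
  ultimately show "gconj G u z \<in> ?Z" using subgroup.m_closed[OF s z] by simp
qed

lemma gcomm_normal_closure_mod:
  assumes N: "N \<lhd> G" and X: "X \<subseteq> carrier G" and Y: "carrier G = generate G Y"
    and com: "\<And>x y. x \<in> X \<Longrightarrow> y \<in> Y \<Longrightarrow> gcomm G x y \<in> N"
    and x: "x \<in> normal_closure G X" and y: "y \<in> carrier G"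
  shows "gcomm G x y \<in> N"
proof -
  have Yc: "Y \<subseteq> carrier G" by (subst Y) (rule subsetI, erule generate.incl)
  have "X \<subseteq> {z \<in> carrier G. \<forall>y\<in>carrier G. gcomm G z y \<in> N}"
  proof clarify
    fix x assume "x \<in> X"
    then have "gcomm G x y \<in> N" if "y \<in> carrier G" for y
      using that unfolding Y by (intro gcomm_generate_mod[OF N X Yc com generate.incl])
    then show "x \<in> carrier G \<and> (\<forall>y\<in>carrier G. gcomm G x y \<in> N)" using \<open>x \<in> X\<close> X by blast
  qed
  from normal_closure_minimal[OF central_mod_normal[OF N] this] show ?thesis using x y by blast
qed

lemma foldl_gcomm_closed:
  "r \<in> carrier G \<Longrightarrow> set fs \<subseteq> carrier G \<Longrightarrow> foldl (gcomm G) r fs \<in> carrier G"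
  by (induction fs arbitrary: r) auto

lemma foldl_gcomm_gconj:
  assumes "u \<in> carrier G"
  shows "r \<in> carrier G \<Longrightarrow> set fs \<subseteq> carrier G \<Longrightarrow>
    gconj G u (foldl (gcomm G) r fs) = foldl (gcomm G) (gconj G u r) (map (gconj G u) fs)"
  using assms by (induction fs arbitrary: r) (auto simp: gconj_gcomm)

lemma foldl_gcomm_iter_comm:
  assumes "N \<lhd> G" "r \<in> N"
  shows "set fs \<subseteq> carrier G \<Longrightarrow> foldl (gcomm G) r fs \<in> iter_comm G N (length fs) (carrier G)"
  by (induction fs rule: rev_induct) (use assms in \<open>auto intro: comm_subgroup_incl\<close>)

lemma foldl_gcomm_hom:
  assumes "group_hom G K h"
  shows "r \<in> carrier G \<Longrightarrow> set fs \<subseteq> carrier G \<Longrightarrow>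
    h (foldl (gcomm G) r fs) = foldl (gcomm K) (h r) (map h fs)"
  by (induction fs arbitrary: r) (auto simp: gcomm_hom[OF assms])

text \<open>The set of generators on the right is closed under conjugation. The subgroup that it generates is
  therefore normal, and modulo a normal subgroup it suffices to form commutators of generators.\<close>

lemma iter_comm_generate:
  assumes N: "N \<lhd> G"
  shows "iter_comm G N n (carrier G) \<subseteq>
    generate G {foldl (gcomm G) r fs |r fs. r \<in> N \<and> length fs = n \<and> set fs \<subseteq> carrier G}"
proof (induction n)
  case 0
  show ?case
  proof
    fix x assume "x \<in> iter_comm G N 0 (carrier G)"
    then have "x = foldl (gcomm G) x [] \<and> x \<in> N \<and> length [] = (0::nat) \<and> set [] \<subseteq> carrier G" by simp
    then show "x \<in> generate G {foldl (gcomm G) r fs |r fs. r \<in> N \<and> length fs = 0 \<and> set fs \<subseteq> carrier G}"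
      by (intro generate.incl CollectI exI)
  qed
next
  case (Suc n)
  let ?L = "\<lambda>n. {foldl (gcomm G) r fs |r fs. r \<in> N \<and> length fs = n \<and> set fs \<subseteq> carrier G}"
  have Lc: "?L n \<subseteq> carrier G" for n
    using normal_carrier[OF N] by (auto intro!: foldl_gcomm_closed)
  have L: "generate G (?L (Suc n)) \<lhd> G"
  proof (rule normal_generate_gconj[OF Lc])
    fix u x assume u: "u \<in> carrier G" and "x \<in> ?L (Suc n)"
    then obtain r fs where x: "x = foldl (gcomm G) r fs" "r \<in> N" "length fs = Suc n" "set fs \<subseteq> carrier G"
      by blast
    then have "gconj G u x = foldl (gcomm G) (gconj G u r) (map (gconj G u) fs)"
      using foldl_gcomm_gconj[OF u] normal_carrier[OF N] by simp
    moreover have "gconj G u r \<in> N" by (rule normal_gconj_closed[OF N u x(2)])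
    moreover have "length (map (gconj G u) fs) = Suc n" "set (map (gconj G u) fs) \<subseteq> carrier G"
      using x u by auto
    ultimately show "gconj G u x \<in> ?L (Suc n)" by blast
  qed
  have *: "gcomm G x y \<in> generate G (?L (Suc n))" if "x \<in> ?L n" "y \<in> carrier G" for x y
  proof -
    obtain r fs where x: "x = foldl (gcomm G) r fs" "r \<in> N" "length fs = n" "set fs \<subseteq> carrier G"
      using \<open>x \<in> ?L n\<close> by blast
    then have "gcomm G x y = foldl (gcomm G) r (fs @ [y])" "length (fs @ [y]) = Suc n"
      "set (fs @ [y]) \<subseteq> carrier G" using that by auto
    then show ?thesis using x(2) by (intro generate.incl CollectI exI[of _ r] exI[of _ "fs @ [y]"]) auto
  qed
  show ?case unfolding iter_comm.simps
  proof (rule comm_subgroup_minimal)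
    show "subgroup (generate G (?L (Suc n))) G" by (rule generate_is_subgroup[OF Lc])
    fix x y assume "x \<in> iter_comm G N n (carrier G)" and y: "y \<in> carrier G"
    then have x: "x \<in> generate G (?L n)" using Suc.IH by blast
    show "gcomm G x y \<in> generate G (?L (Suc n))"
      by (rule gcomm_generate_mod[OF L Lc order_refl * x generate.incl[OF y]])
  qed
qed

end

text \<open>Here \<open>R\<close> presents a split extension: \<open>p\<close> retracts \<open>F\<close> onto a copy of \<open>L\<close>, the kernel of \<open>p\<close> is
  the normal closure of \<open>F\<^sub>1\<close>, and \<open>R\<close> is the product of a normal subgroup \<open>K\<close> of \<open>L\<close> and its part
  in the kernel of \<open>p\<close>.\<close>

locale split_presentation = F: group F + L: group L
  for F :: "('f, 'm) monoid_scheme" (structure) and L :: "('l, 'n) monoid_scheme" +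
  fixes i :: "'l \<Rightarrow> 'f" and p :: "'f \<Rightarrow> 'l" and F\<^sub>1 :: "'f set" and R :: "'f set" and K :: "'l set"
  assumes i: "i \<in> hom L F" and p: "p \<in> hom F L" and p_i: "y \<in> carrier L \<Longrightarrow> p (i y) = y"
    and F1: "subgroup F\<^sub>1 F" and p_F1: "x \<in> F\<^sub>1 \<Longrightarrow> p x = \<one>\<^bsub>L\<^esub>"
    and gen: "carrier F = generate F (F\<^sub>1 \<union> i ` carrier L)"
    and R: "R \<lhd> F" and K: "K \<lhd> L" and i_K: "i ` K \<subseteq> R" and p_R: "p ` R \<subseteq> K"
begin

sublocale p: group_hom F L p by (intro group_homI F.group_axioms L.group_axioms p)
sublocale i: group_hom L F i by (intro group_homI F.group_axioms L.group_axioms i)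

definition S where "S = R \<inter> kernel F L p"

abbreviation "SF n \<equiv> iter_comm F S n (carrier F)"
abbreviation "RF n \<equiv> iter_comm F R n (carrier F)"
abbreviation "KL n \<equiv> iter_comm L K n (carrier L)"
abbreviation "P n \<equiv> prod_comm n F F\<^sub>1 (i ` carrier L) (i ` K)"

text \<open>For \<open>n = c\<close> this is the denominator in the second summand of the Baer invariant.\<close>

definition D where "D n = P n <#> SF n"

lemma F1_carrier: "F\<^sub>1 \<subseteq> carrier F" by (rule subgroup.subset[OF F1])

lemma iL_carrier: "i ` carrier L \<subseteq> carrier F" by auto

lemma image_LE:
  assumes "x \<in> F\<^sub>1 \<union> i ` carrier L" "x \<notin> F\<^sub>1"
  obtains y where "y \<in> carrier L" "x = i y"
  using assms by (elim UnE imageE) simp_all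

lemma K_carrier: "K \<subseteq> carrier L" by (rule L.normal_subset[OF K])

lemma S_normal: "S \<lhd> F"
proof (rule F.normalI_gconj)
  show "subgroup S F" unfolding S_def
    by (intro F.subgroups_Inter_pair normal_imp_subgroup[OF R] p.subgroup_kernel)
  show "gconj F u x \<in> S" if "u \<in> carrier F" "x \<in> S" for u x
    using that F.normal_gconj_closed[OF R that(1)] F.normal_gconj_closed[OF p.normal_kernel that(1)]
    by (auto simp: S_def)
qed

lemma S_le: "S \<subseteq> R" "x \<in> S \<Longrightarrow> p x = \<one>\<^bsub>L\<^esub>" by (auto simp: S_def kernel_def)

lemma D_iter_comm_normal: "SF n \<lhd> F"
  by (rule F.iter_comm_normal[OF S_normal])

abbreviation "prod_gens n \<equiv> {foldl (gcomm F) r fs | r fs.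
  r \<in> i ` K \<and> length fs = n \<and> set fs \<subseteq> F\<^sub>1 \<union> i ` carrier L \<and> set fs \<inter> F\<^sub>1 \<noteq> {}}"

lemma prod_gens_carrier: "prod_gens n \<subseteq> carrier F"
proof clarify
  fix r fs k assume "k \<in> K" "set fs \<subseteq> F\<^sub>1 \<union> i ` carrier L"
  then show "foldl (gcomm F) (i k) fs \<in> carrier F"
    using F1_carrier iL_carrier K_carrier by (intro F.foldl_gcomm_closed) auto
qed

lemma P_normal: "P n \<lhd> F"
  unfolding prod_comm_def by (rule F.normal_closure_normal[OF prod_gens_carrier])

lemma D_normal: "D n \<lhd> F"
  unfolding D_def by (rule F.normal_set_mult_normal[OF P_normal D_iter_comm_normal])

lemma P_le_D: "P n \<subseteq> D n"
  unfolding D_def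
  by (rule F.set_mult_incl_left[OF D_iter_comm_normal F.normal_subset[OF P_normal]])

lemma iter_comm_le_D: "SF n \<subseteq> D n"
  unfolding D_def
  by (rule F.set_mult_incl_right[OF normal_imp_subgroup[OF P_normal] F.iter_comm_subset[OF S_normal]])

lemma P_le_iter_comm: "P n \<subseteq> RF n"
  unfolding prod_comm_def
proof (rule F.normal_closure_minimal[OF F.iter_comm_normal[OF R]], clarify)
  fix r fs k assume "k \<in> K" "set fs \<subseteq> F\<^sub>1 \<union> i ` carrier L"
  then show "foldl (gcomm F) (i k) fs \<in> RF (length fs)"
    using F1_carrier iL_carrier i_K by (intro F.foldl_gcomm_iter_comm[OF R]) auto
qed

lemma p_foldl_gcomm:
  assumes "r \<in> carrier F" "set fs \<subseteq> carrier F" "set fs \<inter> F\<^sub>1 \<noteq> {}"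
  shows "p (foldl (gcomm F) r fs) = \<one>\<^bsub>L\<^esub>"
  using assms(2,3)
proof (induction fs rule: rev_induct)
  case (snoc f fs)
  let ?x = "foldl (gcomm F) r fs"
  have x: "?x \<in> carrier F" using snoc.prems assms(1) by (intro F.foldl_gcomm_closed) auto
  have e: "p (foldl (gcomm F) r (fs @ [f])) = gcomm L (p ?x) (p f)"
    using snoc.prems F.gcomm_hom[OF p.group_hom_axioms x] by simp
  have "p ?x = \<one>\<^bsub>L\<^esub> \<or> p f = \<one>\<^bsub>L\<^esub>"
    using snoc p_F1[of f] by (cases "f \<in> F\<^sub>1") auto
  then show ?case using x snoc.prems unfolding e by (auto simp: gcomm_def)
qed simp

text \<open>The retraction kills a left-normed commutator as soon as one of its entries is in \<open>F\<^sub>1\<close>.\<close>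

lemma P_le_S: "P n \<subseteq> S"
  unfolding prod_comm_def
proof (rule F.normal_closure_minimal[OF S_normal], clarify)
  fix r fs k assume a: "k \<in> K" "set fs \<subseteq> F\<^sub>1 \<union> i ` carrier L" "set fs \<inter> F\<^sub>1 \<noteq> {}"
  have fs: "set fs \<subseteq> carrier F" using a(2) F1_carrier iL_carrier by blast
  have ik: "i k \<in> R" "i k \<in> carrier F" using a(1) i_K K_carrier by auto
  have "foldl (gcomm F) (i k) fs \<in> R"
    using F.foldl_gcomm_iter_comm[OF R ik(1) fs] F.iter_comm_le[OF R] by blast
  then show "foldl (gcomm F) (i k) fs \<in> S"
    using p_foldl_gcomm[OF ik(2) fs a(3)] F.foldl_gcomm_closed[OF ik(2) fs]
    by (simp add: S_def kernel_def)
qed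

lemma D_le_S: "D n \<subseteq> S"
  unfolding D_def
  by (rule F.set_mult_minimal[OF normal_imp_subgroup[OF S_normal] P_le_S F.iter_comm_le[OF S_normal]])

lemma D_le_iter_comm: "D n \<subseteq> RF n"
  unfolding D_def
  by (rule F.set_mult_minimal[OF normal_imp_subgroup[OF F.iter_comm_normal[OF R]] P_le_iter_comm
    F.iter_comm_mono[OF S_le(1)]])

lemma gcomm_P:
  assumes "x \<in> P n" "y \<in> carrier F" shows "gcomm F x y \<in> P (Suc n)"
proof (rule F.gcomm_normal_closure_mod[OF P_normal prod_gens_carrier gen _ _ assms(2)])
  show "x \<in> normal_closure F (prod_gens n)" using assms(1) unfolding prod_comm_def .
next
  fix x f assume "x \<in> prod_gens n" and f: "f \<in> F\<^sub>1 \<union> i ` carrier L"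
  then obtain r fs where x: "x = foldl (gcomm F) r fs" "r \<in> i ` K" "length fs = n"
    "set fs \<subseteq> F\<^sub>1 \<union> i ` carrier L" "set fs \<inter> F\<^sub>1 \<noteq> {}" by blast
  then have "gcomm F x f = foldl (gcomm F) r (fs @ [f])" "length (fs @ [f]) = Suc n"
    "set (fs @ [f]) \<subseteq> F\<^sub>1 \<union> i ` carrier L" "set (fs @ [f]) \<inter> F\<^sub>1 \<noteq> {}" using f by auto
  then have "gcomm F x f \<in> prod_gens (Suc n)" using x(2) by blast
  then show "gcomm F x f \<in> P (Suc n)"
    unfolding prod_comm_def by (rule F.normal_closure_incl[OF prod_gens_carrier])
qed

text \<open>A left-normed commutator \<open>[r\<^sub>2, f\<^sub>1, \<dots>, f\<^sub>n, f]\<close> whose only entry from \<open>F\<^sub>1\<close> is the last one is still a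
  generator of the subgroup \<open>P (n + 1)\<close>.\<close>

lemma gcomm_i_F1:
  assumes "y \<in> KL n" "f \<in> F\<^sub>1" shows "gcomm F (i y) f \<in> P (Suc n)"
proof -
  let ?C = "{x \<in> carrier F. \<forall>f\<in>F\<^sub>1. gcomm F x f \<in> P (Suc n)}"
  have C: "subgroup {y \<in> carrier L. i y \<in> ?C} L"
    by (rule i.subgroup_vimage[OF F.subgroup_centralizer_mod(1)[OF P_normal F1_carrier]])
  have "foldl (gcomm L) k fs \<in> {y \<in> carrier L. i y \<in> ?C}"
    if k: "k \<in> K" and fs: "length fs = n" "set fs \<subseteq> carrier L" for k fs
  proof -
    have kc: "k \<in> carrier L" using k K_carrier by blast
    have y: "foldl (gcomm L) k fs \<in> carrier L" by (rule L.foldl_gcomm_closed[OF kc fs(2)])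
    have iy: "i (foldl (gcomm L) k fs) = foldl (gcomm F) (i k) (map i fs)"
      by (rule L.foldl_gcomm_hom[OF i.group_hom_axioms kc fs(2)])
    have "gcomm F (i (foldl (gcomm L) k fs)) f \<in> P (Suc n)" if "f \<in> F\<^sub>1" for f
    proof -
      have "gcomm F (i (foldl (gcomm L) k fs)) f = foldl (gcomm F) (i k) (map i fs @ [f])"
        by (simp add: iy)
      moreover have "length (map i fs @ [f]) = Suc n" "set (map i fs @ [f]) \<subseteq> F\<^sub>1 \<union> i ` carrier L"
        "set (map i fs @ [f]) \<inter> F\<^sub>1 \<noteq> {}" using that fs by auto
      moreover have "i k \<in> i ` K" using k by blast
      ultimately have "gcomm F (i (foldl (gcomm L) k fs)) f \<in> prod_gens (Suc n)" by blast
      then show ?thesis unfolding prod_comm_def by (rule F.normal_closure_incl[OF prod_gens_carrier])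
    qed
    then show ?thesis using y by simp
  qed
  then have "{foldl (gcomm L) k fs |k fs. k \<in> K \<and> length fs = n \<and> set fs \<subseteq> carrier L}
      \<subseteq> {y \<in> carrier L. i y \<in> ?C}" by blast
  from L.iter_comm_generate[OF K, of n] L.generate_subgroup_incl[OF this C]
  have "KL n \<subseteq> {y \<in> carrier L. i y \<in> ?C}" by (rule order_trans)
  then show ?thesis using assms by blast
qed

text \<open>This subgroup turns out to be $[R,{}_nF]$.\<close>

definition Q where "Q n = i ` KL n <#> D n"

lemma Q_decomp: "x \<in> Q n \<Longrightarrow> \<exists>y\<in>KL n. \<exists>d\<in>D n. x = i y \<otimes> d"
  unfolding Q_def set_mult_iff by blast

lemma iter_comm_L_carrier: "y \<in> KL n \<Longrightarrow> y \<in> carrier L"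
  using L.iter_comm_subset[OF K] by blast

lemma Q_subgroup: "subgroup (Q n) F"
  unfolding Q_def
  by (rule F.normal_set_mult_subgroup[OF i.subgroup_img_is_subgroup[OF
    normal_imp_subgroup[OF L.iter_comm_normal[OF K]]] D_normal])

lemma i_iter_comm_le_Q: "y \<in> KL n \<Longrightarrow> i y \<in> Q n"
proof -
  have "i ` KL n \<subseteq> Q n" unfolding Q_def
    using iter_comm_L_carrier by (intro F.set_mult_incl_left[OF D_normal]) auto
  then show "y \<in> KL n \<Longrightarrow> i y \<in> Q n" by blast
qed

lemma D_le_Q: "D n \<subseteq> Q n"
  unfolding Q_def
  by (rule F.set_mult_incl_right[OF i.subgroup_img_is_subgroup[OF
    normal_imp_subgroup[OF L.iter_comm_normal[OF K]]] F.normal_subset[OF D_normal]])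

text \<open>For the normality of \<open>Q n\<close> a commutator of $y\in[K,{}_nL]$ with an element of \<open>F\<^sub>1\<close> must be in
  \<open>P n\<close>. This follows from \<open>gcomm_i_F1\<close> for $y$ as an element of $[K,{}_{n-1}L]$, which requires that \<open>n\<close> is
  positive.\<close>

lemma Q_Suc_normal: "Q (Suc n) \<lhd> F"
proof (rule F.normalI_generators[OF Q_subgroup _ gen])
  show "F\<^sub>1 \<union> i ` carrier L \<subseteq> carrier F" using F1_carrier iL_carrier by blast
  show "inv x \<in> F\<^sub>1 \<union> i ` carrier L" if xu: "x \<in> F\<^sub>1 \<union> i ` carrier L" for x
  proof (cases "x \<in> F\<^sub>1")
    case True
    then show ?thesis by (intro UnI1 subgroup.m_inv_closed[OF F1])
  next
    case False
    obtain y where y: "y \<in> carrier L" "x = i y" by (rule image_LE[OF xu False])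
    then have "inv x = i (inv\<^bsub>L\<^esub> y)" by simp
    then show ?thesis using y(1) by (simp only: UnI2 imageI L.inv_closed)
  qed
  fix u x assume u: "u \<in> F\<^sub>1 \<union> i ` carrier L" and xQ: "x \<in> Q (Suc n)"
  obtain y d where x: "x = i y \<otimes> d" and y: "y \<in> KL (Suc n)"
    and d: "d \<in> D (Suc n)" using Q_decomp[OF xQ] by blast
  have yc: "y \<in> carrier L" by (rule iter_comm_L_carrier[OF y])
  have uc: "u \<in> carrier F" using u F1_carrier iL_carrier by blast
  have "gconj F u (i y) \<in> Q (Suc n)"
  proof (cases "u \<in> F\<^sub>1")
    case True
    have "gcomm F (i y) u \<in> P (Suc n)"
      by (rule gcomm_i_F1[OF subsetD[OF L.iter_comm_Suc_subset[OF K] y] True])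
    then have "gcomm F (i y) u \<in> Q (Suc n)" using P_le_D D_le_Q by blast
    then have "i y \<otimes> gcomm F (i y) u \<in> Q (Suc n)"
      by (rule subgroup.m_closed[OF Q_subgroup i_iter_comm_le_Q[OF y]])
    then show ?thesis using uc yc by (simp add: gconj_def gcomm_def F.m_assoc)
  next
    case False
    obtain v where v: "v \<in> carrier L" "u = i v" by (rule image_LE[OF u False])
    have "gconj L v y \<in> KL (Suc n)"
      by (rule L.normal_gconj_closed[OF L.iter_comm_normal[OF K] v(1) y])
    then have "i (gconj L v y) \<in> Q (Suc n)" by (rule i_iter_comm_le_Q)
    then show ?thesis using L.gconj_image_hom[OF i.group_hom_axioms v(1) yc] v(2) by simp
  qed
  moreover have "gconj F u d \<in> Q (Suc n)"
    using F.normal_gconj_closed[OF D_normal uc d] D_le_Q by blast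
  ultimately have "gconj F u (i y) \<otimes> gconj F u d \<in> Q (Suc n)"
    by (rule subgroup.m_closed[OF Q_subgroup])
  then show "gconj F u x \<in> Q (Suc n)"
    using x yc uc F.normal_carrier[OF D_normal d] by (simp add: F.gconj_mult)
qed

lemma R_decomp:
  assumes "x \<in> R" shows "inv (i (p x)) \<otimes> x \<in> S"
proof -
  have xc: "x \<in> carrier F" by (rule F.normal_carrier[OF R assms])
  have "i (p x) \<in> R" using assms i_K p_R by blast
  then have "inv (i (p x)) \<otimes> x \<in> R"
    by (intro F.normal_mult_closed[OF R] F.normal_m_inv_closed[OF R] assms)
  moreover have "p (inv (i (p x)) \<otimes> x) = \<one>\<^bsub>L\<^esub>" using xc by (simp add: p_i)
  ultimately show ?thesis using xc by (simp add: S_def kernel_def)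
qed

text \<open>Modulo \<open>Q (n + 1)\<close> the generators of \<open>Q n\<close> commute with \<open>F\<^sub>1\<close> and with the copy of \<open>L\<close>: a
  commutator with an element of \<open>F\<^sub>1\<close> falls into \<open>P (n + 1)\<close>, and a commutator of two elements of
  the copy of \<open>L\<close> stays in it.\<close>

lemma iter_comm_R_le_Q: "RF n \<subseteq> Q n"
proof (induction n)
  case 0
  show ?case
  proof
    fix x assume "x \<in> RF 0"
    then have x: "x \<in> R" by simp
    then have xc: "x \<in> carrier F" by (rule F.normal_carrier[OF R])
    have "inv (i (p x)) \<otimes> x \<in> D 0" using R_decomp[OF x] iter_comm_le_D[of 0] by auto
    moreover have "p x \<in> KL 0" using x p_R by auto
    ultimately have "i (p x) \<otimes> (inv (i (p x)) \<otimes> x) \<in> Q 0"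
      unfolding Q_def set_mult_iff by blast
    then show "x \<in> Q 0" using xc by simp
  qed
next
  case (Suc n)
  let ?Z = "{z \<in> carrier F. \<forall>y\<in>carrier F. gcomm F z y \<in> Q (Suc n)}"
  have Z: "subgroup ?Z F" by (rule normal_imp_subgroup[OF F.central_mod_normal[OF Q_Suc_normal]])
  have "P n \<subseteq> ?Z" using gcomm_P P_le_D D_le_Q F.normal_carrier[OF P_normal] by blast
  moreover have "SF n \<subseteq> ?Z"
  proof
    fix z assume z: "z \<in> SF n"
    have "gcomm F z y \<in> SF (Suc n)" if "y \<in> carrier F" for y
      unfolding iter_comm.simps by (rule F.comm_subgroup_incl[OF z that])
    then show "z \<in> ?Z"
      using iter_comm_le_D D_le_Q F.normal_carrier[OF D_iter_comm_normal z] by blast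
  qed
  ultimately have D: "D n \<subseteq> ?Z" unfolding D_def by (rule F.set_mult_minimal[OF Z])
  have "i ` KL n \<subseteq> ?Z"
  proof clarify
    fix y assume y: "y \<in> KL n"
    have yc: "y \<in> carrier L" by (rule iter_comm_L_carrier[OF y])
    have *: "gcomm F (i y) f \<in> Q (Suc n)" if f: "f \<in> F\<^sub>1 \<union> i ` carrier L" for f
    proof (cases "f \<in> F\<^sub>1")
      case True
      then show ?thesis using gcomm_i_F1[OF y] P_le_D D_le_Q by blast
    next
      case False
      obtain v where v: "v \<in> carrier L" "f = i v" by (rule image_LE[OF f False])
      have "gcomm L y v \<in> KL (Suc n)"
        unfolding iter_comm.simps by (rule L.comm_subgroup_incl[OF y v(1)])
      from i_iter_comm_le_Q[OF this] show ?thesis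
        unfolding v(2) L.gcomm_hom[OF i.group_hom_axioms yc v(1)] .
    qed
    have "gcomm F (i y) g \<in> Q (Suc n)" if "g \<in> carrier F" for g
    proof (rule F.gcomm_generate_mod[OF Q_Suc_normal _ _ _ generate.incl that[unfolded gen]])
      show "{i y} \<subseteq> carrier F" "F\<^sub>1 \<union> i ` carrier L \<subseteq> carrier F" using yc F1_carrier by auto
      show "i y \<in> {i y}" by simp
    qed (use * in auto)
    then show "i y \<in> carrier F \<and> (\<forall>g\<in>carrier F. gcomm F (i y) g \<in> Q (Suc n))" using yc by simp
  qed
  then have "Q n \<subseteq> ?Z" unfolding Q_def[of n] using D by (rule F.set_mult_minimal[OF Z])
  then show ?case unfolding iter_comm.simps using Suc.IH
    by (intro F.comm_subgroup_minimal Q_subgroup) blast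
qed

text \<open>The subgroup $[R,{}_nF]$ splits along the decomposition of an element $x$ into $i(p(x))$ and
  $i(p(x))^{-1}x$, like $R$ itself.\<close>

lemma iter_comm_R_iff:
  assumes "x \<in> carrier F"
  shows "x \<in> RF n \<longleftrightarrow>
    p x \<in> KL n \<and> inv (i (p x)) \<otimes> x \<in> D n"
proof
  assume "x \<in> RF n"
  then have xQ: "x \<in> Q n" using iter_comm_R_le_Q by blast
  obtain y d where x: "x = i y \<otimes> d" and y: "y \<in> KL n" and d: "d \<in> D n"
    using Q_decomp[OF xQ] by blast
  have c: "y \<in> carrier L" "d \<in> carrier F" using iter_comm_L_carrier[OF y] F.normal_carrier[OF D_normal d] .
  have "p d = \<one>\<^bsub>L\<^esub>" using d D_le_S S_le(2) by blast
  then have "p x = y" using x c by (simp add: p_i)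
  then show "p x \<in> KL n \<and> inv (i (p x)) \<otimes> x \<in> D n"
    using x y d c by simp
next
  assume a: "p x \<in> KL n \<and> inv (i (p x)) \<otimes> x \<in> D n"
  have "i (p x) \<in> RF n"
    using a i.iter_comm_image_subset[OF K R i_K, of n] by blast
  moreover have "inv (i (p x)) \<otimes> x \<in> RF n" using a D_le_iter_comm by blast
  ultimately have "i (p x) \<otimes> (inv (i (p x)) \<otimes> x) \<in> RF n"
    by (rule F.normal_mult_closed[OF F.iter_comm_normal[OF R]])
  then show "x \<in> RF n" using assms by simp
qed

lemma baer_group: "group (baer_invariant_of c L K)"
  unfolding baer_invariant_of_def by (rule normal.factorgroup_is_group[OF L.baer_subgroups(2)[OF K]])

text \<open>The two components of $x$ define the isomorphism. The second component of $xy$ differs from the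
  product of the second components of $x$ and $y$ by $[s,i(p(y))]$, where $s$ is the second
  component of $x$. This commutator is in $[S,\gamma_{c+1}(F)]\le[S,{}_cF]$.\<close>

theorem baer_invariant_of_split:
  shows "baer_invariant_of c F R \<cong> baer_invariant_of c L K \<times>\<times>
    (F\<lparr>carrier := S \<inter> lower_central F (c + 1)\<rparr> Mod (P c <#> iter_comm F S c (carrier F)))"
proof -
  let ?X = "F\<lparr>carrier := R \<inter> lower_central F (c + 1)\<rparr>"
  let ?Y = "L\<lparr>carrier := K \<inter> lower_central L (c + 1)\<rparr>"
  let ?Z = "F\<lparr>carrier := S \<inter> lower_central F (c + 1)\<rparr>"
  let ?N = "iter_comm L K c (carrier L)"
  note X = F.baer_subgroups[OF R, of c] and Y = L.baer_subgroups[OF K, of c]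
    and Z = F.baer_subgroups[OF S_normal, of c]
  have D\<gamma>: "D c \<subseteq> lower_central F (c + 1)"
    using D_le_iter_comm F.iter_comm_le_lower_central[OF R, of c] by auto
  have DZ: "D c \<lhd> ?Z"
    by (rule F.normal_restrict_supergroup[OF Z(1) D_normal]) (use D\<gamma> D_le_S in blast)
  have Ns: "subgroup ?N L" by (rule normal_imp_subgroup[OF L.iter_comm_normal[OF K]])
  have Ds: "subgroup (D c) F" by (rule normal_imp_subgroup[OF D_normal])
  define s where "s x = inv (i (p x)) \<otimes> x" for x
  have Xc: "x \<in> carrier F" if "x \<in> carrier ?X" for x
    using that F.normal_carrier[OF R] by auto
  have sc: "s x \<in> carrier F" if "x \<in> carrier F" for x using that by (simp add: s_def)
  have pX: "p x \<in> carrier ?Y" if "x \<in> carrier ?X" for x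
    using that p_R p.lower_central_image_subset[of "c + 1"] by auto
  have ip: "i (p x) \<in> lower_central F (c + 1)" if "x \<in> carrier ?X" for x
    using pX[OF that] i.lower_central_image_subset[of "c + 1"] by auto
  have sX: "s x \<in> carrier ?Z" if "x \<in> carrier ?X" for x
  proof -
    have "s x \<in> lower_central F (c + 1)" unfolding s_def
      using that ip[OF that]
      by (intro F.normal_mult_closed[OF F.lower_central_normal]
        F.normal_m_inv_closed[OF F.lower_central_normal]) auto
    then show ?thesis using R_decomp[of x] that by (auto simp: s_def)
  qed
  define \<Phi> where "\<Phi> x = (?N #>\<^bsub>L\<^esub> p x, D c #> s x)" for x
  have \<Phi>: "\<Phi> \<in> hom ?X ((?Y Mod ?N) \<times>\<times> (?Z Mod D c))"
  proof (rule homI)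
    show "\<Phi> x \<in> carrier ((?Y Mod ?N) \<times>\<times> (?Z Mod D c))" if "x \<in> carrier ?X" for x
      using pX[OF that] sX[OF that] by (simp add: \<Phi>_def carrier_FactGroup image_iff) blast
    fix x y assume x: "x \<in> carrier ?X" and y: "y \<in> carrier ?X"
    note xc = Xc[OF x] and yc = Xc[OF y]
    let ?g = "gcomm F (s x) (i (p y))"
    have "s x \<in> S" using sX[OF x] by simp
    then have "?g \<in> iter_comm F S (Suc c) (carrier F)"
      using ip[OF y] by (intro F.comm_lower_central[OF S_normal]) simp_all
    then have g: "?g \<in> D c"
      using F.iter_comm_Suc_subset[OF S_normal, of c] iter_comm_le_D[of c] by blast
    have gc: "?g \<in> carrier F" by (rule F.normal_carrier[OF D_normal g])
    have "s (x \<otimes> y) = s x \<otimes> ?g \<otimes> s y"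
      using xc yc by (simp add: s_def gcomm_def F.m_assoc F.inv_mult_group)
    then have "D c #> s (x \<otimes> y) = (D c #> s x) <#> (D c #> ?g) <#> (D c #> s y)"
      using sc xc yc gc by (simp add: normal.rcos_sum[OF D_normal])
    also have "D c #> ?g = D c #> \<one>"
      using g gc Ds by (simp add: F.coset_join2 subgroup.subset)
    also have "(D c #> s x) <#> (D c #> \<one>) = D c #> s x"
      using normal.rcos_sum[OF D_normal sc[OF xc] F.one_closed] sc[OF xc] by simp
    finally show "\<Phi> (x \<otimes>\<^bsub>?X\<^esub> y) = \<Phi> x \<otimes>\<^bsub>(?Y Mod ?N) \<times>\<times> (?Z Mod D c)\<^esub> \<Phi> y"
      using xc yc by (simp add: \<Phi>_def normal.rcos_sum[OF L.iter_comm_normal[OF K]])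
  qed
  interpret \<Phi>: group_hom ?X "(?Y Mod ?N) \<times>\<times> (?Z Mod D c)" \<Phi>
    by (intro group_homI \<Phi> DirProd_group F.subgroup_imp_group X(1)
      normal.factorgroup_is_group Y(2) DZ)
  have surj: "\<Phi> ` carrier ?X = carrier ((?Y Mod ?N) \<times>\<times> (?Z Mod D c))"
  proof
    show "\<Phi> ` carrier ?X \<subseteq> carrier ((?Y Mod ?N) \<times>\<times> (?Z Mod D c))"
      using \<Phi>.hom_closed by blast
    show "carrier ((?Y Mod ?N) \<times>\<times> (?Z Mod D c)) \<subseteq> \<Phi> ` carrier ?X"
    proof
      fix w assume "w \<in> carrier ((?Y Mod ?N) \<times>\<times> (?Z Mod D c))"
      then obtain y z where w: "w = (?N #>\<^bsub>L\<^esub> y, D c #> z)" and y: "y \<in> carrier ?Y" and z: "z \<in> carrier ?Z"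
        by (auto simp: carrier_FactGroup)
      have c: "y \<in> carrier L" "z \<in> carrier F" "p z = \<one>\<^bsub>L\<^esub>"
        using y z K_carrier F.normal_carrier[OF S_normal] S_le(2) by auto
      have pz: "p (i y \<otimes> z) = y" using c by (simp add: p_i)
      have "i y \<otimes> z \<in> R" using y z i_K S_le(1) by (intro F.normal_mult_closed[OF R]) auto
      moreover have "i y \<otimes> z \<in> lower_central F (c + 1)"
        using y z i.lower_central_image_subset[of "c + 1"]
        by (intro F.normal_mult_closed[OF F.lower_central_normal]) auto
      moreover have "\<Phi> (i y \<otimes> z) = w" using c by (simp add: \<Phi>_def s_def pz w)
      ultimately show "w \<in> \<Phi> ` carrier ?X" by (force simp: image_iff)
    qed
  qed
  have "kernel ?X ((?Y Mod ?N) \<times>\<times> (?Z Mod D c)) \<Phi> = {x \<in> carrier ?X. p x \<in> ?N \<and> s x \<in> D c}"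
  proof -
    have "\<Phi> x = \<one>\<^bsub>(?Y Mod ?N) \<times>\<times> (?Z Mod D c)\<^esub> \<longleftrightarrow> p x \<in> ?N \<and> s x \<in> D c" if "x \<in> carrier ?X" for x
      using Xc[OF that] sc L.r_coset_eq_iff[OF Ns] F.r_coset_eq_iff[OF Ds] by (simp add: \<Phi>_def)
    then show ?thesis unfolding kernel_def by blast
  qed
  also have "\<dots> = iter_comm F R c (carrier F)"
    using iter_comm_R_iff[OF Xc] subgroup.subset[OF normal_imp_subgroup[OF X(2)]]
    unfolding s_def by blast
  finally show ?thesis
    using \<Phi>.FactGroup_iso[OF surj] unfolding baer_invariant_of_def D_def by simp
qed

end

section \<open>Free products\<close>

locale group_family =
  fixes I :: "'i set" and G :: "'i \<Rightarrow> ('a, 'm) monoid_scheme"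
  assumes group_G: "i \<in> I \<Longrightarrow> group (G i)"
begin

abbreviation "FP \<equiv> free_product I G"
abbreviation "words \<equiv> fp_words I G"
abbreviation "cls w \<equiv> fp_rel I G `` {w}"
abbreviation "inc \<equiv> fp_incl I G"

lemma words_Nil [simp]: "[] \<in> words" by (simp add: fp_words_def)

lemma words_Cons [simp]: "(i, a) # w \<in> words \<longleftrightarrow> i \<in> I \<and> a \<in> carrier (G i) \<and> w \<in> words"
  by (auto simp: fp_words_def)

lemma words_append [simp]: "v @ w \<in> words \<longleftrightarrow> v \<in> words \<and> w \<in> words"
  by (auto simp: fp_words_def)

lemma fp_cong_words:
  assumes "fp_cong I G v w" shows "v \<in> words \<and> w \<in> words"
  using assms
proof induction
  case (fp_one i)
  then show ?case using monoid.one_closed[OF group.is_monoid[OF group_G]] by simp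
next
  case (fp_mult i a b)
  then show ?case using monoid.m_closed[OF group.is_monoid[OF group_G]] by simp
qed auto

lemma equiv_fp_rel: "equiv words (fp_rel I G)"
proof (rule equivI)
  show "fp_rel I G \<subseteq> words \<times> words" using fp_cong_words by (auto simp: fp_rel_def)
  show "refl_on words (fp_rel I G)" by (auto simp: refl_on_def fp_rel_def fp_refl)
  show "sym (fp_rel I G)" by (auto simp: sym_def fp_rel_def intro: fp_sym)
  show "trans (fp_rel I G)" unfolding trans_def fp_rel_def by (auto intro: fp_trans)
qed

lemma cls_eqI: "fp_cong I G v w \<Longrightarrow> cls v = cls w"
  using equiv_class_eq[OF equiv_fp_rel] by (simp add: fp_rel_def)

lemma carrier_FP: "carrier FP = cls ` words"
  by (auto simp: free_product_def quotient_def)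

lemma cls_closed: "w \<in> words \<Longrightarrow> cls w \<in> carrier FP"
  by (simp add: carrier_FP)

lemma one_FP: "\<one>\<^bsub>FP\<^esub> = cls []"
  by (simp add: free_product_def)

lemma mult_FP:
  assumes "v \<in> words" "w \<in> words" shows "cls v \<otimes>\<^bsub>FP\<^esub> cls w = cls (v @ w)"
proof -
  have "(\<lambda>v w. cls (v @ w)) respects2 (fp_rel I G)"
  proof (rule congruent2I')
    fix v v' w w' assume "(v, v') \<in> fp_rel I G" "(w, w') \<in> fp_rel I G"
    then have "fp_cong I G (v @ w) (v' @ w')" unfolding fp_rel_def by (simp add: fp_append)
    then show "cls (v @ w) = cls (v' @ w')" by (rule cls_eqI)
  qed
  from UN_equiv_class2[OF equiv_fp_rel equiv_fp_rel this assms]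
  show ?thesis by (simp add: free_product_def)
qed

lemma cls_reduce:
  assumes "fp_cong I G u u'" "v \<in> words" "w \<in> words"
  shows "cls (v @ u @ w) = cls (v @ u' @ w)"
  by (intro cls_eqI fp_append fp_refl assms)

lemma left_inverse:
  assumes "w \<in> words" shows "\<exists>v\<in>words. cls (v @ w) = cls []"
  using assms
proof (induction w)
  case (Cons x w)
  obtain i a where x: "x = (i, a)" by (cases x)
  then have ia: "i \<in> I" "a \<in> carrier (G i)" "w \<in> words" using Cons.prems by auto
  interpret Gi: group "G i" by (rule group_G[OF ia(1)])
  obtain v where v: "v \<in> words" "cls (v @ w) = cls []" using Cons.IH ia by blast
  let ?v = "v @ [(i, inv\<^bsub>G i\<^esub> a)]"
  have "fp_cong I G [(i, inv\<^bsub>G i\<^esub> a), (i, a)] [(i, inv\<^bsub>G i\<^esub> a \<otimes>\<^bsub>G i\<^esub> a)]"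
    using ia by (intro fp_mult) auto
  moreover have "fp_cong I G [(i, inv\<^bsub>G i\<^esub> a \<otimes>\<^bsub>G i\<^esub> a)] []" using ia by (simp add: fp_one)
  ultimately have "fp_cong I G [(i, inv\<^bsub>G i\<^esub> a), (i, a)] []" by (rule fp_trans)
  from cls_reduce[OF this v(1) ia(3)] have "cls (?v @ x # w) = cls []" using v x by simp
  moreover have "?v \<in> words" using v ia by simp
  ultimately show ?case by blast
qed auto

lemma group_FP: "group FP"
proof (rule groupI)
  fix X assume "X \<in> carrier FP"
  then obtain w where w: "w \<in> words" "X = cls w" by (auto simp: carrier_FP)
  then show "\<one>\<^bsub>FP\<^esub> \<otimes>\<^bsub>FP\<^esub> X = X" by (simp add: one_FP mult_FP)
  obtain v where "v \<in> words" "cls (v @ w) = cls []" using left_inverse[OF w(1)] by blast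
  then show "\<exists>Y\<in>carrier FP. Y \<otimes>\<^bsub>FP\<^esub> X = \<one>\<^bsub>FP\<^esub>"
    using w by (intro bexI[of _ "cls v"]) (auto simp: one_FP mult_FP cls_closed)
qed (auto simp: carrier_FP one_FP mult_FP)

lemma inc_closed: "i \<in> I \<Longrightarrow> a \<in> carrier (G i) \<Longrightarrow> inc i a \<in> carrier FP"
  unfolding fp_incl_def by (rule cls_closed) simp

lemma cls_Cons: "i \<in> I \<Longrightarrow> a \<in> carrier (G i) \<Longrightarrow> w \<in> words \<Longrightarrow> cls ((i, a) # w) = inc i a \<otimes>\<^bsub>FP\<^esub> cls w"
  by (simp add: fp_incl_def mult_FP)

lemma inc_hom: "i \<in> I \<Longrightarrow> inc i \<in> hom (G i) FP"
proof (rule homI)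
  assume i: "i \<in> I"
  fix a b assume ab: "a \<in> carrier (G i)" "b \<in> carrier (G i)"
  show "inc i a \<in> carrier FP" by (rule inc_closed[OF i ab(1)])
  have "inc i a \<otimes>\<^bsub>FP\<^esub> inc i b = cls [(i, a), (i, b)]"
    unfolding fp_incl_def using mult_FP[of "[(i, a)]" "[(i, b)]"] i ab by simp
  also have "\<dots> = inc i (a \<otimes>\<^bsub>G i\<^esub> b)" unfolding fp_incl_def by (rule cls_eqI[OF fp_mult[of i I a G b, OF i ab]])
  finally show "inc i (a \<otimes>\<^bsub>G i\<^esub> b) = inc i a \<otimes>\<^bsub>FP\<^esub> inc i b" by simp
qed

lemma group_hom_inc: "i \<in> I \<Longrightarrow> group_hom (G i) FP (inc i)"
  by (intro group_homI group_G group_FP inc_hom)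

lemma FP_induct [consumes 1, case_names one mult]:
  assumes "x \<in> carrier FP" "P \<one>\<^bsub>FP\<^esub>"
    and "\<And>i a y. i \<in> I \<Longrightarrow> a \<in> carrier (G i) \<Longrightarrow> y \<in> carrier FP \<Longrightarrow> P y \<Longrightarrow> P (inc i a \<otimes>\<^bsub>FP\<^esub> y)"
  shows "P x"
proof -
  have "P (cls w)" if "w \<in> words" for w
    using that
  proof (induction w)
    case (Cons x w)
    obtain i a where x: "x = (i, a)" by (cases x)
    then have "i \<in> I" "a \<in> carrier (G i)" "w \<in> words" using Cons.prems by auto
    then show ?case using Cons.IH assms(3)[of i a "cls w"] cls_closed[of w] by (simp add: x cls_Cons)
  qed (use assms(2) in \<open>simp add: one_FP\<close>)
  then show ?thesis using assms(1) by (auto simp: carrier_FP)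
qed

lemma FP_generate: "carrier FP = generate FP (\<Union>i\<in>I. inc i ` carrier (G i))"
proof
  have "(\<Union>i\<in>I. inc i ` carrier (G i)) \<subseteq> carrier FP" using inc_closed by blast
  then show "generate FP (\<Union>i\<in>I. inc i ` carrier (G i)) \<subseteq> carrier FP"
    by (rule group.generate_incl[OF group_FP])
  show "carrier FP \<subseteq> generate FP (\<Union>i\<in>I. inc i ` carrier (G i))"
  proof
    fix x assume "x \<in> carrier FP"
    then show "x \<in> generate FP (\<Union>i\<in>I. inc i ` carrier (G i))"
    proof (induction rule: FP_induct)
      case (mult i a y)
      then have "inc i a \<in> generate FP (\<Union>i\<in>I. inc i ` carrier (G i))"
        by (intro generate.incl UN_I[of i] imageI)
      then show ?case using mult(4) by (rule generate.eng)
    qed (rule generate.one)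
  qed
qed

lemma FP_subgroup_eq:
  assumes "subgroup S FP" "\<And>i a. i \<in> I \<Longrightarrow> a \<in> carrier (G i) \<Longrightarrow> inc i a \<in> S"
    and "x \<in> carrier FP"
  shows "x \<in> S"
  using assms(3)
  by (induction rule: FP_induct)
    (simp_all add: subgroup.one_closed[OF assms(1)] subgroup.m_closed[OF assms(1)] assms(2))

lemma hom_FP_eqI:
  assumes f: "group_hom FP K f" and g: "group_hom FP K g"
    and "\<And>i a. i \<in> I \<Longrightarrow> a \<in> carrier (G i) \<Longrightarrow> f (inc i a) = g (inc i a)"
    and "x \<in> carrier FP"
  shows "f x = g x"
  using assms(4)
proof (induction rule: FP_induct)
  case one
  show ?case using group_hom.hom_one[OF f] group_hom.hom_one[OF g] by simp
next
  case (mult i a y)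
  then show ?case
    using group_hom.hom_mult[OF f inc_closed mult(3)] group_hom.hom_mult[OF g inc_closed mult(3)] assms(3)
    by simp
qed

end

locale group_family_hom = group_family I G + K: group K
  for I :: "'i set" and G :: "'i \<Rightarrow> ('a, 'm) monoid_scheme" and K :: "('b, 'n) monoid_scheme" +
  fixes f :: "'i \<Rightarrow> 'a \<Rightarrow> 'b"
  assumes f: "i \<in> I \<Longrightarrow> f i \<in> hom (G i) K"
begin

definition "ev w = foldr (\<lambda>(i, a) k. f i a \<otimes>\<^bsub>K\<^esub> k) w \<one>\<^bsub>K\<^esub>"

lemma f_closed: "i \<in> I \<Longrightarrow> a \<in> carrier (G i) \<Longrightarrow> f i a \<in> carrier K"
  by (rule hom_in_carrier[OF f])

lemma ev_Nil: "ev [] = \<one>\<^bsub>K\<^esub>" by (simp add: ev_def)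

lemma ev_Cons: "ev ((i, a) # w) = f i a \<otimes>\<^bsub>K\<^esub> ev w" by (simp add: ev_def)

lemma ev_closed: "w \<in> words \<Longrightarrow> ev w \<in> carrier K"
  by (induction w) (auto simp: ev_Nil ev_Cons f_closed)

lemma ev_append: "v \<in> words \<Longrightarrow> w \<in> words \<Longrightarrow> ev (v @ w) = ev v \<otimes>\<^bsub>K\<^esub> ev w"
  by (induction v) (auto simp: ev_Nil ev_Cons ev_closed f_closed K.m_assoc)

lemma ev_cong: "fp_cong I G v w \<Longrightarrow> ev v = ev w"
proof (induction rule: fp_cong.induct)
  case (fp_one i)
  then show ?case using group_hom.hom_one[OF group_homI[OF group_G K.group_axioms f]]
    by (simp add: ev_Nil ev_Cons)
next
  case (fp_mult i a b)
  then show ?case using hom_mult[OF f] f_closed by (simp add: ev_Nil ev_Cons)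
next
  case (fp_append v v' w w')
  have w: "v \<in> words" "v' \<in> words" "w \<in> words" "w' \<in> words"
    using fp_cong_words[OF fp_append(1)] fp_cong_words[OF fp_append(2)] by auto
  show ?case unfolding ev_append[OF w(1,3)] ev_append[OF w(2,4)] using fp_append by simp
qed auto

lemma lift_cls:
  assumes "w \<in> words" shows "fp_lift K f (cls w) = ev w"
proof -
  have "w \<in> cls w" using assms by (simp add: fp_rel_def fp_refl)
  moreover have "ev v = ev w" if "v \<in> cls w" for v
    using that ev_cong[of w v] by (simp add: fp_rel_def)
  ultimately have "ev ` cls w = {ev w}" by blast
  then show ?thesis unfolding fp_lift_def ev_def[abs_def] by simp
qed

lemma lift_hom: "fp_lift K f \<in> hom FP K"
  by (rule homI) (auto simp: carrier_FP lift_cls ev_closed mult_FP ev_append)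

lemma group_hom_lift: "group_hom FP K (fp_lift K f)"
  by (intro group_homI group_FP K.group_axioms lift_hom)

lemma lift_inc: "i \<in> I \<Longrightarrow> a \<in> carrier (G i) \<Longrightarrow> fp_lift K f (inc i a) = f i a"
  by (simp add: fp_incl_def lift_cls ev_Cons ev_Nil f_closed)

end

context group_family begin

abbreviation mult_FP (infixl \<open>\<odot>\<close> 70) where "x \<odot> y \<equiv> x \<otimes>\<^bsub>FP\<^esub> y"

text \<open>The \<open>b\<close>-component of the natural map onto the direct product.\<close>

definition ret :: "'i \<Rightarrow> ('i \<times> 'a) list set \<Rightarrow> 'a" where
  "ret b = fp_lift (G b) (\<lambda>i a. if i = b then a else \<one>\<^bsub>G b\<^esub>)"

lemma family_hom_ret:
  assumes "b \<in> I" shows "group_family_hom I G (G b) (\<lambda>i a. if i = b then a else \<one>\<^bsub>G b\<^esub>)"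
proof -
  interpret Gb: group "G b" by (rule group_G[OF assms])
  show ?thesis
    by (unfold_locales) (auto simp: hom_def)
qed

lemma group_hom_ret: "b \<in> I \<Longrightarrow> group_hom FP (G b) (ret b)"
  unfolding ret_def by (rule group_family_hom.group_hom_lift[OF family_hom_ret])

lemma ret_inc: "b \<in> I \<Longrightarrow> i \<in> I \<Longrightarrow> a \<in> carrier (G i) \<Longrightarrow> ret b (inc i a) = (if i = b then a else \<one>\<^bsub>G b\<^esub>)"
  unfolding ret_def by (rule group_family_hom.lift_inc[OF family_hom_ret])

text \<open>The commutators of elements of different factors and their conjugates generate the
  cartesian subgroup.\<close>

definition cross_comm :: "('i \<times> 'a) list set set" where
  "cross_comm = normal_closure FP {gcomm FP (inc i a) (inc j b) | i j a b.
     i \<in> I \<and> j \<in> I \<and> i \<noteq> j \<and> a \<in> carrier (G i) \<and> b \<in> carrier (G j)}"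

abbreviation "cross_gens \<equiv> {gcomm FP (inc i a) (inc j b) | i j a b.
     i \<in> I \<and> j \<in> I \<and> i \<noteq> j \<and> a \<in> carrier (G i) \<and> b \<in> carrier (G j)}"

lemma cross_gens_carrier: "cross_gens \<subseteq> carrier FP"
  using inc_closed group.gcomm_closed[OF group_FP] by blast

lemma cross_comm_normal: "cross_comm \<lhd> FP"
  unfolding cross_comm_def by (rule group.normal_closure_normal[OF group_FP cross_gens_carrier])

lemma gcomm_inc_cross:
  assumes "i \<in> I" "j \<in> I" "i \<noteq> j" "a \<in> carrier (G i)" "b \<in> carrier (G j)"
  shows "gcomm FP (inc i a) (inc j b) \<in> cross_comm"
  unfolding cross_comm_def
  by (rule group.normal_closure_incl[OF group_FP cross_gens_carrier]) (use assms in blast)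

lemma ret_cross_comm:
  assumes "x \<in> cross_comm" "b \<in> I" shows "ret b x = \<one>\<^bsub>G b\<^esub>"
proof -
  interpret r: group_hom FP "G b" "ret b" by (rule group_hom_ret[OF assms(2)])
  have "ret b (gcomm FP (inc i a) (inc j c)) = \<one>\<^bsub>G b\<^esub>"
    if "i \<in> I" "j \<in> I" "i \<noteq> j" "a \<in> carrier (G i)" "c \<in> carrier (G j)" for i j a c
  proof -
    have "ret b (gcomm FP (inc i a) (inc j c)) = gcomm (G b) (ret b (inc i a)) (ret b (inc j c))"
      by (rule r.G.gcomm_hom[OF r.group_hom_axioms inc_closed inc_closed]) (use that in auto)
    also have "\<dots> = \<one>\<^bsub>G b\<^esub>"
      using that assms(2) by (auto simp: ret_inc gcomm_def)
    finally show ?thesis .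
  qed
  then have "cross_gens \<subseteq> kernel FP (G b) (ret b)"
    using cross_gens_carrier unfolding kernel_def by blast
  then have "cross_comm \<subseteq> kernel FP (G b) (ret b)"
    unfolding cross_comm_def by (rule r.G.normal_closure_minimal[OF r.normal_kernel])
  then show ?thesis using assms(1) by (auto simp: kernel_def)
qed

lemma gcomm_words_cross:
  assumes "b \<in> I" "b \<notin> J" "J \<subseteq> I" "a \<in> carrier (G b)" "w \<in> fp_words J G"
  shows "gcomm FP (inc b a) (cls w) \<in> cross_comm"
proof -
  interpret FP: group FP by (rule group_FP)
  let ?C = "{y \<in> carrier FP. \<forall>x\<in>{inc b a}. gcomm FP x y \<in> cross_comm}"
  have C: "subgroup ?C FP"
    by (rule FP.subgroup_centralizer_mod(2)[OF cross_comm_normal]) (simp add: inc_closed assms)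
  have "w \<in> words \<and> cls w \<in> ?C" using assms(5)
  proof (induction w)
    case Nil
    then show ?case using subgroup.one_closed[OF C] one_FP by simp
  next
    case (Cons x w)
    obtain j c where x: "x = (j, c)" by (cases x)
    have j: "j \<in> J" "c \<in> carrier (G j)" "w \<in> fp_words J G" using Cons.prems x by (auto simp: fp_words_def)
    then have jI: "j \<in> I" "b \<noteq> j" using assms by auto
    have w: "w \<in> words" "cls w \<in> ?C" using Cons.IH j(3) by auto
    have "inc j c \<in> ?C" using gcomm_inc_cross[OF assms(1) jI assms(4) j(2)] inc_closed[OF jI(1) j(2)] by simp
    then have "inc j c \<odot> cls w \<in> ?C" by (rule subgroup.m_closed[OF C _ w(2)])
    then show ?case using cls_Cons[OF jI(1) j(2) w(1)] jI(1) j(2) w(1) x by simp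
  qed
  then show ?thesis by simp
qed

text \<open>Modulo commutators of different factors the letters from one factor can be moved to the
  right end of a word.\<close>

lemma split_off_factor:
  assumes b: "b \<in> I" "b \<notin> J" and J: "J \<subseteq> I" and w: "w \<in> fp_words (insert b J) G"
  shows "w \<in> words \<and> (\<exists>m\<in>cross_comm. \<exists>w'\<in>fp_words J G. \<exists>a\<in>carrier (G b).
    cls w = m \<odot> cls w' \<odot> inc b a)"
  using w
proof (induction w)
  interpret FP: group FP by (rule group_FP)
  case Nil
  interpret Gb: group "G b" by (rule group_G[OF b(1)])
  have "cls [] = \<one>\<^bsub>FP\<^esub> \<odot> cls [] \<odot> inc b \<one>\<^bsub>G b\<^esub>"
    using group_hom.hom_one[OF group_hom_inc[OF b(1)]] by (simp flip: one_FP)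
  moreover have "[] \<in> fp_words J G" by (simp add: fp_words_def)
  ultimately show ?case
    using FP.normal_one_closed[OF cross_comm_normal] Gb.one_closed words_Nil by blast
next
  interpret FP: group FP by (rule group_FP)
  case (Cons x w)
  obtain i c where x: "x = (i, c)" by (cases x)
  have i: "i \<in> insert b J" "c \<in> carrier (G i)" "w \<in> fp_words (insert b J) G"
    using Cons.prems x by (auto simp: fp_words_def)
  then have iI: "i \<in> I" using b J by auto
  obtain m w' a where m: "m \<in> cross_comm" and w': "w' \<in> fp_words J G" and a: "a \<in> carrier (G b)"
    and w: "cls w = m \<odot> cls w' \<odot> inc b a" and ww: "w \<in> words" using Cons.IH i(3) by blast
  have w'w: "w' \<in> words" using w' J by (auto simp: fp_words_def)
  define z where "z = inc i c"
  have z: "z \<in> carrier FP" unfolding z_def by (rule inc_closed[OF iI i(2)])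
  note mc = FP.normal_carrier[OF cross_comm_normal m] and yc = cls_closed[OF w'w] and ac = inc_closed[OF b(1) a]
  define m' where "m' = gconj FP (inv\<^bsub>FP\<^esub> z) m"
  have m': "m' \<in> cross_comm" unfolding m'_def
    by (rule FP.normal_gconj_closed[OF cross_comm_normal FP.inv_closed[OF z] m])
  have "cls (x # w) = z \<odot> (m \<odot> cls w' \<odot> inc b a)"
    using cls_Cons[OF iI i(2) ww] x w by (simp add: z_def)
  also have "\<dots> = m' \<odot> (z \<odot> cls w') \<odot> inc b a"
    using z mc yc ac by (simp add: m'_def gconj_def FP.m_assoc)
  finally have e: "cls (x # w) = m' \<odot> (z \<odot> cls w') \<odot> inc b a" .
  have xw: "x # w \<in> words" using x iI i(2) ww by simp
  show ?case
  proof (cases "i = b")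
    case False
    then have "(i, c) # w' \<in> fp_words J G" using i w' by (auto simp: fp_words_def)
    moreover have "cls (x # w) = m' \<odot> cls ((i, c) # w') \<odot> inc b a"
      using e cls_Cons[OF iI i(2) w'w] by (simp add: z_def)
    ultimately show ?thesis using xw m' a by blast
  next
    case True
    define g where "g = gcomm FP z (cls w')"
    have g: "g \<in> cross_comm" unfolding g_def z_def True
      by (rule gcomm_words_cross[OF b J _ w']) (use i True in simp)
    let ?g = "gconj FP (inv\<^bsub>FP\<^esub> (cls w' \<odot> z)) g"
    have gc: "?g \<in> cross_comm"
      by (rule FP.normal_gconj_closed[OF cross_comm_normal _ g]) (use z yc in simp)
    have "z \<odot> cls w' = ?g \<odot> (cls w' \<odot> z)"
      using z yc by (simp add: g_def gcomm_def gconj_def FP.m_assoc FP.inv_mult_group)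
    then have "cls (x # w) = m' \<odot> (?g \<odot> (cls w' \<odot> z)) \<odot> inc b a" using e by simp
    also have "\<dots> = (m' \<odot> ?g) \<odot> cls w' \<odot> (z \<odot> inc b a)"
      using z yc ac FP.normal_carrier[OF cross_comm_normal m'] FP.normal_carrier[OF cross_comm_normal gc]
      by (simp add: FP.m_assoc del: FP.gconj_closed)
    also have "z \<odot> inc b a = inc b (c \<otimes>\<^bsub>G b\<^esub> a)"
      using hom_mult[OF inc_hom[OF b(1)]] i(2) a True by (simp add: z_def)
    finally have "cls (x # w) = (m' \<odot> ?g) \<odot> cls w' \<odot> inc b (c \<otimes>\<^bsub>G b\<^esub> a)" .
    moreover have "m' \<odot> ?g \<in> cross_comm"
      by (rule FP.normal_mult_closed[OF cross_comm_normal m' gc])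
    moreover have "c \<otimes>\<^bsub>G b\<^esub> a \<in> carrier (G b)"
      using i(2) a True monoid.m_closed[OF group.is_monoid[OF group_G[OF b(1)]]] by simp
    ultimately show ?thesis using xw w' by blast
  qed
qed

text \<open>The factors are split off one after the other. The part split off for \<open>b\<close> is the
  \<open>b\<close>-component, because the other parts have trivial \<open>b\<close>-component.\<close>

lemma words_decomposition:
  assumes "finite J" "J \<subseteq> I" "w \<in> fp_words J G"
  shows "\<exists>m\<in>cross_comm. \<exists>y\<in>generate FP {inc b (ret b (cls w)) | b. b \<in> J}. cls w = m \<odot> y"
  using assms
proof (induction J arbitrary: w rule: finite_induct)
  case empty
  interpret FP: group FP by (rule group_FP)
  have "w = []" using empty by (auto simp: fp_words_def)
  then have "cls w = \<one>\<^bsub>FP\<^esub> \<odot> \<one>\<^bsub>FP\<^esub>" by (simp flip: one_FP)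
  then show ?case using FP.normal_one_closed[OF cross_comm_normal] generate.one[of FP] by blast
next
  case (insert b J)
  interpret FP: group FP by (rule group_FP)
  have b: "b \<in> I" "b \<notin> J" "J \<subseteq> I" using insert by auto
  obtain m w' a where m: "m \<in> cross_comm" and w': "w' \<in> fp_words J G" and a: "a \<in> carrier (G b)"
    and w: "cls w = m \<odot> cls w' \<odot> inc b a" using split_off_factor[OF b insert.prems(2)] by blast
  have w'w: "w' \<in> words" using w' b by (auto simp: fp_words_def)
  note mc = FP.normal_carrier[OF cross_comm_normal m] and yc = cls_closed[OF w'w] and ac = inc_closed[OF b(1) a]
  have rw: "ret j (cls w) = ret j (cls w') \<otimes>\<^bsub>G j\<^esub> (if b = j then a else \<one>\<^bsub>G j\<^esub>)" if "j \<in> I" for j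
  proof -
    interpret r: group_hom FP "G j" "ret j" by (rule group_hom_ret[OF that])
    show ?thesis unfolding w using mc yc ac ret_cross_comm[OF m that] ret_inc[OF that b(1) a] by simp
  qed
  have ra: "ret b (cls w) = a"
  proof -
    interpret r: group_hom FP "G b" "ret b" by (rule group_hom_ret[OF b(1)])
    have "v \<in> fp_words J G \<Longrightarrow> v \<in> words \<and> ret b (cls v) = \<one>\<^bsub>G b\<^esub>" for v
    proof (induction v)
      case (Cons x v)
      obtain j c where x: "x = (j, c)" by (cases x)
      have j: "j \<in> J" "c \<in> carrier (G j)" "v \<in> fp_words J G" using Cons.prems x by (auto simp: fp_words_def)
      then have jI: "j \<in> I" "j \<noteq> b" using b by auto
      have v: "v \<in> words" "ret b (cls v) = \<one>\<^bsub>G b\<^esub>" using Cons.IH j(3) by auto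
      have "ret b (cls (x # v)) = ret b (inc j c) \<otimes>\<^bsub>G b\<^esub> ret b (cls v)"
        unfolding x cls_Cons[OF jI(1) j(2) v(1)]
        by (rule r.hom_mult[OF inc_closed[OF jI(1) j(2)] cls_closed[OF v(1)]])
      then show ?case using ret_inc[OF b(1) jI(1) j(2)] jI j(2) v x by simp
    qed (simp flip: one_FP)
    from this[OF w'] show ?thesis using rw[OF b(1)] a by simp
  qed
  have rj: "ret j (cls w) = ret j (cls w')" if "j \<in> J" for j
  proof -
    have jI: "j \<in> I" using that b by auto
    interpret r: group_hom FP "G j" "ret j" by (rule group_hom_ret[OF jI])
    show ?thesis using rw[OF jI] that b(2) yc by auto
  qed
  obtain m' y where m': "m' \<in> cross_comm" and y: "y \<in> generate FP {inc b (ret b (cls w')) | b. b \<in> J}"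
    and w'e: "cls w' = m' \<odot> y" using insert.IH[OF b(3) w'] by blast
  let ?X = "{inc j (ret j (cls w)) | j. j \<in> insert b J}"
  have Xc: "?X \<subseteq> carrier FP"
  proof clarify
    fix j assume "j \<in> insert b J"
    then have jI: "j \<in> I" using b by auto
    have "cls w \<in> carrier FP" unfolding w using mc yc ac by simp
    then show "inc j (ret j (cls w)) \<in> carrier FP"
      using jI inc_closed group_hom.hom_closed[OF group_hom_ret[OF jI]] by blast
  qed
  have "{inc b (ret b (cls w')) | b. b \<in> J} \<subseteq> ?X" using rj by force
  then have y': "y \<in> generate FP ?X" using y FP.mono_generate by blast
  have "inc b a \<in> ?X" using ra by blast
  then have "y \<odot> inc b a \<in> generate FP ?X" by (intro generate.eng y' generate.incl)
  moreover have "m \<odot> m' \<in> cross_comm" by (rule FP.normal_mult_closed[OF cross_comm_normal m m'])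
  moreover have "y \<in> carrier FP" using y' FP.generate_incl[OF Xc] by blast
  then have "cls w = (m \<odot> m') \<odot> (y \<odot> inc b a)"
    unfolding w w'e using mc ac FP.normal_carrier[OF cross_comm_normal m'] by (simp add: FP.m_assoc)
  ultimately show ?case by blast
qed

text \<open>Every element is the product of its components in the factors, in some order, up to
  commutators of different factors. Each component is the image of the element under an
  endomorphism of the free product, so it stays in every fully invariant subgroup that contains the
  element.\<close>

lemma FP_decomposition:
  assumes "x \<in> carrier FP"
  shows "\<exists>m\<in>cross_comm. \<exists>y\<in>generate FP {inc b (ret b x) | b. b \<in> I}. x = m \<odot> y"
proof -
  obtain w where w: "w \<in> words" "x = cls w" using assms by (auto simp: carrier_FP)
  let ?J = "fst ` set w"
  have "w \<in> fp_words ?J G" "?J \<subseteq> I" using w(1) by (force simp: fp_words_def)+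
  then obtain m y where *: "m \<in> cross_comm" "y \<in> generate FP {inc b (ret b x) | b. b \<in> ?J}" "x = m \<odot> y"
    using words_decomposition[of ?J w] w(2) by auto
  have "{inc b (ret b x) | b. b \<in> ?J} \<subseteq> {inc b (ret b x) | b. b \<in> I}" using \<open>?J \<subseteq> I\<close> by blast
  then have "y \<in> generate FP {inc b (ret b x) | b. b \<in> I}"
    using *(2) group.mono_generate[OF group_FP] by blast
  then show ?thesis using * by blast
qed

end

text \<open>The coordinates of the image of \<open>x\<close> in the restricted direct product are the components of
  \<open>x\<close>.\<close>

lemma cartesian_subgroup_ret:
  assumes "group_family I G"
  shows "cartesian_subgroup I G = {x \<in> carrier (free_product I G). \<forall>b\<in>I. group_family.ret G b x = \<one>\<^bsub>G b\<^esub>}"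
proof -
  interpret group_family I G by (rule assms)
  let ?f = "\<lambda>i a. \<lambda>j\<in>I. if j = i then a else \<one>\<^bsub>G j\<^esub>"
  have sg: "group (sum_group I G)" using group_G by simp
  interpret s: group_family_hom I G "sum_group I G" ?f
  proof (unfold_locales)
    fix i assume i: "i \<in> I"
    interpret Gi: group "G i" by (rule group_G[OF i])
    show "?f i \<in> hom (G i) (sum_group I G)"
    proof (rule homI)
      fix a assume a: "a \<in> carrier (G i)"
      have "finite {j \<in> I. ?f i a j \<noteq> \<one>\<^bsub>G j\<^esub>}" by (rule finite_subset[of _ "{i}"]) auto
      moreover have "?f i a \<in> (\<Pi>\<^sub>E j\<in>I. carrier (G j))"
        using a monoid.one_closed[OF group.is_monoid[OF group_G]] by auto
      ultimately show "?f i a \<in> carrier (sum_group I G)" by (simp add: carrier_sum_group group_G)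
      fix b assume "b \<in> carrier (G i)"
      then show "?f i (a \<otimes>\<^bsub>G i\<^esub> b) = ?f i a \<otimes>\<^bsub>sum_group I G\<^esub> ?f i b"
        using monoid.l_one[OF group.is_monoid[OF group_G] monoid.one_closed[OF group.is_monoid[OF group_G]]]
        by (auto simp: fun_eq_iff)
    qed
  qed (use sg in \<open>auto simp: group_def monoid_def group_axioms_def\<close>)
  let ?F = "fp_lift (sum_group I G) ?f"
  have c: "?F x b = ret b x" if x: "x \<in> carrier FP" and b: "b \<in> I" for x b
  proof (rule hom_FP_eqI[where f = "\<lambda>x. ?F x b" and K = "G b", OF _ group_hom_ret[OF b] _ x])
    have "?F y \<in> carrier (sum_group I G)" if "y \<in> carrier FP" for y
      by (rule group_hom.hom_closed[OF s.group_hom_lift that])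
    then have "?F y b \<in> carrier (G b)" if "y \<in> carrier FP" for y
      using that b by (force simp: carrier_sum_group group_G)
    moreover have "?F (y \<otimes>\<^bsub>FP\<^esub> z) b = ?F y b \<otimes>\<^bsub>G b\<^esub> ?F z b" if "y \<in> carrier FP" "z \<in> carrier FP" for y z
      using hom_mult[OF s.lift_hom that] b by simp
    ultimately show "group_hom FP (G b) (\<lambda>x. ?F x b)"
      by (intro group_homI group_FP group_G b homI)
    show "?F (inc i a) b = ret b (inc i a)" if "i \<in> I" "a \<in> carrier (G i)" for i a
      using s.lift_inc[OF that] ret_inc[OF b that] b by auto
  qed
  have "?F x = \<one>\<^bsub>sum_group I G\<^esub> \<longleftrightarrow> (\<forall>b\<in>I. ret b x = \<one>\<^bsub>G b\<^esub>)" if x: "x \<in> carrier FP" for x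
  proof -
    have "?F x \<in> carrier (sum_group I G)" by (rule group_hom.hom_closed[OF s.group_hom_lift x])
    then have "?F x \<in> extensional I" by (auto simp: carrier_sum_group group_G PiE_def)
    then have "?F x = \<one>\<^bsub>sum_group I G\<^esub> \<longleftrightarrow> (\<forall>b\<in>I. ?F x b = \<one>\<^bsub>G b\<^esub>)"
      by (auto intro!: extensionalityI[of _ I])
    then show ?thesis using c[OF x] by simp
  qed
  then show ?thesis unfolding cartesian_subgroup_def kernel_def by blast
qed

section \<open>Free groups are projective\<close>

lemma group_family_integers: "group_family X (\<lambda>_. integer_group)"
  by (rule group_family.intro) (rule group_integer_group)

lemma free_group_lift_family:
  assumes "group K" "f ` X \<subseteq> carrier K"
  shows "group_family_hom X (\<lambda>_. integer_group) K (\<lambda>x (n :: int). f x [^]\<^bsub>K\<^esub> n)"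
proof -
  interpret K: group K by (rule assms(1))
  show ?thesis
    by (intro group_family_hom.intro group_family_hom_axioms.intro group_family_integers assms(1)
      K.hom_integer_group_pow) (use assms(2) in auto)
qed

lemma group_free_group: "group (free_group X)"
  unfolding free_group_def by (rule group_family.group_FP[OF group_family_integers])

lemma free_group_projective:
  assumes "group K" "group G" "p \<in> epi K G" "f \<in> hom (free_group X) G"
  obtains h where "h \<in> hom (free_group X) K" "\<And>x. x \<in> carrier (free_group X) \<Longrightarrow> p (h x) = f x"
proof -
  interpret K: group K by (rule assms(1))
  interpret X: group_family X "\<lambda>_. integer_group" by (rule group_family_integers)
  have p: "p \<in> hom K G" "p ` carrier K = carrier G" using assms(3) by (auto simp: epi_def)
  interpret p: group_hom K G p by (intro group_homI assms p)
  interpret f: group_hom X.FP G f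
    using assms(4) by (intro group_homI X.group_FP assms) (simp add: free_group_def)
  define k where "k x = inv_into (carrier K) p (f (X.inc x (1 :: int)))" for x
  have k: "k x \<in> carrier K" "p (k x) = f (X.inc x 1)" if "x \<in> X" for x
  proof -
    have "f (X.inc x 1) \<in> p ` carrier K" using X.inc_closed[OF that] p(2) by simp
    then show "k x \<in> carrier K" "p (k x) = f (X.inc x 1)"
      unfolding k_def by (auto intro: inv_into_into f_inv_into_f)
  qed
  interpret h: group_family_hom X "\<lambda>_. integer_group" K "\<lambda>x (n :: int). k x [^]\<^bsub>K\<^esub> n"
    by (rule free_group_lift_family) (use k assms(1) in auto)
  let ?h = "fp_lift K (\<lambda>x (n :: int). k x [^]\<^bsub>K\<^esub> n)"
  have inc: "X.inc x n = X.inc x 1 [^]\<^bsub>X.FP\<^esub> n" if "x \<in> X" for x and n :: int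
    using group_hom.hom_int_pow[OF X.group_hom_inc[OF that], of 1 n] by simp
  have "p (?h x) = f x" if "x \<in> carrier X.FP" for x
  proof (rule X.hom_FP_eqI[where f = "\<lambda>x. p (?h x)", OF _ f.group_hom_axioms _ that])
    show "group_hom X.FP G (\<lambda>x. p (?h x))"
      using hom_compose[OF h.lift_hom p(1)] by (intro group_homI X.group_FP assms) (simp add: comp_def)
    fix x and n :: int assume x: "x \<in> X"
    then have "p (?h (X.inc x n)) = p (k x) [^]\<^bsub>G\<^esub> n" using h.lift_inc[OF x] k by (simp add: p.hom_int_pow)
    also have "\<dots> = f (X.inc x n)"
      unfolding inc[OF x, of n] using k x X.inc_closed[OF x] by (simp add: f.hom_int_pow)
    finally show "p (?h (X.inc x n)) = f (X.inc x n)" .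
  qed
  with h.lift_hom show thesis using that unfolding free_group_def by blast
qed

lemma free_on_projective:
  assumes "is_free_on F X" "group K" "group G" "p \<in> epi K G" "f \<in> hom F G"
  obtains h where "h \<in> hom F K" "\<And>x. x \<in> carrier F \<Longrightarrow> p (h x) = f x"
proof -
  let ?j = "free_group_lift F (\<lambda>x. x)"
  have j: "?j \<in> iso (free_group X) F" and F: "group F" using assms(1) by (auto simp: is_free_on_def)
  let ?i = "inv_into (carrier (free_group X)) ?j"
  have i: "?i \<in> iso F (free_group X)" by (rule group.iso_set_sym[OF group_free_group j])
  have "f \<circ> ?j \<in> hom (free_group X) G" by (rule hom_compose[OF _ assms(5)]) (use j in \<open>simp add: iso_def\<close>)
  from free_group_projective[OF assms(2-4) this] obtain h where h: "h \<in> hom (free_group X) K"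
    and ph: "\<And>x. x \<in> carrier (free_group X) \<Longrightarrow> p (h x) = (f \<circ> ?j) x" by blast
  show thesis
  proof (rule that)
    show "h \<circ> ?i \<in> hom F K" by (rule hom_compose[OF _ h]) (use i in \<open>simp add: iso_def\<close>)
    fix x assume x: "x \<in> carrier F"
    then have "?i x \<in> carrier (free_group X)" using i by (auto simp: iso_def hom_def)
    moreover have "?j (?i x) = x" using x j by (auto simp: iso_def bij_betw_def intro: f_inv_into_f)
    ultimately show "p ((h \<circ> ?i) x) = f x" using ph by simp
  qed
qed

lemma free_group_lift_epi:
  assumes "group G" shows "free_group_lift G (\<lambda>g. g) \<in> epi (free_group (carrier G)) G"
proof -
  interpret G: group G by (rule assms)
  interpret h: group_family_hom "carrier G" "\<lambda>_. integer_group" G "\<lambda>x (n :: int). x [^]\<^bsub>G\<^esub> n"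
    by (rule free_group_lift_family) (use assms in auto)
  have "g \<in> free_group_lift G (\<lambda>g. g) ` carrier (free_group (carrier G))" if "g \<in> carrier G" for g
  proof (rule image_eqI)
    show "g = free_group_lift G (\<lambda>g. g) (h.inc g 1)"
      using h.lift_inc[OF that, of 1] that by (simp add: free_group_lift_def)
    show "h.inc g 1 \<in> carrier (free_group (carrier G))"
      unfolding free_group_def by (rule h.inc_closed) (use that in auto)
  qed
  then show ?thesis
    using h.lift_hom group_hom.hom_closed[OF h.group_hom_lift]
    unfolding epi_def free_group_lift_def free_group_def by auto
qed

section \<open>The free product of two groups\<close>

locale free_product_pair = G: group G + H: group H
  for G :: "'a monoid" and H :: "'b monoid"
begin

lemma inj_Inl: "inj_on (Inl :: 'a \<Rightarrow> 'a + 'b) (carrier G)"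
  and inj_Inr: "inj_on (Inr :: 'b \<Rightarrow> 'a + 'b) (carrier H)" by auto

sublocale fam: group_family UNIV "fp2_factor G H"
proof (rule group_family.intro)
  fix b :: bool
  show "group (fp2_factor G H b)"
    unfolding fp2_factor_def
    using G.inj_imp_image_group_is_group[OF inj_Inl] H.inj_imp_image_group_is_group[OF inj_Inr] by auto
qed

lemma Inl_hom: "Inl \<in> hom G (fp2_factor G H True)"
  using inj_imp_image_group_iso[OF inj_Inl] by (simp add: fp2_factor_def iso_def)

lemma Inr_hom: "Inr \<in> hom H (fp2_factor G H False)"
  using inj_imp_image_group_iso[OF inj_Inr] by (simp add: fp2_factor_def iso_def)

lemma carrier_factor:
  "carrier (fp2_factor G H True) = Inl ` carrier G" "carrier (fp2_factor G H False) = Inr ` carrier H"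
  by (simp_all add: fp2_factor_def image_group_carrier)

lemma group_star: "group (G \<star> H)"
  unfolding free_product2_def by (rule fam.group_FP)

lemma inl_hom: "fp2_inl G H \<in> hom G (G \<star> H)"
  using hom_compose[OF Inl_hom fam.inc_hom[of True]]
  by (simp add: free_product2_def fp2_inl_def[abs_def] comp_def)

lemma inr_hom: "fp2_inr G H \<in> hom H (G \<star> H)"
  using hom_compose[OF Inr_hom fam.inc_hom[of False]]
  by (simp add: free_product2_def fp2_inr_def[abs_def] comp_def)

lemma star_generate:
  "carrier (G \<star> H) = generate (G \<star> H) (fp2_inl G H ` carrier G \<union> fp2_inr G H ` carrier H)"
proof -
  have "(\<Union>b\<in>UNIV. fam.inc b ` carrier (fp2_factor G H b)) =
      fp2_inl G H ` carrier G \<union> fp2_inr G H ` carrier H"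
    by (simp add: UNIV_bool carrier_factor fp2_inl_def[abs_def] fp2_inr_def[abs_def] image_image Un_commute)
  then show ?thesis using fam.FP_generate by (simp add: free_product2_def)
qed

definition star_lift :: "('c, 'n) monoid_scheme \<Rightarrow> ('a \<Rightarrow> 'c) \<Rightarrow> ('b \<Rightarrow> 'c) \<Rightarrow>
    (bool \<times> ('a + 'b)) list set \<Rightarrow> 'c" where
  "star_lift K f g = fp_lift K (\<lambda>_ x. case x of Inl a \<Rightarrow> f a | Inr b \<Rightarrow> g b)"

lemma star_lift:
  assumes "group K" "f \<in> hom G K" "g \<in> hom H K"
  shows star_lift_hom: "star_lift K f g \<in> hom (G \<star> H) K"
    and star_lift_inl: "a \<in> carrier G \<Longrightarrow> star_lift K f g (fp2_inl G H a) = f a"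
    and star_lift_inr: "b \<in> carrier H \<Longrightarrow> star_lift K f g (fp2_inr G H b) = g b"
proof -
  interpret K: group K by (rule assms(1))
  let ?f = "\<lambda>(_ :: bool) x. case x of Inl a \<Rightarrow> f a | Inr b \<Rightarrow> g b"
  interpret l: group_family_hom UNIV "fp2_factor G H" K ?f
  proof (intro group_family_hom.intro group_family_hom_axioms.intro fam.group_family_axioms assms(1))
    fix b :: bool
    show "?f b \<in> hom (fp2_factor G H b) K"
    proof (cases b)
      case True
      have "?f b \<in> hom (image_group Inl G) K"
        using assms(2) by (auto simp: hom_def image_group_def)
      then show ?thesis using True by (simp add: fp2_factor_def)
    next
      case False
      have "?f b \<in> hom (image_group Inr H) K"
        using assms(3) by (auto simp: hom_def image_group_def)
      then show ?thesis using False by (simp add: fp2_factor_def)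
    qed
  qed
  show "star_lift K f g \<in> hom (G \<star> H) K" unfolding star_lift_def free_product2_def by (rule l.lift_hom)
  show "a \<in> carrier G \<Longrightarrow> star_lift K f g (fp2_inl G H a) = f a"
    unfolding star_lift_def fp2_inl_def by (subst l.lift_inc) (auto simp: carrier_factor)
  show "b \<in> carrier H \<Longrightarrow> star_lift K f g (fp2_inr G H b) = g b"
    unfolding star_lift_def fp2_inr_def by (subst l.lift_inc) (auto simp: carrier_factor)
qed

lemma star_subgroup_eq:
  assumes "subgroup S (G \<star> H)" "\<And>a. a \<in> carrier G \<Longrightarrow> fp2_inl G H a \<in> S"
    "\<And>b. b \<in> carrier H \<Longrightarrow> fp2_inr G H b \<in> S" "x \<in> carrier (G \<star> H)"
  shows "x \<in> S"
proof -
  have "fp2_inl G H ` carrier G \<union> fp2_inr G H ` carrier H \<subseteq> S" using assms(2,3) by blast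
  from group.generate_subgroup_incl[OF group_star this assms(1)]
  show ?thesis using assms(4) star_generate by blast
qed

lemma star_hom_eqI:
  assumes f: "group_hom (G \<star> H) K f" and g: "group_hom (G \<star> H) K g"
    and "\<And>a. a \<in> carrier G \<Longrightarrow> f (fp2_inl G H a) = g (fp2_inl G H a)"
    and "\<And>b. b \<in> carrier H \<Longrightarrow> f (fp2_inr G H b) = g (fp2_inr G H b)" and x: "x \<in> carrier (G \<star> H)"
  shows "f x = g x"
proof -
  interpret f: group_hom "G \<star> H" K f by (rule f)
  interpret g: group_hom "G \<star> H" K g by (rule g)
  let ?S = "{x \<in> carrier (G \<star> H). f x = g x}"
  have "subgroup ?S (G \<star> H)"
    by (rule f.G.subgroupI) (auto intro!: exI[of _ "\<one>\<^bsub>G \<star> H\<^esub>"])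
  from star_subgroup_eq[OF this _ _ x] show ?thesis
    using assms(3,4) hom_in_carrier[OF inl_hom] hom_in_carrier[OF inr_hom] by blast
qed

lemma star_projective:
  assumes "is_free_on G X" "is_free_on H Y" "group K" "group L" "p \<in> epi K L" "f \<in> hom (G \<star> H) L"
  obtains h where "h \<in> hom (G \<star> H) K" "\<And>x. x \<in> carrier (G \<star> H) \<Longrightarrow> p (h x) = f x"
proof -
  have "f \<circ> fp2_inl G H \<in> hom G L" by (rule hom_compose[OF inl_hom assms(6)])
  from free_on_projective[OF assms(1,3,4,5) this] obtain h1 where
    h1: "h1 \<in> hom G K" "\<And>x. x \<in> carrier G \<Longrightarrow> p (h1 x) = (f \<circ> fp2_inl G H) x" by blast
  have "f \<circ> fp2_inr G H \<in> hom H L" by (rule hom_compose[OF inr_hom assms(6)])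
  from free_on_projective[OF assms(2,3,4,5) this] obtain h2 where
    h2: "h2 \<in> hom H K" "\<And>x. x \<in> carrier H \<Longrightarrow> p (h2 x) = (f \<circ> fp2_inr G H) x" by blast
  let ?h = "star_lift K h1 h2"
  note h = star_lift[OF assms(3) h1(1) h2(1)]
  have p: "p \<in> hom K L" using assms(5) by (simp add: epi_def)
  have "p (?h x) = f x" if "x \<in> carrier (G \<star> H)" for x
  proof (rule star_hom_eqI[where f = "\<lambda>x. p (?h x)", OF _ _ _ _ that])
    show "group_hom (G \<star> H) L (\<lambda>x. p (?h x))"
      using hom_compose[OF h(1) p] by (intro group_homI group_star assms) (simp add: comp_def)
    show "group_hom (G \<star> H) L f" by (intro group_homI group_star assms)
  qed (use h h1 h2 in auto)
  with h(1) show thesis using that by blast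
qed

end

text \<open>The last three hypotheses say that \<open>F\<close> and the free group on the elements of \<open>G\<close> are projective
  over \<open>G\<close>. They are restricted to lifts from one of these groups to the other, because a
  hypothesis cannot quantify over groups of all types.\<close>

theorem baer_invariant_presentation:
  fixes G :: "'a monoid"
  assumes F: "group F" and G: "group G" and p: "p \<in> epi F G"
    and h: "h \<in> hom F (free_group (carrier G))"
      "\<And>x. x \<in> carrier F \<Longrightarrow> free_group_lift G (\<lambda>g. g) (h x) = p x"
    and lift: "\<And>f. f \<in> hom (free_group (carrier G)) G \<Longrightarrow>
      \<exists>k\<in>hom (free_group (carrier G)) F. \<forall>x\<in>carrier (free_group (carrier G)). p (k x) = f x"
  shows "baer_invariant c G \<cong> baer_invariant_of c F (kernel F G p)"
proof -
  let ?l = "free_group_lift G (\<lambda>g. g)"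
  have l: "?l \<in> hom (free_group (carrier G)) G"
    using free_group_lift_epi[OF G] by (simp add: epi_def)
  from lift[OF l] obtain k where k: "k \<in> hom (free_group (carrier G)) F"
    "\<And>x. x \<in> carrier (free_group (carrier G)) \<Longrightarrow> p (k x) = ?l x" by blast
  have "p \<in> hom F G" using p by (simp add: epi_def)
  then show ?thesis unfolding baer_invariant_def
    by (intro baer_invariant_of_independent[of "free_group (carrier G)" G ?l F p k h]
      group_homI group_free_group F G l k h)
qed

section \<open>Verbal subgroups\<close>

lemma law_value_Nil: "law_value G x [] = \<one>\<^bsub>G\<^esub>" by (simp add: law_value_def)

lemma law_value_Cons: "law_value G x ((i, b) # w) = (if b then x i else inv\<^bsub>G\<^esub> (x i)) \<otimes>\<^bsub>G\<^esub> law_value G x w"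
  by (simp add: law_value_def)

lemma (in group) law_value_closed: "range x \<subseteq> carrier G \<Longrightarrow> law_value G x w \<in> carrier G"
proof (induction w)
  case (Cons l w)
  obtain i b where l: "l = (i, b)" by (cases l)
  have "x i \<in> carrier G" using Cons.prems by auto
  then show ?case unfolding l law_value_Cons using Cons by simp
qed (simp add: law_value_Nil)

lemma (in group_hom) law_value_hom:
  assumes x: "range x \<subseteq> carrier G"
  shows "h (law_value G x w) = law_value H (h \<circ> x) w"
proof (induction w)
  case (Cons l w)
  obtain i b where l: "l = (i, b)" by (cases l)
  have "x i \<in> carrier G" using x by auto
  then show ?case unfolding l law_value_Cons using Cons G.law_value_closed[OF x, of w] by (simp add: comp_def)
qed (simp add: law_value_Nil)

abbreviation "law_values V G \<equiv> {law_value G x w |x w. w \<in> V \<and> range x \<subseteq> carrier G}"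

lemma (in group) law_values_carrier: "law_values V G \<subseteq> carrier G"
  using law_value_closed by blast

lemma (in group) verbal_subgroup_carrier: "verbal_subgroup V G \<subseteq> carrier G"
  unfolding verbal_subgroup_def by (rule generate_incl[OF law_values_carrier])

lemma (in group) verbal_subgroup_subgroup: "subgroup (verbal_subgroup V G) G"
  unfolding verbal_subgroup_def by (rule generate_is_subgroup[OF law_values_carrier])

lemma (in group_hom) verbal_subgroup_image:
  "h ` verbal_subgroup V G \<subseteq> verbal_subgroup V H"
  unfolding verbal_subgroup_def
proof (rule generate_image_subset[OF G.law_values_carrier _ H.law_values_carrier])
  show "h ` law_values V G \<subseteq> law_values V H"
  proof clarify
    fix x :: "nat \<Rightarrow> 'a" and w assume x: "w \<in> V" "range x \<subseteq> carrier G"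
    then have "range (h \<circ> x) \<subseteq> carrier H" by auto
    then show "\<exists>x' w'. h (law_value G x w) = law_value H x' w' \<and> w' \<in> V \<and> range x' \<subseteq> carrier H"
      using law_value_hom[OF x(2), of w] x(1) by blast
  qed
qed

lemma (in group_hom) verbal_subgroup_image_epi:
  assumes "h ` carrier G = carrier H"
  shows "verbal_subgroup V H \<subseteq> h ` verbal_subgroup V G"
proof -
  have "law_values V H \<subseteq> h ` law_values V G"
  proof clarify
    fix y :: "nat \<Rightarrow> 'c" and w assume y: "w \<in> V" "range y \<subseteq> carrier H"
    define x where "x n = inv_into (carrier G) h (y n)" for n :: nat
    have x: "x n \<in> carrier G \<and> h (x n) = y n" for n :: nat
    proof -
      have "y n \<in> h ` carrier G" using y(2) assms by auto
      then show ?thesis unfolding x_def by (simp add: inv_into_into f_inv_into_f)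
    qed
    then have "range x \<subseteq> carrier G" "h \<circ> x = y" by auto
    then have "law_value H y w = h (law_value G x w)" using law_value_hom by metis
    then show "law_value H y w \<in> h ` law_values V G" using y(1) \<open>range x \<subseteq> carrier G\<close> by blast
  qed
  from H.mono_generate[OF this] show ?thesis
    unfolding verbal_subgroup_def generate_img[OF G.law_values_carrier, symmetric] .
qed

lemma (in group) verbal_subgroup_normal: "verbal_subgroup V G \<lhd> G"
proof (rule normalI_gconj[OF verbal_subgroup_subgroup])
  fix u x assume u: "u \<in> carrier G" and x: "x \<in> verbal_subgroup V G"
  interpret c: group_hom G G "gconj G u" by (intro group_homI group_axioms gconj_hom u)
  show "gconj G u x \<in> verbal_subgroup V G" using c.verbal_subgroup_image x by blast
qed

lemma hom_eq_on_generate: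
  assumes f: "group_hom G K f" and g: "group_hom G K g" and X: "X \<subseteq> carrier G"
    "\<And>x. x \<in> X \<Longrightarrow> f x = g x" and x: "x \<in> generate G X"
  shows "f x = g x"
proof -
  interpret f: group_hom G K f by (rule f)
  interpret g: group_hom G K g by (rule g)
  have "subgroup {x \<in> carrier G. f x = g x} G"
    by (rule f.G.subgroupI) (auto intro!: exI[of _ "\<one>\<^bsub>G\<^esub>"])
  then have "generate G X \<subseteq> {x \<in> carrier G. f x = g x}"
    using X by (intro f.G.generate_subgroup_incl) auto
  then show ?thesis using x by blast
qed

section \<open>The verbal wreath product\<close>

locale wreath = A: group A + B: group B for A :: "'a monoid" and B :: "'b monoid"
begin

sublocale fam: group_family "carrier B" "\<lambda>_. A"
  by (rule group_family.intro) (rule A.group_axioms)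

abbreviation "C \<equiv> free_product (carrier B) (\<lambda>_. A)"

sublocale C: group C by (rule fam.group_FP)

abbreviation "shift \<equiv> wreath_shift A B"

lemma shift_family:
  assumes "b' \<in> carrier B"
  shows "group_family_hom (carrier B) (\<lambda>_. A) C (\<lambda>b a. fam.inc (b \<otimes>\<^bsub>B\<^esub> b') a)"
  by (intro group_family_hom.intro group_family_hom_axioms.intro fam.group_family_axioms C.group_axioms
    fam.inc_hom B.m_closed assms)

lemma group_hom_shift: "b' \<in> carrier B \<Longrightarrow> group_hom C C (shift b')"
  unfolding wreath_shift_def by (rule group_family_hom.group_hom_lift[OF shift_family])

lemma shift_inc:
  "b' \<in> carrier B \<Longrightarrow> b \<in> carrier B \<Longrightarrow> a \<in> carrier A \<Longrightarrow> shift b' (fam.inc b a) = fam.inc (b \<otimes>\<^bsub>B\<^esub> b') a"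
  unfolding wreath_shift_def by (rule group_family_hom.lift_inc[OF shift_family])

lemma shift_closed: "b \<in> carrier B \<Longrightarrow> x \<in> carrier C \<Longrightarrow> shift b x \<in> carrier C"
  by (rule group_hom.hom_closed[OF group_hom_shift])

lemma group_hom_shift_comp: "b \<in> carrier B \<Longrightarrow> b' \<in> carrier B \<Longrightarrow> group_hom C C (\<lambda>x. shift b' (shift b x))"
  using hom_compose[OF group_hom.homh[OF group_hom_shift] group_hom.homh[OF group_hom_shift], of b b']
  by (intro group_homI C.group_axioms) (simp add: comp_def)

lemma shift_shift:
  assumes "b \<in> carrier B" "b' \<in> carrier B" "x \<in> carrier C"
  shows "shift b' (shift b x) = shift (b \<otimes>\<^bsub>B\<^esub> b') x"
  by (rule fam.hom_FP_eqI[where f = "\<lambda>x. shift b' (shift b x)", OF group_hom_shift_comp group_hom_shift _ assms(3)])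
    (use assms in \<open>simp_all add: shift_inc B.m_assoc\<close>)

lemma shift_one:
  assumes "x \<in> carrier C" shows "shift \<one>\<^bsub>B\<^esub> x = x"
proof (rule fam.hom_FP_eqI[where g = "\<lambda>x. x", OF group_hom_shift _ _ assms])
  show "group_hom C C (\<lambda>x. x)" by (intro group_homI C.group_axioms) (simp add: hom_def)
qed (simp_all add: shift_inc)

text \<open>The semidirect product of the free product \<open>C\<close> by \<open>B\<close>, of which all verbal wreath
  products are quotients; it is isomorphic to the free product of \<open>A\<close> and \<open>B\<close>.\<close>

definition W0 :: "('b \<times> ('b \<times> 'a) list set) monoid" where
  "W0 = \<lparr>carrier = carrier B \<times> carrier C,
    monoid.mult = (\<lambda>(b\<^sub>1, g\<^sub>1) (b\<^sub>2, g\<^sub>2). (b\<^sub>1 \<otimes>\<^bsub>B\<^esub> b\<^sub>2, shift b\<^sub>2 g\<^sub>1 \<otimes>\<^bsub>C\<^esub> g\<^sub>2)),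
    one = (\<one>\<^bsub>B\<^esub>, \<one>\<^bsub>C\<^esub>)\<rparr>"

lemma W0_simps:
  "carrier W0 = carrier B \<times> carrier C" "\<one>\<^bsub>W0\<^esub> = (\<one>\<^bsub>B\<^esub>, \<one>\<^bsub>C\<^esub>)"
  "(b\<^sub>1, g\<^sub>1) \<otimes>\<^bsub>W0\<^esub> (b\<^sub>2, g\<^sub>2) = (b\<^sub>1 \<otimes>\<^bsub>B\<^esub> b\<^sub>2, shift b\<^sub>2 g\<^sub>1 \<otimes>\<^bsub>C\<^esub> g\<^sub>2)"
  by (simp_all add: W0_def)

lemma shift_mult:
  "b \<in> carrier B \<Longrightarrow> x \<in> carrier C \<Longrightarrow> y \<in> carrier C \<Longrightarrow> shift b (x \<otimes>\<^bsub>C\<^esub> y) = shift b x \<otimes>\<^bsub>C\<^esub> shift b y"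
  by (rule group_hom.hom_mult[OF group_hom_shift])

lemma shift_1: "b \<in> carrier B \<Longrightarrow> shift b \<one>\<^bsub>C\<^esub> = \<one>\<^bsub>C\<^esub>"
  by (rule group_hom.hom_one[OF group_hom_shift])

lemma group_W0: "group W0"
proof (rule groupI)
  fix x y z assume "x \<in> carrier W0" "y \<in> carrier W0" "z \<in> carrier W0"
  then obtain b1 g1 b2 g2 b3 g3 where "x = (b1, g1)" "y = (b2, g2)" "z = (b3, g3)"
    "b1 \<in> carrier B" "b2 \<in> carrier B" "b3 \<in> carrier B" "g1 \<in> carrier C" "g2 \<in> carrier C" "g3 \<in> carrier C"
    by (auto simp: W0_simps)
  then show "x \<otimes>\<^bsub>W0\<^esub> y \<otimes>\<^bsub>W0\<^esub> z = x \<otimes>\<^bsub>W0\<^esub> (y \<otimes>\<^bsub>W0\<^esub> z)"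
    by (simp add: W0_simps B.m_assoc C.m_assoc shift_mult shift_shift shift_closed)
next
  fix x assume "x \<in> carrier W0"
  then obtain b g where x: "x = (b, g)" "b \<in> carrier B" "g \<in> carrier C" by (auto simp: W0_simps)
  show "\<one>\<^bsub>W0\<^esub> \<otimes>\<^bsub>W0\<^esub> x = x" using x by (simp add: W0_simps shift_1)
  let ?y = "(inv\<^bsub>B\<^esub> b, shift (inv\<^bsub>B\<^esub> b) (inv\<^bsub>C\<^esub> g))"
  have "?y \<in> carrier W0" "?y \<otimes>\<^bsub>W0\<^esub> x = \<one>\<^bsub>W0\<^esub>"
    using x by (simp_all add: W0_simps shift_closed shift_shift shift_one)
  then show "\<exists>y\<in>carrier W0. y \<otimes>\<^bsub>W0\<^esub> x = \<one>\<^bsub>W0\<^esub>" by blast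
qed (auto simp: W0_simps shift_closed)

text \<open>The subgroup that is factored out in the verbal product of the copies of \<open>A\<close>.\<close>

definition C_V :: "law set \<Rightarrow> ('b \<times> 'a) list set set" where
  "C_V V = verbal_subgroup V C \<inter> cartesian_subgroup (carrier B) (\<lambda>_. A)"

lemma C_V_iff: "x \<in> C_V V \<longleftrightarrow> x \<in> verbal_subgroup V C \<and> (\<forall>b\<in>carrier B. fam.ret b x = \<one>\<^bsub>A\<^esub>)"
  using C.verbal_subgroup_carrier unfolding C_V_def cartesian_subgroup_ret[OF fam.group_family_axioms] by blast

lemma C_V_normal: "C_V V \<lhd> C"
proof (rule C.normalI_gconj)
  have r: "fam.ret b \<in> hom C A" if "b \<in> carrier B" for b
    by (rule group_hom.homh[OF fam.group_hom_ret[OF that]])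
  have c: "x \<in> carrier C" if "x \<in> verbal_subgroup V C" for x using that C.verbal_subgroup_carrier by blast
  show "subgroup (C_V V) C"
  proof (rule C.subgroupI)
    show "C_V V \<subseteq> carrier C" using c by (auto simp: C_V_iff)
    have "\<one>\<^bsub>C\<^esub> \<in> C_V V" using subgroup.one_closed[OF C.verbal_subgroup_subgroup]
      group_hom.hom_one[OF fam.group_hom_ret] by (simp add: C_V_iff)
    then show "C_V V \<noteq> {}" by blast
    fix x y assume x: "x \<in> C_V V" and y: "y \<in> C_V V"
    show "inv\<^bsub>C\<^esub> x \<in> C_V V" using x subgroup.m_inv_closed[OF C.verbal_subgroup_subgroup]
      group_hom.hom_inv[OF fam.group_hom_ret] c by (simp add: C_V_iff)
    show "x \<otimes>\<^bsub>C\<^esub> y \<in> C_V V" using x y subgroup.m_closed[OF C.verbal_subgroup_subgroup]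
      group_hom.hom_mult[OF fam.group_hom_ret] c by (simp add: C_V_iff)
  qed
  fix u x assume u: "u \<in> carrier C" and x: "x \<in> C_V V"
  have "fam.ret b (gconj C u x) = \<one>\<^bsub>A\<^esub>" if "b \<in> carrier B" for b
  proof -
    interpret r: group_hom C A "fam.ret b" by (rule fam.group_hom_ret[OF that])
    show ?thesis using x u c that by (simp add: gconj_def C_V_iff)
  qed
  moreover have "gconj C u x \<in> verbal_subgroup V C"
    using x C.normal_gconj_closed[OF C.verbal_subgroup_normal u] by (simp add: C_V_iff)
  ultimately show "gconj C u x \<in> C_V V" by (simp add: C_V_iff)
qed

lemma ret_shift:
  assumes "b \<in> carrier B" "b' \<in> carrier B" "x \<in> carrier C"
  shows "fam.ret b (shift b' x) = fam.ret (b \<otimes>\<^bsub>B\<^esub> inv\<^bsub>B\<^esub> b') x"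
proof (rule fam.hom_FP_eqI[where f = "\<lambda>x. fam.ret b (shift b' x)" and K = A, OF _ fam.group_hom_ret _ assms(3)])
  show "group_hom C A (\<lambda>x. fam.ret b (shift b' x))"
    using hom_compose[OF group_hom.homh[OF group_hom_shift[OF assms(2)]]
      group_hom.homh[OF fam.group_hom_ret[OF assms(1)]]]
    by (intro group_homI C.group_axioms A.group_axioms) (simp add: comp_def)
  show "b \<otimes>\<^bsub>B\<^esub> inv\<^bsub>B\<^esub> b' \<in> carrier B" using assms by simp
  fix i a assume ia: "i \<in> carrier B" "a \<in> carrier A"
  have "i \<otimes>\<^bsub>B\<^esub> b' = b \<longleftrightarrow> i = b \<otimes>\<^bsub>B\<^esub> inv\<^bsub>B\<^esub> b'"
    using assms ia by (auto simp: B.m_assoc)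
  then show "fam.ret b (shift b' (fam.inc i a)) = fam.ret (b \<otimes>\<^bsub>B\<^esub> inv\<^bsub>B\<^esub> b') (fam.inc i a)"
    using assms ia by (simp add: shift_inc fam.ret_inc)
qed

lemma shift_C_V:
  assumes "b \<in> carrier B" shows "shift b ` C_V V = C_V V"
proof -
  have *: "shift b' x \<in> C_V V" if "b' \<in> carrier B" "x \<in> C_V V" for b' x
  proof -
    have x: "x \<in> verbal_subgroup V C" "x \<in> carrier C"
      using that C.verbal_subgroup_carrier by (auto simp: C_V_iff)
    have "shift b' x \<in> verbal_subgroup V C"
      using x(1) group_hom.verbal_subgroup_image[OF group_hom_shift[OF that(1)]] by blast
    then show ?thesis using that x by (simp add: C_V_iff ret_shift)
  qed
  have "x \<in> shift b ` C_V V" if "x \<in> C_V V" for x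
  proof (rule image_eqI)
    have "x \<in> carrier C" using that C.normal_carrier[OF C_V_normal] by blast
    then show "x = shift b (shift (inv\<^bsub>B\<^esub> b) x)" using assms by (simp add: shift_shift shift_one)
    show "shift (inv\<^bsub>B\<^esub> b) x \<in> C_V V" using assms that by (intro *) auto
  qed
  then show ?thesis using * assms by blast
qed

lemma action_coset:
  assumes "b \<in> carrier B" "g \<in> carrier C"
  shows "wreath_action A B b (C_V V #>\<^bsub>C\<^esub> g) = C_V V #>\<^bsub>C\<^esub> shift b g"
proof -
  have "wreath_action A B b (C_V V #>\<^bsub>C\<^esub> g) = (\<lambda>n. shift b (n \<otimes>\<^bsub>C\<^esub> g)) ` C_V V"
    by (auto simp: wreath_action_def r_coset_def)
  also have "\<dots> = (\<lambda>n. shift b n \<otimes>\<^bsub>C\<^esub> shift b g) ` C_V V"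
    using assms C.normal_carrier[OF C_V_normal] by (intro image_cong) (auto simp: shift_mult)
  also have "\<dots> = (\<lambda>n. n \<otimes>\<^bsub>C\<^esub> shift b g) ` (shift b ` C_V V)" by (simp add: image_image)
  also have "\<dots> = C_V V #>\<^bsub>C\<^esub> shift b g" unfolding shift_C_V[OF assms(1)] by (auto simp: r_coset_def)
  finally show ?thesis .
qed

definition proj :: "law set \<Rightarrow> 'b \<times> ('b \<times> 'a) list set \<Rightarrow> 'b \<times> ('b \<times> 'a) list set set" where
  "proj V = (\<lambda>(b, g). (b, C_V V #>\<^bsub>C\<^esub> g))"

lemma carrier_wreath: "carrier (verbal_wreath V A B) = proj V ` carrier W0"
  by (auto simp: verbal_wreath_def verbal_product_def carrier_FactGroup W0_simps proj_def C_V_def image_iff)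

lemma proj_mult:
  assumes "x \<in> carrier W0" "y \<in> carrier W0"
  shows "proj V (x \<otimes>\<^bsub>W0\<^esub> y) = proj V x \<otimes>\<^bsub>verbal_wreath V A B\<^esub> proj V y"
proof -
  obtain b1 g1 b2 g2 where x: "x = (b1, g1)" "y = (b2, g2)"
    "b1 \<in> carrier B" "b2 \<in> carrier B" "g1 \<in> carrier C" "g2 \<in> carrier C"
    using assms by (auto simp: W0_simps)
  have m: "(C_V V #>\<^bsub>C\<^esub> shift b2 g1) <#>\<^bsub>C\<^esub> (C_V V #>\<^bsub>C\<^esub> g2) = C_V V #>\<^bsub>C\<^esub> (shift b2 g1 \<otimes>\<^bsub>C\<^esub> g2)"
    by (rule normal.rcos_sum[OF C_V_normal shift_closed[OF x(4,5)] x(6)])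
  show ?thesis
    using m action_coset[OF x(4,5), of V] x(1,2)
    by (simp add: W0_simps proj_def verbal_wreath_def verbal_product_def flip: C_V_def)
qed

lemma proj_hom: "proj V \<in> hom W0 (verbal_wreath V A B)"
  by (rule homI) (auto simp: carrier_wreath proj_mult)

lemma one_wreath: "\<one>\<^bsub>verbal_wreath V A B\<^esub> = (\<one>\<^bsub>B\<^esub>, C_V V)"
  by (simp add: verbal_wreath_def verbal_product_def flip: C_V_def)

lemma group_wreath: "group (verbal_wreath V A B)"
proof -
  have "proj V \<one>\<^bsub>W0\<^esub> = \<one>\<^bsub>verbal_wreath V A B\<^esub>"
    using normal_imp_subgroup[OF C_V_normal] C.coset_mult_one[OF subgroup.subset]
    by (simp add: W0_simps proj_def one_wreath)
  moreover have "verbal_wreath V A B\<lparr>carrier := carrier (verbal_wreath V A B),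
      one := \<one>\<^bsub>verbal_wreath V A B\<^esub>\<rparr> = verbal_wreath V A B" by simp
  ultimately show ?thesis
    using group.hom_imp_img_group[OF group_W0 proj_hom[of V]] by (simp flip: carrier_wreath)
qed

lemma proj_eq_one_iff:
  assumes "(b, g) \<in> carrier W0"
  shows "proj V (b, g) = \<one>\<^bsub>verbal_wreath V A B\<^esub> \<longleftrightarrow> b = \<one>\<^bsub>B\<^esub> \<and> g \<in> C_V V"
  using assms C.r_coset_eq_iff[OF normal_imp_subgroup[OF C_V_normal]]
  by (auto simp: proj_def one_wreath W0_simps)

end

section \<open>The kernel of the retraction of a free product of two groups\<close>

context free_product_pair begin

abbreviation "GH \<equiv> G \<star> H"

definition retr where "retr = star_lift H (\<lambda>_. \<one>\<^bsub>H\<^esub>) (\<lambda>b. b)"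

lemma retr_facts:
  shows group_hom_retr: "group_hom GH H retr"
    and retr_inl: "a \<in> carrier G \<Longrightarrow> retr (fp2_inl G H a) = \<one>\<^bsub>H\<^esub>"
    and retr_inr: "b \<in> carrier H \<Longrightarrow> retr (fp2_inr G H b) = b"
proof -
  have h: "(\<lambda>_. \<one>\<^bsub>H\<^esub>) \<in> hom G H" "(\<lambda>b. b) \<in> hom H H" by (simp_all add: hom_def)
  note l = star_lift[OF H.group_axioms h]
  show "group_hom GH H retr" unfolding retr_def by (intro group_homI group_star H.group_axioms l)
  show "a \<in> carrier G \<Longrightarrow> retr (fp2_inl G H a) = \<one>\<^bsub>H\<^esub>" "b \<in> carrier H \<Longrightarrow> retr (fp2_inr G H b) = b"
    unfolding retr_def by (rule l, assumption)+
qed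

sublocale S: group GH by (rule group_star)

abbreviation "inl \<equiv> fp2_inl G H"
abbreviation "inr \<equiv> fp2_inr G H"

sublocale il: group_hom G GH inl by (intro group_homI G.group_axioms group_star inl_hom)
sublocale ir: group_hom H GH inr by (intro group_homI H.group_axioms group_star inr_hom)
sublocale rt: group_hom GH H retr by (rule group_hom_retr)

abbreviation "U \<equiv> conj_subgroup GH (inl ` carrier G) (inr ` carrier H)"

abbreviation "conj_gens \<equiv> (\<Union>u\<in>inr ` carrier H. gconj GH u ` (inl ` carrier G))"

lemma conj_gens_carrier: "conj_gens \<subseteq> carrier GH" by auto

lemma U_subgroup: "subgroup U GH"
  unfolding conj_subgroup_def by (rule S.generate_is_subgroup[OF conj_gens_carrier])

lemma conj_in_U: "u \<in> carrier H \<Longrightarrow> a \<in> carrier G \<Longrightarrow> gconj GH (inr u) (inl a) \<in> U"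
  unfolding conj_subgroup_def by (intro generate.incl UN_I[of "inr u"] imageI)

lemma inl_in_U: "a \<in> carrier G \<Longrightarrow> inl a \<in> U"
  using conj_in_U[of "\<one>\<^bsub>H\<^esub>" a] by simp

lemma U_normal: "U \<lhd> GH"
proof (rule S.normalI_generators[OF U_subgroup _ star_generate])
  show "inl ` carrier G \<union> inr ` carrier H \<subseteq> carrier GH" by auto
  fix x assume x: "x \<in> inl ` carrier G \<union> inr ` carrier H"
  then show "inv\<^bsub>GH\<^esub> x \<in> inl ` carrier G \<union> inr ` carrier H"
    by (elim UnE imageE) (simp_all flip: il.hom_inv ir.hom_inv)
  fix n assume n: "n \<in> U"
  have nc: "n \<in> carrier GH" by (rule subgroup.mem_carrier[OF U_subgroup n])
  from x show "gconj GH x n \<in> U"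
  proof (elim UnE imageE)
    fix a assume a: "x = inl a" "a \<in> carrier G"
    show ?thesis unfolding gconj_def a(1)
      by (intro subgroup.m_closed[OF U_subgroup] subgroup.m_inv_closed[OF U_subgroup] inl_in_U a(2) n)
  next
    fix v assume v: "x = inr v" "v \<in> carrier H"
    have vc: "inr v \<in> carrier GH" using v by simp
    have "gconj GH (inr v) y \<in> U" if "y \<in> conj_gens" for y
    proof -
      obtain u a where y: "y = gconj GH (inr u) (inl a)" "u \<in> carrier H" "a \<in> carrier G"
        using \<open>y \<in> conj_gens\<close> by blast
      then have "gconj GH (inr v) y = gconj GH (inr (u \<otimes>\<^bsub>H\<^esub> v)) (inl a)"
        using S.gconj_gconj[of "inr v" "inr u" "inl a"] v by simp
      then show ?thesis using conj_in_U[of "u \<otimes>\<^bsub>H\<^esub> v" a] y v by simp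
    qed
    then show ?thesis unfolding v(1) conj_subgroup_def
      by (rule S.generate_gconj_closed[OF conj_gens_carrier vc _ conj_gens_carrier
        n[unfolded conj_subgroup_def]])
  qed
qed

text \<open>Every element has the form \<open>inr b \<cdot> n\<close> with \<open>n\<close> in the normal subgroup \<open>U\<close>, and the
  retraction maps it to \<open>b\<close>.\<close>

lemma U_eq_kernel: "U = kernel GH H retr"
proof
  have "conj_gens \<subseteq> kernel GH H retr"
    by (auto simp: kernel_def gconj_def retr_inl retr_inr)
  then show "U \<subseteq> kernel GH H retr"
    unfolding conj_subgroup_def by (rule S.generate_subgroup_incl[OF _ rt.subgroup_kernel])
  have HU: "subgroup (inr ` carrier H <#>\<^bsub>GH\<^esub> U) GH"
    by (rule S.normal_set_mult_subgroup[OF ir.img_is_subgroup U_normal])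
  show "kernel GH H retr \<subseteq> U"
  proof
    fix x assume x: "x \<in> kernel GH H retr"
    then have xc: "x \<in> carrier GH" by (simp add: kernel_def)
    have "inl a \<in> inr ` carrier H <#>\<^bsub>GH\<^esub> U" if "a \<in> carrier G" for a
      using inl_in_U[OF that] S.set_mult_incl_right[OF ir.img_is_subgroup subgroup.subset[OF U_subgroup]] by blast
    moreover have "inr b \<in> inr ` carrier H <#>\<^bsub>GH\<^esub> U" if "b \<in> carrier H" for b
      using that S.set_mult_incl_left[OF U_normal subgroup.subset[OF ir.img_is_subgroup]] by blast
    ultimately have "x \<in> inr ` carrier H <#>\<^bsub>GH\<^esub> U" using star_subgroup_eq[OF HU _ _ xc] by blast
    then obtain b n where bn: "x = inr b \<otimes>\<^bsub>GH\<^esub> n" "b \<in> carrier H" "n \<in> U"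
      unfolding set_mult_iff by blast
    have "retr n = \<one>\<^bsub>H\<^esub>" "n \<in> carrier GH"
      using bn(3) \<open>U \<subseteq> kernel GH H retr\<close> by (auto simp: kernel_def)
    then have "b = \<one>\<^bsub>H\<^esub>" using x bn(1,2) by (simp add: kernel_def retr_inr)
    then show "x \<in> U" using bn \<open>n \<in> carrier GH\<close> by simp
  qed
qed

end

section \<open>The kernel of the presentation of a verbal wreath product\<close>

locale wreath_presentation = wreath A B + pair: free_product_pair F\<^sub>1 F\<^sub>2
  for A :: "'a monoid" and B :: "'b monoid" and F\<^sub>1 :: "'f monoid" and F\<^sub>2 :: "'g monoid" +
  fixes \<nu>\<^sub>1 :: "'f \<Rightarrow> 'a" and \<nu>\<^sub>2 :: "'g \<Rightarrow> 'b" and V :: "law set"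
  assumes nu1: "\<nu>\<^sub>1 \<in> epi F\<^sub>1 A" and nu2: "\<nu>\<^sub>2 \<in> epi F\<^sub>2 B"
begin

sublocale n1: group_hom F\<^sub>1 A \<nu>\<^sub>1
  by (intro group_homI pair.G.group_axioms A.group_axioms) (use nu1 in \<open>simp add: epi_def\<close>)

sublocale n2: group_hom F\<^sub>2 B \<nu>\<^sub>2
  by (intro group_homI pair.H.group_axioms B.group_axioms) (use nu2 in \<open>simp add: epi_def\<close>)

abbreviation "F \<equiv> F\<^sub>1 \<star> F\<^sub>2"
abbreviation "inl \<equiv> fp2_inl F\<^sub>1 F\<^sub>2"
abbreviation "inr \<equiv> fp2_inr F\<^sub>1 F\<^sub>2"
abbreviation "X1 \<equiv> inl ` carrier F\<^sub>1"
abbreviation "X2 \<equiv> inr ` carrier F\<^sub>2"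
abbreviation "W \<equiv> verbal_wreath V A B"
abbreviation "U \<equiv> pair.U"
abbreviation "FU \<equiv> F\<lparr>carrier := U\<rparr>"
abbreviation "R1 \<equiv> inl ` kernel F\<^sub>1 A \<nu>\<^sub>1"
abbreviation "R2 \<equiv> inr ` kernel F\<^sub>2 B \<nu>\<^sub>2"

sublocale FU: group FU by (rule pair.S.subgroup_imp_group[OF pair.U_subgroup])

lemma U_carrier: "x \<in> U \<Longrightarrow> x \<in> carrier F"
  by (rule subgroup.mem_carrier[OF pair.U_subgroup])

lemma inv_FU: "x \<in> U \<Longrightarrow> inv\<^bsub>FU\<^esub> x = inv\<^bsub>F\<^esub> x"
  by (rule pair.S.m_inv_consistent[OF pair.U_subgroup])

lemma gcomm_FU: "x \<in> U \<Longrightarrow> y \<in> U \<Longrightarrow> gcomm FU x y = gcomm F x y"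
  by (simp add: gcomm_def inv_FU)

definition "\<pi>0 = pair.star_lift W0 (\<lambda>f. (\<one>\<^bsub>B\<^esub>, fam.inc \<one>\<^bsub>B\<^esub> (\<nu>\<^sub>1 f))) (\<lambda>u. (\<nu>\<^sub>2 u, \<one>\<^bsub>C\<^esub>))"

lemma pi0:
  shows group_hom_pi0: "group_hom F W0 \<pi>0"
    and pi0_inl: "f \<in> carrier F\<^sub>1 \<Longrightarrow> \<pi>0 (inl f) = (\<one>\<^bsub>B\<^esub>, fam.inc \<one>\<^bsub>B\<^esub> (\<nu>\<^sub>1 f))"
    and pi0_inr: "u \<in> carrier F\<^sub>2 \<Longrightarrow> \<pi>0 (inr u) = (\<nu>\<^sub>2 u, \<one>\<^bsub>C\<^esub>)"
proof -
  have 1: "(\<lambda>f. (\<one>\<^bsub>B\<^esub>, fam.inc \<one>\<^bsub>B\<^esub> (\<nu>\<^sub>1 f))) \<in> hom F\<^sub>1 W0"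
    by (rule homI) (simp_all add: W0_simps fam.inc_closed shift_one hom_mult[OF fam.inc_hom])
  have 2: "(\<lambda>u. (\<nu>\<^sub>2 u, \<one>\<^bsub>C\<^esub>)) \<in> hom F\<^sub>2 W0"
    by (rule homI) (simp_all add: W0_simps shift_1)
  note l = pair.star_lift[OF group_W0 1 2]
  show "group_hom F W0 \<pi>0" unfolding \<pi>0_def by (intro group_homI pair.group_star group_W0 l)
  show "f \<in> carrier F\<^sub>1 \<Longrightarrow> \<pi>0 (inl f) = (\<one>\<^bsub>B\<^esub>, fam.inc \<one>\<^bsub>B\<^esub> (\<nu>\<^sub>1 f))"
    "u \<in> carrier F\<^sub>2 \<Longrightarrow> \<pi>0 (inr u) = (\<nu>\<^sub>2 u, \<one>\<^bsub>C\<^esub>)"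
    unfolding \<pi>0_def by (rule l, assumption)+
qed

sublocale pi0: group_hom F W0 \<pi>0 by (rule group_hom_pi0)

lemma fst_pi0:
  assumes "x \<in> carrier F" shows "fst (\<pi>0 x) = \<nu>\<^sub>2 (pair.retr x)"
proof (rule pair.star_hom_eqI[where f = "\<lambda>x. fst (\<pi>0 x)" and K = B, OF _ _ _ _ assms])
  have "fst \<in> hom W0 B" by (rule homI) (auto simp: W0_simps)
  then show "group_hom F B (\<lambda>x. fst (\<pi>0 x))"
    using hom_compose[OF pi0.homh] by (intro group_homI pair.group_star B.group_axioms) (simp add: comp_def)
  show "group_hom F B (\<lambda>x. \<nu>\<^sub>2 (pair.retr x))"
    using hom_compose[OF pair.rt.homh n2.homh]
    by (intro group_homI pair.group_star B.group_axioms) (simp add: comp_def)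
qed (simp_all add: pi0_inl pi0_inr pair.retr_inl pair.retr_inr)

definition "\<rho> x = snd (\<pi>0 x)"

lemma pi0_U: "x \<in> U \<Longrightarrow> \<pi>0 x = (\<one>\<^bsub>B\<^esub>, \<rho> x)"
  using fst_pi0[OF U_carrier, of x] pair.U_eq_kernel
  by (simp add: \<rho>_def kernel_def prod_eq_iff)

lemma rho_closed: "x \<in> U \<Longrightarrow> \<rho> x \<in> carrier C"
  using pi0.hom_closed[OF U_carrier, of x] by (simp add: pi0_U W0_simps)

lemma group_hom_rho: "group_hom FU C \<rho>"
proof (intro group_homI FU.group_axioms C.group_axioms homI)
  fix x y assume x: "x \<in> carrier FU" and y: "y \<in> carrier FU"
  then show "\<rho> x \<in> carrier C" using rho_closed by simp
  have "\<pi>0 (x \<otimes>\<^bsub>F\<^esub> y) = (\<one>\<^bsub>B\<^esub>, \<rho> x) \<otimes>\<^bsub>W0\<^esub> (\<one>\<^bsub>B\<^esub>, \<rho> y)"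
    using x y U_carrier pi0_U by simp
  then show "\<rho> (x \<otimes>\<^bsub>FU\<^esub> y) = \<rho> x \<otimes>\<^bsub>C\<^esub> \<rho> y"
    using x rho_closed[of x] by (simp add: \<rho>_def[of "x \<otimes>\<^bsub>F\<^esub> y"] W0_simps shift_one)
qed

sublocale rho: group_hom FU C \<rho> by (rule group_hom_rho)

lemma rho_conj:
  assumes u: "u \<in> carrier F\<^sub>2" and f: "f \<in> carrier F\<^sub>1"
  shows "\<rho> (gconj F (inr u) (inl f)) = fam.inc (\<nu>\<^sub>2 u) (\<nu>\<^sub>1 f)"
proof -
  let ?b = "\<nu>\<^sub>2 u" and ?a = "\<nu>\<^sub>1 f"
  let ?v = "(?b, \<one>\<^bsub>C\<^esub>)" and ?y = "(\<one>\<^bsub>B\<^esub>, fam.inc \<one>\<^bsub>B\<^esub> ?a)" and ?x = "(\<one>\<^bsub>B\<^esub>, fam.inc ?b ?a)"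
  have c: "?v \<in> carrier W0" "?y \<in> carrier W0" "?x \<in> carrier W0"
    using u f by (simp_all add: W0_simps fam.inc_closed)
  have e: "?y \<otimes>\<^bsub>W0\<^esub> ?v = ?v \<otimes>\<^bsub>W0\<^esub> ?x"
    using u f by (simp add: W0_simps shift_inc shift_1 fam.inc_closed)
  have "\<pi>0 (gconj F (inr u) (inl f)) = gconj W0 ?v ?y"
    using pair.S.gconj_image_hom[OF group_hom_pi0, of "inr u" "inl f"] u f
    by (simp add: pi0_inl pi0_inr)
  also have "\<dots> = inv\<^bsub>W0\<^esub> ?v \<otimes>\<^bsub>W0\<^esub> (?y \<otimes>\<^bsub>W0\<^esub> ?v)"
    unfolding gconj_def by (rule pi0.H.m_assoc) (use c in auto)
  also have "\<dots> = ?x" unfolding e by (rule pi0.H.inv_mult_cancel(1)[OF c(1,3)])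
  finally show ?thesis by (simp add: \<rho>_def)
qed

section \<open>The kernel of the map onto the free product of copies of \<open>A\<close>\<close>

text \<open>The factors of $S_V$ that do not depend on the laws.\<close>

definition "K = normal_closure F (comm_subgroup F R2 X1) <#>\<^bsub>F\<^esub> normal_closure F R1"

lemma R_carrier: "R1 \<subseteq> carrier F" "R2 \<subseteq> carrier F" "X1 \<subseteq> carrier F"
  by (auto simp: kernel_def)

lemma comm_R2_carrier: "comm_subgroup F R2 X1 \<subseteq> carrier F"
proof (rule pair.S.comm_subgroup_minimal[OF pair.S.subgroup_self])
  show "gcomm F x y \<in> carrier F" if "x \<in> R2" "y \<in> X1" for x y
    using that R_carrier by (intro pair.S.gcomm_closed) auto
qed

lemma normal_closures:
  "normal_closure F (comm_subgroup F R2 X1) \<lhd> F" "normal_closure F R1 \<lhd> F"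
  by (rule pair.S.normal_closure_normal[OF comm_R2_carrier],
    rule pair.S.normal_closure_normal[OF R_carrier(1)])

lemma K_normal: "K \<lhd> F"
  unfolding K_def by (rule pair.S.normal_set_mult_normal[OF normal_closures])

lemma gcomm_in_K:
  assumes "x \<in> R2" "y \<in> X1" shows "gcomm F x y \<in> K"
proof -
  have "gcomm F x y \<in> normal_closure F (comm_subgroup F R2 X1)"
    by (rule pair.S.normal_closure_incl[OF comm_R2_carrier pair.S.comm_subgroup_incl[OF assms]])
  then show ?thesis unfolding K_def
    using pair.S.set_mult_incl_left[OF normal_closures(2) subgroup.subset[OF normal_imp_subgroup[OF normal_closures(1)]]]
    by blast
qed

lemma R1_in_K: "R1 \<subseteq> K"
proof -
  have "R1 \<subseteq> normal_closure F R1" using pair.S.normal_closure_incl[OF R_carrier(1)] by blast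
  also have "\<dots> \<subseteq> K" unfolding K_def
    by (rule pair.S.set_mult_incl_right[OF normal_imp_subgroup[OF normal_closures(1)]
      subgroup.subset[OF normal_imp_subgroup[OF normal_closures(2)]]])
  finally show ?thesis .
qed

lemma pi0_R1: "x \<in> R1 \<Longrightarrow> \<pi>0 x = \<one>\<^bsub>W0\<^esub>"
  using group_hom.hom_one[OF fam.group_hom_inc[OF B.one_closed]]
  by (auto simp: kernel_def pi0_inl W0_simps)

lemma pi0_R2: "x \<in> R2 \<Longrightarrow> \<pi>0 x = \<one>\<^bsub>W0\<^esub>"
  by (auto simp: kernel_def pi0_inr W0_simps)

lemma K_le_kernel: "K \<subseteq> kernel F W0 \<pi>0"
  unfolding K_def
proof (rule pair.S.set_mult_minimal[OF pi0.subgroup_kernel])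
  show "normal_closure F R1 \<subseteq> kernel F W0 \<pi>0"
    by (rule pair.S.normal_closure_minimal[OF pi0.normal_kernel])
      (use R_carrier pi0_R1 in \<open>auto simp: kernel_def[of F]\<close>)
  have "gcomm F x y \<in> kernel F W0 \<pi>0" if "x \<in> R2" "y \<in> X1" for x y
  proof (rule pair.S.normal_gcomm_left[OF pi0.normal_kernel])
    show "x \<in> kernel F W0 \<pi>0" "y \<in> carrier F"
      using that R_carrier pi0_R2 by (auto simp: kernel_def[of F])
  qed
  then show "normal_closure F (comm_subgroup F R2 X1) \<subseteq> kernel F W0 \<pi>0"
    by (intro pair.S.normal_closure_minimal[OF pi0.normal_kernel]
      pair.S.comm_subgroup_minimal[OF pi0.subgroup_kernel])
qed

lemma K_le_U: "K \<subseteq> U"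
  unfolding K_def
proof (rule pair.S.set_mult_minimal[OF pair.U_subgroup])
  have l: "X1 \<subseteq> U" using pair.inl_in_U by blast
  then show "normal_closure F R1 \<subseteq> U"
    by (intro pair.S.normal_closure_minimal[OF pair.U_normal]) (auto simp: kernel_def)
  have "gcomm F x y \<in> U" if "x \<in> R2" "y \<in> X1" for x y
    by (rule pair.S.normal_gcomm_right[OF pair.U_normal]) (use that R_carrier l in auto)
  then show "normal_closure F (comm_subgroup F R2 X1) \<subseteq> U"
    by (intro pair.S.normal_closure_minimal[OF pair.U_normal]
      pair.S.comm_subgroup_minimal[OF pair.U_subgroup])
qed

text \<open>Arbitrary preimages; those of elements of \<open>B\<close> represent the cosets of \<open>R2\<close>.\<close>

definition "s1 = inv_into (carrier F\<^sub>1) \<nu>\<^sub>1"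
definition "s2 = inv_into (carrier F\<^sub>2) \<nu>\<^sub>2"

lemma s1: "a \<in> carrier A \<Longrightarrow> s1 a \<in> carrier F\<^sub>1" "a \<in> carrier A \<Longrightarrow> \<nu>\<^sub>1 (s1 a) = a"
  using nu1 unfolding s1_def epi_def by (auto intro: inv_into_into f_inv_into_f)

lemma s2: "b \<in> carrier B \<Longrightarrow> s2 b \<in> carrier F\<^sub>2" "b \<in> carrier B \<Longrightarrow> \<nu>\<^sub>2 (s2 b) = b"
  using nu2 unfolding s2_def epi_def by (auto intro: inv_into_into f_inv_into_f)

text \<open>Modulo \<open>K\<close> the conjugate of \<open>f\<close> by \<open>u\<close> depends only on the images of \<open>f\<close> in \<open>A\<close> and of \<open>u\<close>
  in \<open>B\<close>: elements of \<open>R1\<close> vanish, and elements of \<open>R2\<close> commute with \<open>f\<close>. The universal property of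
  the free product \<open>C\<close> turns this into a homomorphism \<open>C \<rightarrow> F/K\<close> whose composition with \<open>\<rho>\<close> is the
  natural map.\<close>

lemma kernel_rho_le_K:
  assumes x: "x \<in> U" "\<rho> x = \<one>\<^bsub>C\<^esub>" shows "x \<in> K"
proof -
  obtain Q :: "(bool \<times> ('f + 'g)) list set set monoid" and q where q: "group_hom F Q q"
    and "q ` carrier F = carrier Q" and q1: "\<forall>x\<in>carrier F. q x = \<one>\<^bsub>Q\<^esub> \<longleftrightarrow> x \<in> K"
    by (rule pair.S.quotient_hom[OF K_normal])
  interpret q: group_hom F Q q by (rule q)
  have qinl: "q (inl f) = q (inl f')"
    if "f \<in> carrier F\<^sub>1" "f' \<in> carrier F\<^sub>1" "\<nu>\<^sub>1 f = \<nu>\<^sub>1 f'" for f f'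
  proof -
    let ?r = "f \<otimes>\<^bsub>F\<^sub>1\<^esub> inv\<^bsub>F\<^sub>1\<^esub> f'"
    have "?r \<in> kernel F\<^sub>1 A \<nu>\<^sub>1" using that by (simp add: kernel_def)
    then have "inl ?r \<in> K" using R1_in_K by blast
    moreover have "inl ?r \<in> carrier F" using that by simp
    ultimately have "q (inl ?r) = \<one>\<^bsub>Q\<^esub>" using q1 by blast
    then have "q (inl f) \<otimes>\<^bsub>Q\<^esub> inv\<^bsub>Q\<^esub> q (inl f') = \<one>\<^bsub>Q\<^esub>" using that by simp
    then show ?thesis using that q.H.inv_solve_right'[of "\<one>\<^bsub>Q\<^esub>" "q (inl f)" "q (inl f')"] by simp
  qed
  have qconj: "q (gconj F (inr u) (inl f)) = q (gconj F (inr u') (inl f))"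
    if uf: "u \<in> carrier F\<^sub>2" "u' \<in> carrier F\<^sub>2" "f \<in> carrier F\<^sub>1" and e: "\<nu>\<^sub>2 u = \<nu>\<^sub>2 u'" for u u' f
  proof -
    let ?r = "u \<otimes>\<^bsub>F\<^sub>2\<^esub> inv\<^bsub>F\<^sub>2\<^esub> u'"
    have rR: "inr ?r \<in> R2" using uf e by (intro imageI) (simp add: kernel_def)
    have c: "inr ?r \<in> carrier F" "inl f \<in> carrier F" "inr u' \<in> carrier F" using uf by simp_all
    have g: "gcomm F (inr ?r) (inl f) \<in> K" by (rule gcomm_in_K[OF rR]) (use uf in blast)
    have gc: "gcomm F (inr ?r) (inl f) \<in> carrier F" by (rule pair.S.gcomm_closed[OF c(1,2)])
    have "gconj F (inr ?r) (inl f) = inl f \<otimes>\<^bsub>F\<^esub> inv\<^bsub>F\<^esub> gcomm F (inr ?r) (inl f)"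
      using c by (simp add: gconj_def gcomm_def pair.S.m_assoc pair.S.inv_mult_group)
    moreover have "q (gcomm F (inr ?r) (inl f)) = \<one>\<^bsub>Q\<^esub>" using q1 g gc by blast
    ultimately have "q (gconj F (inr ?r) (inl f)) = q (inl f)" using c gc by simp
    moreover have "inr u = inr ?r \<otimes>\<^bsub>F\<^esub> inr u'"
      using uf by (simp add: pair.S.m_assoc)
    then have "gconj F (inr u) (inl f) = gconj F (inr u') (gconj F (inr ?r) (inl f))"
      using pair.S.gconj_gconj[OF c(3,1,2)] by simp
    ultimately show ?thesis
      using pair.S.gconj_image_hom[OF q c(3) pair.S.gconj_closed[OF c(1,2)]]
        pair.S.gconj_image_hom[OF q c(3,2)] by simp
  qed
  define \<sigma> where "\<sigma> b a = q (gconj F (inr (s2 b)) (inl (s1 a)))" for b a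
  interpret \<sigma>: group_family_hom "carrier B" "\<lambda>_. A" Q \<sigma>
  proof (intro group_family_hom.intro group_family_hom_axioms.intro fam.group_family_axioms q.H.group_axioms homI)
    fix b a a' assume b: "b \<in> carrier B" and a: "a \<in> carrier A" "a' \<in> carrier A"
    have c: "inr (s2 b) \<in> carrier F" "inl (s1 a) \<in> carrier F" "inl (s1 a') \<in> carrier F"
      "inl (s1 (a \<otimes>\<^bsub>A\<^esub> a')) \<in> carrier F"
      using b a s1 s2 by simp_all
    show "\<sigma> b a \<in> carrier Q"
      unfolding \<sigma>_def by (rule q.hom_closed[OF pair.S.gconj_closed[OF c(1,2)]])
    have "q (inl (s1 (a \<otimes>\<^bsub>A\<^esub> a'))) = q (inl (s1 a \<otimes>\<^bsub>F\<^sub>1\<^esub> s1 a'))"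
      by (rule qinl) (use a s1 in simp_all)
    also have "\<dots> = q (inl (s1 a)) \<otimes>\<^bsub>Q\<^esub> q (inl (s1 a'))" using a s1 by simp
    finally have e: "q (inl (s1 (a \<otimes>\<^bsub>A\<^esub> a'))) = q (inl (s1 a)) \<otimes>\<^bsub>Q\<^esub> q (inl (s1 a'))" .
    show "\<sigma> b (a \<otimes>\<^bsub>A\<^esub> a') = \<sigma> b a \<otimes>\<^bsub>Q\<^esub> \<sigma> b a'"
      unfolding \<sigma>_def pair.S.gconj_image_hom[OF q c(1,2)] pair.S.gconj_image_hom[OF q c(1,3)]
        pair.S.gconj_image_hom[OF q c(1,4)] e
      by (rule q.H.gconj_mult) (use c in simp_all)
  qed
  let ?L = "fp_lift Q \<sigma>"
  have "?L (\<rho> x) = q x"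
  proof (rule hom_eq_on_generate[where f = "\<lambda>x. ?L (\<rho> x)" and G = FU and K = Q and X = pair.conj_gens])
    show "group_hom FU Q (\<lambda>x. ?L (\<rho> x))"
      using hom_compose[OF rho.homh \<sigma>.lift_hom]
      by (intro group_homI FU.group_axioms q.H.group_axioms) (simp add: comp_def)
    show "group_hom FU Q q"
      by (intro group_homI FU.group_axioms q.H.group_axioms homI) (simp_all add: U_carrier)
    have gU: "pair.conj_gens \<subseteq> U" using pair.conj_in_U by blast
    then show "pair.conj_gens \<subseteq> carrier FU" by simp
    show "x \<in> generate FU pair.conj_gens"
      using x(1) pair.S.generate_consistent[OF gU pair.U_subgroup]
      by (simp add: conj_subgroup_def)
    fix y assume "y \<in> pair.conj_gens"
    then obtain u f where y: "y = gconj F (inr u) (inl f)" and uf: "u \<in> carrier F\<^sub>2" "f \<in> carrier F\<^sub>1"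
      by blast
    have nb: "\<nu>\<^sub>2 u \<in> carrier B" "\<nu>\<^sub>1 f \<in> carrier A" using uf by simp_all
    have c: "inr u \<in> carrier F" "inl f \<in> carrier F" "inl (s1 (\<nu>\<^sub>1 f)) \<in> carrier F"
      using uf s1[OF nb(2)] by simp_all
    have "?L (\<rho> y) = q (gconj F (inr (s2 (\<nu>\<^sub>2 u))) (inl (s1 (\<nu>\<^sub>1 f))))"
      using rho_conj[OF uf] \<sigma>.lift_inc[OF nb] by (simp add: y \<sigma>_def)
    also have "\<dots> = q (gconj F (inr u) (inl (s1 (\<nu>\<^sub>1 f))))"
      by (rule qconj) (use uf s1[OF nb(2)] s2[OF nb(1)] in simp_all)
    also have "\<dots> = q y"
      unfolding y pair.S.gconj_image_hom[OF q c(1,2)] pair.S.gconj_image_hom[OF q c(1,3)]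
      using qinl[OF s1(1)[OF nb(2)] uf(2) s1(2)[OF nb(2)]] by simp
    finally show "?L (\<rho> y) = q y" .
  qed
  then have "q x = \<one>\<^bsub>Q\<^esub>" using x(2) group_hom.hom_one[OF \<sigma>.group_hom_lift] by simp
  then show ?thesis using q1 U_carrier[OF x(1)] by blast
qed

section \<open>The laws and the cartesian subgroup\<close>

abbreviation "RV \<equiv> R_V V F X1 X2 R2"

abbreviation "conjF u \<equiv> gconj F u ` X1"

abbreviation "T_gens \<equiv> {gcomm F x y | x y u v.
  u \<in> X2 \<and> v \<in> X2 \<and> R2 #>\<^bsub>F\<^esub> u \<noteq> R2 #>\<^bsub>F\<^esub> v \<and>
  x \<in> normal_closure FU (conjF u) \<and> y \<in> normal_closure FU (conjF v)}"

lemma RV_iff: "x \<in> RV \<longleftrightarrow> x \<in> verbal_subgroup V FU \<and> x \<in> generate F T_gens"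
  by (simp add: R_V_def Let_def)

lemma R2_coset_eq_iff:
  assumes "u \<in> carrier F\<^sub>2" "v \<in> carrier F\<^sub>2"
  shows "R2 #>\<^bsub>F\<^esub> inr u = R2 #>\<^bsub>F\<^esub> inr v \<longleftrightarrow> \<nu>\<^sub>2 u = \<nu>\<^sub>2 v"
proof
  have R2: "subgroup R2 F" by (rule pair.ir.subgroup_img_is_subgroup[OF n2.subgroup_kernel])
  have c: "inr u \<in> carrier F" "inr v \<in> carrier F" using assms by simp_all
  {
    assume "R2 #>\<^bsub>F\<^esub> inr u = R2 #>\<^bsub>F\<^esub> inr v"
    then have "inr u \<in> R2 #>\<^bsub>F\<^esub> inr v" using pair.S.rcos_self[OF c(1) R2] by simp
    then obtain k where k: "k \<in> kernel F\<^sub>2 B \<nu>\<^sub>2" and e: "inr u = inr k \<otimes>\<^bsub>F\<^esub> inr v"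
      by (auto simp: r_coset_def)
    have kc: "k \<in> carrier F\<^sub>2" "\<nu>\<^sub>2 k = \<one>\<^bsub>B\<^esub>" using k by (auto simp: kernel_def)
    have "pair.retr (inr u) = pair.retr (inr k \<otimes>\<^bsub>F\<^esub> inr v)" using e by simp
    then have "u = k \<otimes>\<^bsub>F\<^sub>2\<^esub> v" using kc assms by (simp add: pair.retr_inr)
    then show "\<nu>\<^sub>2 u = \<nu>\<^sub>2 v" using kc assms by simp
  }
  {
    assume e: "\<nu>\<^sub>2 u = \<nu>\<^sub>2 v"
    let ?k = "u \<otimes>\<^bsub>F\<^sub>2\<^esub> inv\<^bsub>F\<^sub>2\<^esub> v"
    have k: "inr ?k \<in> R2" using assms e by (intro imageI) (simp add: kernel_def)
    have "inr u = inr ?k \<otimes>\<^bsub>F\<^esub> inr v" using assms by (simp add: pair.S.m_assoc)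
    then have "inr u \<in> R2 #>\<^bsub>F\<^esub> inr v" using k unfolding r_coset_def by blast
    then show "R2 #>\<^bsub>F\<^esub> inr u = R2 #>\<^bsub>F\<^esub> inr v"
      by (rule pair.S.repr_independence[OF _ c(2) R2, symmetric])
  }
qed

lemma conjF_carrier: "u \<in> X2 \<Longrightarrow> conjF u \<subseteq> carrier FU"
  using pair.conj_in_U by auto

lemma group_hom_ret_rho:
  assumes "b \<in> carrier B" shows "group_hom FU A (\<lambda>x. fam.ret b (\<rho> x))"
  using hom_compose[OF rho.homh group_hom.homh[OF fam.group_hom_ret[OF assms]]]
  by (intro group_homI FU.group_axioms A.group_axioms) (simp add: comp_def)

lemma ret_rho_normal_closure:
  assumes u: "u \<in> carrier F\<^sub>2" and b: "b \<in> carrier B" "b \<noteq> \<nu>\<^sub>2 u"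
    and x: "x \<in> normal_closure FU (conjF (inr u))"
  shows "fam.ret b (\<rho> x) = \<one>\<^bsub>A\<^esub>"
proof -
  interpret r: group_hom FU A "\<lambda>x. fam.ret b (\<rho> x)" by (rule group_hom_ret_rho[OF b(1)])
  have "fam.ret b (\<rho> (gconj F (inr u) (inl f))) = \<one>\<^bsub>A\<^esub>" if "f \<in> carrier F\<^sub>1" for f
    unfolding rho_conj[OF u that] using fam.ret_inc[OF b(1), of "\<nu>\<^sub>2 u" "\<nu>\<^sub>1 f"] b u that by auto
  then have "conjF (inr u) \<subseteq> kernel FU A (\<lambda>x. fam.ret b (\<rho> x))"
    using pair.conj_in_U[OF u] by (auto simp: kernel_def)
  from FU.normal_closure_minimal[OF r.normal_kernel this] show ?thesis
    using x by (auto simp: kernel_def)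
qed

text \<open>For elements $x$ and $y$ of the normal closures of $F_1^u$ and $F_1^v$ the image of $[x,y]$ in \<open>C\<close> has
  trivial \<open>b\<close>-component for every \<open>b\<close>, since \<open>b\<close> differs from \<open>\<nu>\<^sub>2 u\<close> or from \<open>\<nu>\<^sub>2 v\<close>.\<close>

lemma rho_T:
  assumes "x \<in> generate F T_gens" and b: "b \<in> carrier B"
  shows "x \<in> U \<and> fam.ret b (\<rho> x) = \<one>\<^bsub>A\<^esub>"
proof -
  interpret r: group_hom FU A "\<lambda>x. fam.ret b (\<rho> x)" by (rule group_hom_ret_rho[OF b])
  let ?k = "kernel FU A (\<lambda>x. fam.ret b (\<rho> x))"
  have k: "subgroup ?k F"
    by (rule pair.S.incl_subgroup[OF pair.U_subgroup r.subgroup_kernel])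
  have "T_gens \<subseteq> ?k"
  proof clarify
    fix x y u v assume u: "u \<in> carrier F\<^sub>2" and v: "v \<in> carrier F\<^sub>2"
      and ne: "R2 #>\<^bsub>F\<^esub> inr u \<noteq> R2 #>\<^bsub>F\<^esub> inr v"
      and x: "x \<in> normal_closure FU (conjF (inr u))" and y: "y \<in> normal_closure FU (conjF (inr v))"
    have c: "x \<in> carrier FU" "y \<in> carrier FU"
      using x y FU.normal_carrier[OF FU.normal_closure_normal[OF conjF_carrier]] u v by blast+
    have "\<nu>\<^sub>2 u \<noteq> \<nu>\<^sub>2 v" using R2_coset_eq_iff[OF u v] ne by simp
    then have "b \<noteq> \<nu>\<^sub>2 u \<or> b \<noteq> \<nu>\<^sub>2 v" by auto
    then have "x \<in> ?k \<or> y \<in> ?k"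
      using ret_rho_normal_closure[OF u b _ x] ret_rho_normal_closure[OF v b _ y] c by (auto simp: kernel_def)
    then have "gcomm FU x y \<in> ?k"
      using FU.normal_gcomm_left[OF r.normal_kernel _ c(2)] FU.normal_gcomm_right[OF r.normal_kernel c(1)] by blast
    then show "gcomm F x y \<in> ?k" using gcomm_FU c by simp
  qed
  then have "generate F T_gens \<subseteq> ?k" by (rule pair.S.generate_subgroup_incl[OF _ k])
  then show ?thesis using assms(1) by (auto simp: kernel_def)
qed

lemma rho_RV: "x \<in> RV \<Longrightarrow> x \<in> U \<and> \<rho> x \<in> C_V V"
  using rho_T rho.verbal_subgroup_image[of V] FU.verbal_subgroup_carrier[of V]
  by (auto simp: RV_iff C_V_iff)

text \<open>The free product \<open>E\<close> of copies of \<open>F\<^sub>1\<close> lies over \<open>C\<close>, and it is mapped to \<open>U\<close> by sending the copies to the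
  conjugates of \<open>F\<^sub>1\<close> by coset representatives of \<open>R2\<close>. In \<open>E\<close>, unlike in \<open>U\<close>, the components of an element
  are available from the universal property.\<close>

sublocale fam1: group_family "carrier B" "\<lambda>_. F\<^sub>1"
  by (rule group_family.intro) (rule pair.G.group_axioms)

abbreviation "E \<equiv> free_product (carrier B) (\<lambda>_. F\<^sub>1)"

sublocale E: group E by (rule fam1.group_FP)

sublocale phi: group_family_hom "carrier B" "\<lambda>_. F\<^sub>1" C "\<lambda>b f. fam.inc b (\<nu>\<^sub>1 f)"
proof (intro group_family_hom.intro group_family_hom_axioms.intro fam1.group_family_axioms C.group_axioms)
  show "(\<lambda>f. fam.inc b (\<nu>\<^sub>1 f)) \<in> hom F\<^sub>1 C" if "b \<in> carrier B" for b
    using hom_compose[OF n1.homh fam.inc_hom[OF that]] by (simp add: comp_def)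
qed

sublocale eps: group_family_hom "carrier B" "\<lambda>_. F\<^sub>1" FU "\<lambda>b f. gconj F (inr (s2 b)) (inl f)"
proof (intro group_family_hom.intro group_family_hom_axioms.intro fam1.group_family_axioms FU.group_axioms homI)
  fix b f f' assume b: "b \<in> carrier B" and f: "f \<in> carrier F\<^sub>1" "f' \<in> carrier F\<^sub>1"
  show "gconj F (inr (s2 b)) (inl f) \<in> carrier FU"
    using pair.conj_in_U[OF s2(1)[OF b] f(1)] by simp
  show "gconj F (inr (s2 b)) (inl (f \<otimes>\<^bsub>F\<^sub>1\<^esub> f')) =
    gconj F (inr (s2 b)) (inl f) \<otimes>\<^bsub>FU\<^esub> gconj F (inr (s2 b)) (inl f')"
    using pair.S.gconj_mult[of "inr (s2 b)" "inl f" "inl f'"] s2(1)[OF b] f by simp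
qed

definition "\<phi> = fp_lift C (\<lambda>b f. fam.inc b (\<nu>\<^sub>1 f))"
definition "\<epsilon> = fp_lift FU (\<lambda>b f. gconj F (inr (s2 b)) (inl f))"

sublocale ph: group_hom E C \<phi> unfolding \<phi>_def by (rule phi.group_hom_lift)
sublocale ep: group_hom E FU \<epsilon> unfolding \<epsilon>_def by (rule eps.group_hom_lift)

lemma phi_inc: "b \<in> carrier B \<Longrightarrow> f \<in> carrier F\<^sub>1 \<Longrightarrow> \<phi> (fam1.inc b f) = fam.inc b (\<nu>\<^sub>1 f)"
  unfolding \<phi>_def by (rule phi.lift_inc)

lemma eps_inc: "b \<in> carrier B \<Longrightarrow> f \<in> carrier F\<^sub>1 \<Longrightarrow> \<epsilon> (fam1.inc b f) = gconj F (inr (s2 b)) (inl f)"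
  unfolding \<epsilon>_def by (rule eps.lift_inc)

lemma rho_eps:
  assumes "e \<in> carrier E" shows "\<rho> (\<epsilon> e) = \<phi> e"
proof (rule fam1.hom_FP_eqI[where f = "\<lambda>e. \<rho> (\<epsilon> e)", OF _ ph.group_hom_axioms _ assms])
  show "group_hom E C (\<lambda>e. \<rho> (\<epsilon> e))"
    using hom_compose[OF ep.homh rho.homh] by (intro group_homI E.group_axioms C.group_axioms) (simp add: comp_def)
qed (simp add: eps_inc phi_inc rho_conj s2)

lemma phi_surj: "\<phi> ` carrier E = carrier C"
proof
  show "\<phi> ` carrier E \<subseteq> carrier C" by auto
  have s: "subgroup (\<phi> ` carrier E) C" by (rule ph.img_is_subgroup)
  show "carrier C \<subseteq> \<phi> ` carrier E"
  proof
    fix x assume x: "x \<in> carrier C"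
    show "x \<in> \<phi> ` carrier E"
    proof (rule fam.FP_subgroup_eq[OF s _ x])
      fix b a assume "b \<in> carrier B" "a \<in> carrier A"
      then have "fam.inc b a = \<phi> (fam1.inc b (s1 a))" "fam1.inc b (s1 a) \<in> carrier E"
        by (simp_all add: phi_inc s1 fam1.inc_closed)
      then show "fam.inc b a \<in> \<phi> ` carrier E" by blast
    qed
  qed
qed

lemma ret_phi:
  assumes "b \<in> carrier B" "e \<in> carrier E" shows "\<nu>\<^sub>1 (fam1.ret b e) = fam.ret b (\<phi> e)"
proof (rule fam1.hom_FP_eqI[where f = "\<lambda>e. \<nu>\<^sub>1 (fam1.ret b e)" and g = "\<lambda>e. fam.ret b (\<phi> e)" and K = A,
    OF _ _ _ assms(2)])
  show "group_hom E A (\<lambda>e. \<nu>\<^sub>1 (fam1.ret b e))"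
    using hom_compose[OF group_hom.homh[OF fam1.group_hom_ret[OF assms(1)]] n1.homh]
    by (intro group_homI E.group_axioms A.group_axioms) (simp add: comp_def)
  show "group_hom E A (\<lambda>e. fam.ret b (\<phi> e))"
    using hom_compose[OF ph.homh group_hom.homh[OF fam.group_hom_ret[OF assms(1)]]]
    by (intro group_homI E.group_axioms A.group_axioms) (simp add: comp_def)
qed (simp add: phi_inc fam1.ret_inc fam.ret_inc assms)

lemma eps_cross_comm: "m \<in> fam1.cross_comm \<Longrightarrow> \<epsilon> m \<in> generate F T_gens"
proof -
  have Tc: "T_gens \<subseteq> U"
  proof clarify
    fix x y u v assume "u \<in> carrier F\<^sub>2" "v \<in> carrier F\<^sub>2"
      and "x \<in> normal_closure FU (conjF (inr u))" "y \<in> normal_closure FU (conjF (inr v))"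
    then have "x \<in> carrier FU" "y \<in> carrier FU"
      using FU.normal_carrier[OF FU.normal_closure_normal[OF conjF_carrier]] by blast+
    then show "gcomm F x y \<in> U" using FU.gcomm_closed[of x y] gcomm_FU[of x y] by simp
  qed
  have TU: "generate F T_gens = generate FU T_gens"
    by (rule pair.S.generate_consistent[OF Tc pair.U_subgroup, symmetric])
  define T where "T = generate F T_gens"
  have sT: "subgroup T FU"
    unfolding T_def TU by (rule FU.generate_is_subgroup) (use Tc in simp)
  have "fam1.cross_comm \<subseteq> {e \<in> carrier E. \<epsilon> e \<in> T}"
    unfolding fam1.cross_comm_def normal_closure_def[of E]
  proof (rule E.generate_subgroup_incl[OF _ ep.subgroup_vimage[OF sT]], clarify)
    fix g i j f f' assume g: "g \<in> carrier E" and ij: "i \<in> carrier B" "j \<in> carrier B" "i \<noteq> j"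
      and f: "f \<in> carrier F\<^sub>1" "f' \<in> carrier F\<^sub>1"
    let ?x = "fam1.inc i f" and ?y = "fam1.inc j f'"
    have c: "?x \<in> carrier E" "?y \<in> carrier E" using ij f by (simp_all add: fam1.inc_closed)
    have n: "\<epsilon> (gconj E g (fam1.inc b h)) \<in> normal_closure FU (conjF (inr (s2 b)))"
      if b: "b \<in> carrier B" and h: "h \<in> carrier F\<^sub>1" for b h
    proof -
      have u: "inr (s2 b) \<in> X2" using s2(1)[OF b] by blast
      have "\<epsilon> (fam1.inc b h) \<in> conjF (inr (s2 b))" unfolding eps_inc[OF b h] using h by blast
      then have "\<epsilon> (fam1.inc b h) \<in> normal_closure FU (conjF (inr (s2 b)))"
        by (rule FU.normal_closure_incl[OF conjF_carrier[OF u]])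
      then have "gconj FU (\<epsilon> g) (\<epsilon> (fam1.inc b h)) \<in> normal_closure FU (conjF (inr (s2 b)))"
        by (rule FU.normal_gconj_closed[OF FU.normal_closure_normal[OF conjF_carrier[OF u]] ep.hom_closed[OF g]])
      then show ?thesis using E.gconj_image_hom[OF ep.group_hom_axioms g fam1.inc_closed[OF b h]] by simp
    qed
    have gc: "gconj E g ?x \<in> carrier E" "gconj E g ?y \<in> carrier E"
      using E.gconj_closed[OF g] c by blast+
    have "\<epsilon> (gconj E g (gcomm E ?x ?y)) = gcomm FU (\<epsilon> (gconj E g ?x)) (\<epsilon> (gconj E g ?y))"
      using E.gconj_gcomm[OF g c] E.gcomm_hom[OF ep.group_hom_axioms gc] by simp
    also have "\<dots> = gcomm F (\<epsilon> (gconj E g ?x)) (\<epsilon> (gconj E g ?y))"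
      using ep.hom_closed[OF gc(1)] ep.hom_closed[OF gc(2)] by (simp add: gcomm_FU)
    also have "\<dots> \<in> T_gens"
    proof -
      have "R2 #>\<^bsub>F\<^esub> inr (s2 i) \<noteq> R2 #>\<^bsub>F\<^esub> inr (s2 j)"
        using R2_coset_eq_iff[OF s2(1)[OF ij(1)] s2(1)[OF ij(2)]] s2(2) ij by simp
      moreover have "inr (s2 i) \<in> X2" "inr (s2 j) \<in> X2"
        using s2(1) ij by blast+
      ultimately show ?thesis using n[OF ij(1) f(1)] n[OF ij(2) f(2)] by blast
    qed
    finally have "\<epsilon> (gconj E g (gcomm E ?x ?y)) \<in> T" unfolding T_def by (rule generate.incl)
    then show "gconj E g (gcomm E ?x ?y) \<in> carrier E \<and> \<epsilon> (gconj E g (gcomm E ?x ?y)) \<in> T"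
      using E.gconj_closed[OF g E.gcomm_closed[OF c]] by blast
  qed
  then show "m \<in> fam1.cross_comm \<Longrightarrow> \<epsilon> m \<in> generate F T_gens" unfolding T_def by blast
qed

text \<open>A preimage \<open>e\<close> of \<open>g\<close> in the verbal subgroup of \<open>E\<close> is the product of an element \<open>m\<close> of the
  cartesian subgroup and an element \<open>y\<close> generated by the components of \<open>e\<close>. The components are in
  the verbal subgroup as well. They are trivial in \<open>C\<close>, because \<open>g\<close> is in the cartesian subgroup. So \<open>m\<close>
  is a preimage of \<open>g\<close> that is in both subgroups.\<close>

lemma C_V_lift:
  assumes "g \<in> C_V V" obtains x where "x \<in> RV" "\<rho> x = g"
proof -
  have g: "g \<in> verbal_subgroup V C" "b \<in> carrier B \<Longrightarrow> fam.ret b g = \<one>\<^bsub>A\<^esub>" for b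
    using assms by (auto simp: C_V_iff)
  obtain e where e: "e \<in> verbal_subgroup V E" "\<phi> e = g"
    using ph.verbal_subgroup_image_epi[OF phi_surj, of V] g(1) by blast
  have ec: "e \<in> carrier E" using e(1) E.verbal_subgroup_carrier by blast
  let ?X = "{fam1.inc b (fam1.ret b e) | b. b \<in> carrier B}"
  obtain m y where m: "m \<in> fam1.cross_comm" and y: "y \<in> generate E ?X" and emy: "e = m \<otimes>\<^bsub>E\<^esub> y"
    using fam1.FP_decomposition[OF ec] by blast
  have rc: "fam1.ret b e \<in> carrier F\<^sub>1" if "b \<in> carrier B" for b
    by (rule group_hom.hom_closed[OF fam1.group_hom_ret[OF that] ec])
  have XV: "?X \<subseteq> verbal_subgroup V E"
  proof clarify
    fix b assume b: "b \<in> carrier B"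
    have "fam1.ret b e \<in> verbal_subgroup V F\<^sub>1"
      using group_hom.verbal_subgroup_image[OF fam1.group_hom_ret[OF b]] e(1) by blast
    then show "fam1.inc b (fam1.ret b e) \<in> verbal_subgroup V E"
      using group_hom.verbal_subgroup_image[OF fam1.group_hom_inc[OF b]] by blast
  qed
  have yV: "y \<in> verbal_subgroup V E"
    using E.generate_subgroup_incl[OF XV E.verbal_subgroup_subgroup] y by blast
  have yc: "y \<in> carrier E" using yV E.verbal_subgroup_carrier by blast
  have mc: "m \<in> carrier E" by (rule E.normal_carrier[OF fam1.cross_comm_normal m])
  have "?X \<subseteq> kernel E C \<phi>"
  proof clarify
    fix b assume b: "b \<in> carrier B"
    have "\<nu>\<^sub>1 (fam1.ret b e) = \<one>\<^bsub>A\<^esub>" using ret_phi[OF b ec] e(2) g(2)[OF b] by simp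
    then have "\<phi> (fam1.inc b (fam1.ret b e)) = \<one>\<^bsub>C\<^esub>"
      using phi_inc[OF b rc[OF b]] group_hom.hom_one[OF fam.group_hom_inc[OF b]] by simp
    then show "fam1.inc b (fam1.ret b e) \<in> kernel E C \<phi>"
      using fam1.inc_closed[OF b rc[OF b]] by (simp add: kernel_def)
  qed
  from E.generate_subgroup_incl[OF this ph.subgroup_kernel] have "\<phi> y = \<one>\<^bsub>C\<^esub>"
    using y by (auto simp: kernel_def)
  then have phm: "\<phi> m = g" using e(2) emy mc yc by simp
  have "m = e \<otimes>\<^bsub>E\<^esub> inv\<^bsub>E\<^esub> y" using emy mc yc by (simp add: E.m_assoc)
  also have "\<dots> \<in> verbal_subgroup V E"
    by (intro subgroup.m_closed[OF E.verbal_subgroup_subgroup]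
      subgroup.m_inv_closed[OF E.verbal_subgroup_subgroup] e(1) yV)
  finally have "\<epsilon> m \<in> verbal_subgroup V FU" using ep.verbal_subgroup_image by blast
  then have "\<epsilon> m \<in> RV" using eps_cross_comm[OF m] by (simp add: RV_iff)
  moreover have "\<rho> (\<epsilon> m) = g" using rho_eps[OF mc] phm by simp
  ultimately show thesis by (rule that)
qed

definition "\<pi> x = proj V (\<pi>0 x)"

abbreviation "R \<equiv> kernel F W \<pi>"

lemma group_hom_pi: "group_hom F W \<pi>"
  using hom_compose[OF pi0.homh proj_hom[of V]]
  by (intro group_homI pair.group_star group_wreath) (simp add: comp_def \<pi>_def[abs_def])

sublocale pi: group_hom F "W" \<pi> by (rule group_hom_pi)

lemma kernel_pi_iff:
  "x \<in> R \<longleftrightarrow> x \<in> carrier F \<and> \<nu>\<^sub>2 (pair.retr x) = \<one>\<^bsub>B\<^esub> \<and> \<rho> x \<in> C_V V"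
proof -
  have "\<pi> x = \<one>\<^bsub>W\<^esub> \<longleftrightarrow> \<nu>\<^sub>2 (pair.retr x) = \<one>\<^bsub>B\<^esub> \<and> \<rho> x \<in> C_V V"
    if x: "x \<in> carrier F" for x
  proof -
    have e: "\<pi>0 x = (\<nu>\<^sub>2 (pair.retr x), \<rho> x)" using fst_pi0[OF x] by (simp add: \<rho>_def prod_eq_iff)
    then show ?thesis
      using proj_eq_one_iff[of "\<nu>\<^sub>2 (pair.retr x)" "\<rho> x" V] pi0.hom_closed[OF x] by (simp add: \<pi>_def)
  qed
  then show ?thesis unfolding kernel_def by blast
qed

lemma pi_epi: "\<pi> \<in> epi F W"
proof -
  have s: "subgroup (\<pi>0 ` carrier F) W0" by (rule pi0.img_is_subgroup)
  interpret W0: group W0 by (rule group_W0)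
  have U: "g \<in> \<rho> ` U" if "g \<in> carrier C" for g
  proof -
    obtain e where "e \<in> carrier E" "g = \<phi> e" using \<open>g \<in> carrier C\<close> phi_surj by blast
    then have "g = \<rho> (\<epsilon> e)" "\<epsilon> e \<in> U" using rho_eps ep.hom_closed[of e] by auto
    then show ?thesis by blast
  qed
  have "(b, g) \<in> \<pi>0 ` carrier F" if b: "b \<in> carrier B" and g: "g \<in> carrier C" for b g
  proof -
    obtain x where x: "x \<in> U" "g = \<rho> x" using U[OF g] by blast
    have xc: "x \<in> carrier F" by (rule U_carrier[OF x(1)])
    have "\<pi>0 (inr (s2 b) \<otimes>\<^bsub>F\<^esub> x) = (b, \<one>\<^bsub>C\<^esub>) \<otimes>\<^bsub>W0\<^esub> (\<one>\<^bsub>B\<^esub>, g)"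
      using xc s2[OF b] pi0_U[OF x(1)] x(2) by (simp add: pi0_inr)
    also have "\<dots> = (b, g)" using b g by (simp add: W0_simps shift_1)
    finally have "(b, g) = \<pi>0 (inr (s2 b) \<otimes>\<^bsub>F\<^esub> x)" by simp
    moreover have "inr (s2 b) \<otimes>\<^bsub>F\<^esub> x \<in> carrier F" using xc s2(1)[OF b] by simp
    ultimately show ?thesis by (rule image_eqI)
  qed
  then have "carrier W0 \<subseteq> \<pi>0 ` carrier F" by (auto simp: W0_simps)
  moreover have "\<pi>0 ` carrier F \<subseteq> carrier W0" using pi0.hom_closed by blast
  ultimately have "\<pi>0 ` carrier F = carrier W0" by blast
  then have "\<pi> ` carrier F = carrier W"
    unfolding carrier_wreath \<pi>_def by (simp add: image_image flip: \<open>\<pi>0 ` carrier F = carrier W0\<close>)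
  then show ?thesis using pi.homh by (simp add: epi_def)
qed

abbreviation "SV \<equiv> S_V V F X1 X2 R1 R2"

text \<open>An element \<open>x\<close> of the right-hand side is mapped by \<open>\<rho>\<close> into \<open>C_V\<close>. Some \<open>t\<close> in \<open>R_V\<close> has the same image,
  and the quotient of \<open>x\<close> by \<open>t\<close> is in the kernel \<open>K\<close> of \<open>\<rho>\<close>.\<close>

lemma S_V_eq: "SV = R \<inter> kernel F F\<^sub>2 pair.retr"
proof -
  have S: "SV = K <#>\<^bsub>F\<^esub> RV" by (simp add: S_V_def K_def)
  have U: "x \<in> U \<longleftrightarrow> x \<in> carrier F \<and> pair.retr x = \<one>\<^bsub>F\<^sub>2\<^esub>" for x
    unfolding pair.U_eq_kernel kernel_def by simp
  have i: "x \<in> R \<inter> kernel F F\<^sub>2 pair.retr \<longleftrightarrow> x \<in> U \<and> \<rho> x \<in> C_V V" for x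
    unfolding U Int_iff kernel_pi_iff by (auto simp: kernel_def)
  have K: "k \<in> U \<and> \<rho> k = \<one>\<^bsub>C\<^esub>" if "k \<in> K" for k
    using that K_le_U K_le_kernel by (auto simp: kernel_def \<rho>_def W0_simps)
  show ?thesis
  proof (intro subset_antisym subsetI)
    fix x assume "x \<in> SV"
    then obtain k t where kt: "k \<in> K" "t \<in> RV" "x = k \<otimes>\<^bsub>F\<^esub> t" unfolding S set_mult_iff by blast
    have "x \<in> U" "\<rho> x = \<rho> t"
      using K[OF kt(1)] rho_RV[OF kt(2)] rho.hom_mult[of k t] subgroup.m_closed[OF pair.U_subgroup, of k t] kt(3)
        rho_closed[of t] by simp_all
    then show "x \<in> R \<inter> kernel F F\<^sub>2 pair.retr"
      using rho_RV[OF kt(2)] unfolding i by simp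
  next
    fix x assume "x \<in> R \<inter> kernel F F\<^sub>2 pair.retr"
    then have x: "x \<in> U" "\<rho> x \<in> C_V V" unfolding i by simp_all
    obtain t where t: "t \<in> RV" "\<rho> t = \<rho> x" by (rule C_V_lift[OF x(2)])
    have tU: "t \<in> U" using rho_RV[OF t(1)] by simp
    let ?k = "x \<otimes>\<^bsub>F\<^esub> inv\<^bsub>F\<^esub> t"
    have kU: "?k \<in> U"
      by (intro subgroup.m_closed[OF pair.U_subgroup] subgroup.m_inv_closed[OF pair.U_subgroup] x tU)
    have "\<rho> ?k = \<rho> x \<otimes>\<^bsub>C\<^esub> inv\<^bsub>C\<^esub> \<rho> t"
      using rho.hom_mult[of x "inv\<^bsub>FU\<^esub> t"] rho.hom_inv[of t] FU.inv_closed[of t] x(1) tU inv_FU[OF tU] by simp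
    also have "\<dots> = \<one>\<^bsub>C\<^esub>" using t(2) rho_closed[OF x(1)] by simp
    finally have "?k \<in> K" by (rule kernel_rho_le_K[OF kU])
    moreover have "x = ?k \<otimes>\<^bsub>F\<^esub> t" using U_carrier[OF x(1)] U_carrier[OF tU] by (simp add: pair.S.m_assoc)
    ultimately show "x \<in> SV" unfolding S set_mult_iff using t(1) by blast
  qed
qed

sublocale split: split_presentation F F\<^sub>2 inr pair.retr "X1"
  "R" "kernel F\<^sub>2 B \<nu>\<^sub>2"
proof (intro split_presentation.intro split_presentation_axioms.intro)
  show "group F" "group F\<^sub>2" by (rule pair.group_star, rule pair.H.group_axioms)
  show "inr \<in> hom F\<^sub>2 F" "pair.retr \<in> hom F F\<^sub>2" by (rule pair.ir.homh, rule pair.rt.homh)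
  show "pair.retr (inr y) = y" if "y \<in> carrier F\<^sub>2" for y by (rule pair.retr_inr[OF that])
  show "subgroup X1 F" by (rule pair.il.img_is_subgroup)
  show "pair.retr x = \<one>\<^bsub>F\<^sub>2\<^esub>" if "x \<in> X1" for x using that pair.retr_inl by auto
  show "carrier F = generate F (X1 \<union> X2)" by (rule pair.star_generate)
  show "R \<lhd> F" by (rule pi.normal_kernel)
  show "kernel F\<^sub>2 B \<nu>\<^sub>2 \<lhd> F\<^sub>2" by (rule n2.normal_kernel)
  show "R2 \<subseteq> R"
  proof
    fix x assume x: "x \<in> R2"
    then have "\<rho> x = \<one>\<^bsub>C\<^esub>" "x \<in> carrier F" using pi0_R2[OF x] R_carrier by (auto simp: \<rho>_def W0_simps)
    moreover have "\<nu>\<^sub>2 (pair.retr x) = \<one>\<^bsub>B\<^esub>" using x by (auto simp: kernel_def pair.retr_inr)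
    ultimately show "x \<in> R"
      unfolding kernel_pi_iff using C.normal_one_closed[OF C_V_normal] by simp
  qed
  show "pair.retr ` R \<subseteq> kernel F\<^sub>2 B \<nu>\<^sub>2"
    using kernel_pi_iff by (auto simp: kernel_def[of F\<^sub>2])
qed

theorem baer_invariant_wreath:
  assumes free: "is_free_on F\<^sub>1 X" "is_free_on F\<^sub>2 Y"
  shows "baer_invariant c W \<cong> baer_invariant c B \<times>\<times>
    (F\<lparr>carrier := SV \<inter> lower_central F (c + 1)\<rparr> Mod
      (prod_comm c F X1 X2 R2 <#>\<^bsub>F\<^esub> iter_comm F SV c (carrier F)))"
    (is "_ \<cong> _ \<times>\<times> ?Z")
proof -
    have 1: "baer_invariant c W \<cong> baer_invariant_of c F (R)"
  proof -
    obtain h where h: "h \<in> hom F (free_group (carrier W))"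
      "\<And>x. x \<in> carrier F \<Longrightarrow> free_group_lift W (\<lambda>g. g) (h x) = \<pi> x"
      using pair.star_projective[OF free group_free_group group_wreath free_group_lift_epi[OF group_wreath] pi.homh]
      by blast
    show ?thesis
    proof (rule baer_invariant_presentation[OF pair.group_star group_wreath pi_epi h])
      fix f assume "f \<in> hom (free_group (carrier W)) W"
      then show "\<exists>k\<in>hom (free_group (carrier W)) F. \<forall>x\<in>carrier (free_group (carrier W)). \<pi> (k x) = f x"
        using free_group_projective[OF pair.group_star group_wreath pi_epi] by metis
    qed
  qed
  have 2: "baer_invariant c B \<cong> baer_invariant_of c F\<^sub>2 (kernel F\<^sub>2 B \<nu>\<^sub>2)"
  proof -
    obtain h where h: "h \<in> hom F\<^sub>2 (free_group (carrier B))"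
      "\<And>x. x \<in> carrier F\<^sub>2 \<Longrightarrow> free_group_lift B (\<lambda>g. g) (h x) = \<nu>\<^sub>2 x"
      using free_on_projective[OF free(2) group_free_group B.group_axioms free_group_lift_epi[OF B.group_axioms] n2.homh]
      by blast
    show ?thesis
    proof (rule baer_invariant_presentation[OF pair.H.group_axioms B.group_axioms nu2 h])
      fix f assume "f \<in> hom (free_group (carrier B)) B"
      then show "\<exists>k\<in>hom (free_group (carrier B)) F\<^sub>2. \<forall>x\<in>carrier (free_group (carrier B)). \<nu>\<^sub>2 (k x) = f x"
        using free_group_projective[OF pair.H.group_axioms B.group_axioms nu2] by metis
    qed
  qed
  have S: "split.S = SV" by (simp add: split.S_def S_V_eq)
  have 3: "baer_invariant_of c F (R) \<cong> baer_invariant_of c F\<^sub>2 (kernel F\<^sub>2 B \<nu>\<^sub>2) \<times>\<times> ?Z"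
    using split.baer_invariant_of_split[of c] unfolding S .
  have g: "group (baer_invariant c B)"
  proof -
    have l: "free_group_lift B (\<lambda>g. g) \<in> hom (free_group (carrier B)) B"
      using free_group_lift_epi[OF B.group_axioms] by (simp add: epi_def)
    note n = group_hom.normal_kernel[OF group_homI[OF group_free_group B.group_axioms l]]
    show ?thesis unfolding baer_invariant_def baer_invariant_of_def
      by (rule normal.factorgroup_is_group[OF group.baer_subgroups(2)[OF group_free_group n]])
  qed
  have 4: "baer_invariant_of c F\<^sub>2 (kernel F\<^sub>2 B \<nu>\<^sub>2) \<times>\<times> ?Z \<cong> baer_invariant c B \<times>\<times> ?Z"
    by (rule group.DirProd_iso_trans[OF split.baer_group group.iso_sym[OF g 2] iso_refl])
  show ?thesis by (rule iso_trans[OF 1 iso_trans[OF 3 4]])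
qed

end

theorem theorem4p2:
  fixes c :: nat and V :: "law set"
    and A :: "'a monoid" and B :: "'b monoid"
    and F\<^sub>1 :: "'f monoid" and F\<^sub>2 :: "'g monoid"
    and \<nu>\<^sub>1 :: "'f \<Rightarrow> 'a" and \<nu>\<^sub>2 :: "'g \<Rightarrow> 'b"
  assumes "c \<ge> 1" and "group A" and "group B"
    and "free_presentation F\<^sub>1 \<nu>\<^sub>1 A" and "free_presentation F\<^sub>2 \<nu>\<^sub>2 B"
  shows
    "let F = F\<^sub>1 \<star> F\<^sub>2;
         F1 = fp2_inl F\<^sub>1 F\<^sub>2 ` carrier F\<^sub>1;
         F2 = fp2_inr F\<^sub>1 F\<^sub>2 ` carrier F\<^sub>2;
         R1 = fp2_inl F\<^sub>1 F\<^sub>2 ` kernel F\<^sub>1 A \<nu>\<^sub>1;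
         R2 = fp2_inr F\<^sub>1 F\<^sub>2 ` kernel F\<^sub>2 B \<nu>\<^sub>2;
         S = S_V V F F1 F2 R1 R2
     in baer_invariant c (verbal_wreath V A B) \<cong>
        baer_invariant c B \<times>\<times>
          (F\<lparr>carrier := S \<inter> lower_central F (c + 1)\<rparr> Mod
             (prod_comm c F F1 F2 R2 <#>\<^bsub>F\<^esub> iter_comm F S c (carrier F)))"
proof -
  obtain X Y where free: "is_free_on F\<^sub>1 X" "is_free_on F\<^sub>2 Y"
    and nu: "\<nu>\<^sub>1 \<in> epi F\<^sub>1 A" "\<nu>\<^sub>2 \<in> epi F\<^sub>2 B"
    using assms(4,5) by (auto simp: free_presentation_def)
  have "group F\<^sub>1" "group F\<^sub>2" using free by (auto simp: is_free_on_def)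
  then interpret wreath_presentation A B F\<^sub>1 F\<^sub>2 \<nu>\<^sub>1 \<nu>\<^sub>2 V
    using assms(2,3) nu
    by (intro wreath_presentation.intro wreath.intro free_product_pair.intro wreath_presentation_axioms.intro)
  show ?thesis unfolding Let_def by (rule baer_invariant_wreath[OF free])
qed

end
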